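(* Let $1<p<\infty$, let $n\in\{1,2,\ldots\}$, and let $F=(f_1,\ldots,f_n)\in L^p(\mathbb{R}^d;\mathbb{R}^n)$. Then $$\int_{\mathbb{R}^d}|F(x)|^p\,dx=\int_0^\infty\int_{\mathbb{R}^d}\int_{\mathbb{R}^d}\mathcal{F}_p\big(P_tF(x),P_tF(y)\big)\,\nu(x,y)\,dx\,dy\,dt.$$
   Context: Setting. Let $d\ge 1$. Let $\nu:\mathbb{R}^d\setminus\{0\}\to(0,\infty)$ be a Borel function with $\nu(-z)=\nu(z)$ and $\int_{\mathbb{R}^d}(|z|^2\wedge 1)\nu(z)\,dz<\infty$. Put $\psi(\xi):=\int_{\mathbb{R}^d}(1-\cos(\xi\cdot x))\nu(x)\,dx$ for $\xi\in\mathbb{R}^d$, and assume $\lim_{|\xi|\to\infty}\psi(\xi)/\log|\xi|=\infty$. Let $p_t(x):=(2\pi)^{-d}\int_{\mathbb{R}^d}e^{-i\xi\cdot x}e^{-t\psi(\xi)}\,d\xi$ for $t>0$, $x\in\mathbb{R}^d$ (a convolution semigroup of probability densities), $p_t(x,y):=p_t(y-x)$ and $\nu(x,y):=\nu(y-x)$. Assume moreover that there is a constant $c$ with $p_t(x,y)/t\le c\,\nu(x,y)$ for all $t>0$ and $x\ne y$, and that $p_t(x,y)/t\to\nu(x,y)$ as $t\to0^+$ for all $x\neq y$. For $f\in L^p(\mathbb{R}^d)$ let $P_tf(x):=\int_{\mathbb{R}^d}f(y)p_t(x,y)\,dy$ for $t>0$, and $P_0f:=f$. All functions are Borel; $|\cdot|$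 is the Euclidean norm and $\cdot$ the Euclidean scalar product. For $F=(f_1,\dots,f_n)\in L^p(\mathbb{R}^d;\mathbb{R}^n)$ let $P_tF:=(P_tf_1,\ldots,P_tf_n)$. For $z\in\mathbb{R}^n$ and $\kappa>0$ let $z^{\langle\kappa\rangle}:=|z|^{\kappa-1}z$, with $0^{\langle\kappa\rangle}:=0$. The Bregman divergence is $\mathcal{F}_p(w,z):=|z|^p-|w|^p-p\,w^{\langle p-1\rangle}\cdot(z-w)$ for $w,z\in\mathbb{R}^n$ (it is nonnegative). *)

theory Defs
  imports "HOL-Analysis.Analysis"
begin

text \<open>
  A density \<open>\<nu>\<close> on the punctured space is represented by a total function whose value at the
  origin is arbitrary. That value is immaterial for everything below: \<open>1 - cos (\<xi> \<bullet> 0) = 0\<close>,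
  and the Bregman divergence of a point from itself is \<open>0\<close>.
\<close>

definition levy_exponent :: "(real^'d \<Rightarrow> real) \<Rightarrow> real^'d \<Rightarrow> real" where
  "levy_exponent \<nu> \<xi> = (LINT x|lborel. (1 - cos (\<xi> \<bullet> x)) * \<nu> x)"

text \<open>
  The inverse Fourier transform below is real because \<open>levy_exponent \<nu>\<close> is an even function, so \<open>Re\<close> only changes the type.
\<close>

definition heat_kernel :: "(real^'d \<Rightarrow> real) \<Rightarrow> real \<Rightarrow> real^'d \<Rightarrow> real" where
  "heat_kernel \<nu> t x =
     Re (complex_of_real ((2 * pi) powr (- real CARD('d))) *
       (LINT \<xi>|lborel. exp (- \<i> * complex_of_real (\<xi> \<bullet> x)) *
          complex_of_real (exp (- t * levy_exponent \<nu> \<xi>))))"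

text \<open>Only used for \<open>t \<ge> 0\<close>.\<close>

definition heat_semigroup :: "(real^'d \<Rightarrow> real) \<Rightarrow> real \<Rightarrow> (real^'d \<Rightarrow> real) \<Rightarrow> real^'d \<Rightarrow> real" where
  "heat_semigroup \<nu> t f x =
     (if t = 0 then f x else (LINT y|lborel. f y * heat_kernel \<nu> t (y - x)))"

definition vec_heat_semigroup ::
    "(real^'d \<Rightarrow> real) \<Rightarrow> real \<Rightarrow> (real^'d \<Rightarrow> real^'n) \<Rightarrow> real^'d \<Rightarrow> real^'n" where
  "vec_heat_semigroup \<nu> t F x = (\<chi> i. heat_semigroup \<nu> t (\<lambda>y. F y $ i) x)"

text \<open>Membership of a Borel representative in the Lebesgue space with exponent \<open>p\<close>.\<close>

definition in_Lp :: "real \<Rightarrow> (real^'d \<Rightarrow> real^'n) \<Rightarrow> bool" where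
  "in_Lp p F \<longleftrightarrow> F \<in> borel_measurable borel \<and> integrable lborel (\<lambda>x. norm (F x) powr p)"

definition french_power :: "real^'n \<Rightarrow> real \<Rightarrow> real^'n" where
  "french_power z \<kappa> = (if z = 0 then 0 else norm z powr (\<kappa> - 1) *\<^sub>R z)"

definition bregman :: "real \<Rightarrow> real^'n \<Rightarrow> real^'n \<Rightarrow> real" where
  "bregman p w z = norm z powr p - norm w powr p - p * (french_power w (p - 1) \<bullet> (z - w))"

end

theory Submission
  imports Defs "HOL-Probability.Characteristic_Functions" "HOL-Probability.Sinc_Integral"
begin

text \<open>
  Write \<open>u\<^sub>t = P\<^sub>t F\<close> and \<open>a t = \<integral> |u\<^sub>t|^p\<close>. The identity says that \<open>a\<close> decreases from \<open>a 0\<close> to \<open>0\<close> and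
  that the rate of decrease at time \<open>t\<close> is \<open>D t = \<integral>\<integral> \<F> (u\<^sub>t x) (u\<^sub>t y) \<nu> (y - x)\<close>, where \<open>\<F>\<close> is the
  Bregman divergence. A proof by differentiation would use analyticity of the semigroup on the Lebesgue space;
  here everything is done with difference quotients.

  The source of all estimates is a bias-variance identity (\<open>bregman_variance\<close>): for the probability
  density \<open>k\<^sub>h (y - x)\<close> in \<open>y\<close>, whose mean of \<open>u\<close> is \<open>P\<^sub>h u x\<close>, and any vector \<open>w\<close>,
  \<open>\<integral> \<F> w (u y) k\<^sub>h (y - x) dy = P\<^sub>h |u|^p x - |P\<^sub>h u x|^p + \<F> w (P\<^sub>h u x)\<close>.
  Integrating in \<open>x\<close> and using \<open>\<integral> P\<^sub>h |u|^p = \<integral> |u|^p\<close> gives two statements about \<open>u = u\<^sub>t\<close>: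

  \<^item> With \<open>w = P\<^sub>h u x\<close>, the decrement \<open>a t - a (t + h)\<close> equals
    \<open>\<integral>\<integral> \<F> (u\<^bsub>t+h\<^esub> x) (u\<^sub>t y) k\<^sub>h (y - x)\<close> (\<open>energy_identity\<close>). Dividing by \<open>h\<close>, integrating in \<open>t\<close> and
    letting \<open>h \<rightarrow> 0\<close>, Fatou's lemma and \<open>k\<^sub>h / h \<rightarrow> \<nu>\<close> give \<open>\<integral> D \<le> a 0\<close> (\<open>dissipation_le_energy\<close>).
  \<^item> With \<open>w = u x\<close>, the decrement is at most \<open>\<integral>\<integral> \<F> (u\<^sub>t x) (u\<^sub>t y) k\<^sub>h (y - x)\<close>
    (\<open>energy_upper_bound\<close>). Now both arguments of \<open>\<F>\<close> belong to the same time, so \<open>k\<^sub>h / h \<le> c \<nu>\<close> bounds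
    the integrand by \<open>c\<close> times that of \<open>D\<close>, which is integrable by the first part. Dominated
    convergence gives \<open>a 0 \<le> a T + \<integral> D\<close> over \<open>{0<..T}\<close> (\<open>energy_le_dissipation\<close>).

  Besides, \<open>a T \<rightarrow> 0\<close> as \<open>T \<rightarrow> \<infinity>\<close> because \<open>k\<^sub>T\<close> tends to \<open>0\<close> uniformly (\<open>power_energy_vanishes\<close>), and \<open>a\<close> has
  no downward jump at \<open>0\<close> because \<open>u\<^sub>t \<rightarrow> F\<close> almost everywhere along a sequence
  (\<open>power_energy_lower_semicontinuous\<close>).

  It remains to see that the inverse Fourier transforms \<open>k\<^sub>t\<close> of \<open>exp (- t \<psi>)\<close> form a convolution semigroup of
  probability densities. They are nonnegative because multiplication by the cosine transform of a nonnegative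
  function preserves positivity of the Fourier transform; applied to the powers
  \<open>(1 + t c / n)^n\<close>, where \<open>c\<close> is the cosine transform of a truncation of \<open>\<nu>\<close>, this yields \<open>exp (- t \<psi>)\<close> in the limit
  (\<open>levy_fourier_cos_nonneg\<close>). Fourier inversion, proved by Gaussian regularization, then returns \<open>exp (- t \<psi>)\<close>
  as the transform of \<open>k\<^sub>t\<close> (\<open>fourier_inversion\<close>). Hence \<open>k\<^sub>t\<close> has mass \<open>1\<close>, and convolution of kernels
  corresponds to multiplication of exponentials (\<open>K_conv\<close>).
\<close>

section \<open>Translations and reflections of Lebesgue measure\<close>

lemma lborel_distr_reflect:
  "distr lborel borel (\<lambda>x. a - x) = (lborel :: 'a::euclidean_space measure)"
  using lborel_affine[of "-1::real" a] by (simp add: density_1)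

lemma nn_integral_translate:
  fixes f :: "'a::euclidean_space \<Rightarrow> ennreal"
  assumes [measurable]: "f \<in> borel_measurable borel"
  shows "(\<integral>\<^sup>+x. f (a + x) \<partial>lborel) = (\<integral>\<^sup>+x. f x \<partial>lborel)"
  by (subst lborel_distr_plus[of a, symmetric], subst nn_integral_distr) auto

lemma has_bochner_integral_translate:
  fixes f :: "'a::euclidean_space \<Rightarrow> 'b::{banach,second_countable_topology}"
  assumes "has_bochner_integral lborel f I"
  shows "has_bochner_integral lborel (\<lambda>x. f (a + x)) I"
  using assms integrable_distr_eq[of "(+) a" lborel borel f] integral_distr[of "(+) a" lborel borel f]
  by (auto simp: has_bochner_integral_iff lborel_distr_plus dest!: borel_measurable_integrable)

lemma has_bochner_integral_reflect:
  fixes f :: "'a::euclidean_space \<Rightarrow> 'b::{banach,second_countable_topology}"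
  assumes "has_bochner_integral lborel f I"
  shows "has_bochner_integral lborel (\<lambda>x. f (a - x)) I"
  using assms integrable_distr_eq[of "(-) a" lborel borel f] integral_distr[of "(-) a" lborel borel f]
  by (auto simp: has_bochner_integral_iff lborel_distr_reflect dest!: borel_measurable_integrable)

section \<open>The Bregman divergence of the power function\<close>

lemma norm_french_power: "norm (french_power w (p - 1)) = norm w powr (p - 1)"
  using powr_mult_base[of "norm w" "p - 2"]
  by (cases "w = 0") (auto simp: french_power_def powr_mult_base[symmetric] mult.commute)

lemma french_power_inner_self: "french_power w (p - 1) \<bullet> w = norm w powr p"
  using powr_add[of "norm w" "p - 2" 2]
  by (cases "w = 0") (auto simp: french_power_def powr_realpow power2_norm_eq_inner power2_eq_square[symmetric])

text \<open>
  Young's inequality for the conjugate exponents \<open>p\<close> and \<open>p / (p - 1)\<close>; it says that the Bregman divergence is nonnegative.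
\<close>

lemma french_power_inner_le:
  assumes "1 < p"
  shows "p * (french_power w (p - 1) \<bullet> z) \<le> norm z powr p + (p - 1) * norm w powr p"
proof -
  have "french_power w (p - 1) \<bullet> z \<le> norm z * (norm w powr (p - 1))"
    using norm_cauchy_schwarz[of "french_power w (p - 1)" z] by (simp add: norm_french_power mult.commute)
  also have "\<dots> \<le> norm z powr p / p + (norm w powr (p - 1)) powr (p / (p - 1)) / (p / (p - 1))"
    using assms by (intro Youngs_inequality) (auto simp: field_simps)
  also have "(norm w powr (p - 1)) powr (p / (p - 1)) = norm w powr p"
    using assms by (simp add: powr_powr)
  finally have "p * (french_power w (p - 1) \<bullet> z) \<le> p * (norm z powr p / p + norm w powr p / (p / (p - 1)))"
    using assms by (intro mult_left_mono) auto
  also have "\<dots> = norm z powr p + (p - 1) * norm w powr p"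
    using assms by (simp add: field_simps)
  finally show ?thesis .
qed

lemma bregman_altdef:
  "bregman p w z = norm z powr p + (p - 1) * norm w powr p - p * (french_power w (p - 1) \<bullet> z)"
  by (simp add: bregman_def inner_diff_right french_power_inner_self algebra_simps)

lemma bregman_nonneg: "1 < p \<Longrightarrow> 0 \<le> bregman p w z"
  using french_power_inner_le[of p w z] by (simp add: bregman_altdef)

lemma tendsto_french_power:
  assumes "1 < p" and f: "(f \<longlongrightarrow> w) G"
  shows "((\<lambda>x. french_power (f x) (p - 1)) \<longlongrightarrow> french_power w (p - 1)) G"
proof (cases "w = 0")
  case True
  have "((\<lambda>x. norm (f x) powr (p - 1)) \<longlongrightarrow> 0) G"
    using True assms(1) tendsto_powr'[OF tendsto_norm[OF f] tendsto_const[of "p - 1"]] by simp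
  then have "((\<lambda>x. norm (french_power (f x) (p - 1))) \<longlongrightarrow> 0) G"
    by (simp add: norm_french_power)
  then show ?thesis
    using True by (simp add: tendsto_norm_zero_iff french_power_def[of 0])
next
  case False
  have ev: "eventually (\<lambda>x. f x \<noteq> 0) G"
    using tendsto_imp_eventually_ne[OF f False] .
  have "((\<lambda>x. norm (f x) powr (p - 1 - 1) *\<^sub>R f x) \<longlongrightarrow> norm w powr (p - 1 - 1) *\<^sub>R w) G"
    using False by (intro tendsto_intros f) auto
  then show ?thesis
    using False by (subst (2) french_power_def)
       (auto simp: french_power_def elim!: Lim_transform_eventually intro: eventually_mono[OF ev])
qed

lemma tendsto_bregman:
  assumes "1 < p" "(f \<longlongrightarrow> w) G" "(g \<longlongrightarrow> z) G"
  shows "((\<lambda>x. bregman p (f x) (g x)) \<longlongrightarrow> bregman p w z) G"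
  unfolding bregman_def using assms(1)
  by (intro tendsto_intros tendsto_french_power assms tendsto_powr' ) auto

lemma borel_measurable_french_power [measurable]:
  assumes [measurable]: "f \<in> borel_measurable M"
  shows "(\<lambda>x. french_power (f x) \<kappa>) \<in> borel_measurable M"
  unfolding french_power_def by measurable

lemma borel_measurable_bregman [measurable]:
  assumes [measurable]: "f \<in> borel_measurable M" "g \<in> borel_measurable M"
  shows "(\<lambda>x. bregman p (f x) (g x)) \<in> borel_measurable M"
  unfolding bregman_def by measurable

lemma bregman_self [simp]: "bregman p w w = 0"
  by (simp add: bregman_def)

section \<open>Convolution semigroups on power-integrable functions\<close>

text \<open>
  The same condition as \<open>in_Lp\<close>, for arbitrary Euclidean domain and range.
\<close>

definition power_integrable :: "real \<Rightarrow> ('a::euclidean_space \<Rightarrow> 'b::euclidean_space) \<Rightarrow> bool" where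
  "power_integrable p F \<longleftrightarrow> F \<in> borel_measurable borel \<and> integrable lborel (\<lambda>x. norm (F x) powr p)"

text \<open>
  The \<open>p\<close>-th power of the Lebesgue norm. With values in \<open>ennreal\<close>, statements about it need no integrability side conditions.
\<close>

definition power_energy :: "real \<Rightarrow> ('a::euclidean_space \<Rightarrow> 'b::euclidean_space) \<Rightarrow> ennreal" where
  "power_energy p F = (\<integral>\<^sup>+x. ennreal (norm (F x) powr p) \<partial>lborel)"

lemma power_integrableD:
  assumes "power_integrable p F"
  shows "F \<in> borel_measurable borel" "integrable lborel (\<lambda>x. norm (F x) powr p)"
  using assms by (auto simp: power_integrable_def)

lemma power_integrable_iff:
  assumes [measurable]: "F \<in> borel_measurable borel"
  shows "power_integrable p F \<longleftrightarrow> power_energy p F < \<infinity>"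
  by (auto simp: power_integrable_def power_energy_def integrable_iff_bounded)

text \<open>
  A \<open>p\<close>-integrable function is the sum of a function bounded by \<open>e\<close> and an integrable one. This replaces Hoelder's
  inequality throughout.
\<close>

lemma le_cutoff_plus_powr:
  fixes a :: real
  assumes "0 < e" "1 < p" "0 \<le> a"
  shows "a \<le> e + e powr (1 - p) * a powr p"
proof (cases "a \<le> e")
  case True
  then show ?thesis using assms by (simp add: add_increasing2)
next
  case False
  then have "a = a powr (1 - p) * a powr p"
    using assms by (simp flip: powr_add)
  also have "\<dots> \<le> e powr (1 - p) * a powr p"
    using assms False by (intro mult_right_mono powr_mono2') auto
  finally show ?thesis using assms by simp
qed

text \<open>
  The density of the increment over time \<open>t\<close> is \<open>k t\<close>. The last three assumptions are regularity in time. For kernels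
  whose Fourier transform is nonnegative and decreasing in \<open>t\<close> the origin is the worst point, so uniform control
  follows from control of \<open>k t 0\<close>.
\<close>

locale convolution_semigroup =
  fixes k :: "real \<Rightarrow> 'a::euclidean_space \<Rightarrow> real"
  assumes k_measurable: "case_prod k \<in> borel_measurable (borel \<Otimes>\<^sub>M borel)"
    and k_nonneg: "0 < t \<Longrightarrow> 0 \<le> k t x"
    and k_le_k0: "0 < t \<Longrightarrow> k t x \<le> k t 0"
    and k_mass: "0 < t \<Longrightarrow> has_bochner_integral lborel (k t) 1"
    and k_conv: "0 < s \<Longrightarrow> 0 < t \<Longrightarrow> (LINT y|lborel. k s (y - x) * k t (z - y)) = k (s + t) (z - x)"
    and k_oscillation: "0 < s \<Longrightarrow> s \<le> t \<Longrightarrow> \<bar>k s x - k t x\<bar> \<le> k s 0 - k t 0"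
    and k_right_continuous: "0 < t \<Longrightarrow> ((\<lambda>s. k s 0) \<longlongrightarrow> k t 0) (at_right t)"
    and k_vanishes: "((\<lambda>t. k t 0) \<longlongrightarrow> 0) at_top"
begin

definition P :: "real \<Rightarrow> ('a \<Rightarrow> 'b::euclidean_space) \<Rightarrow> 'a \<Rightarrow> 'b" where
  "P t F x = (if t = 0 then F x else (LINT y|lborel. k t (y - x) *\<^sub>R F y))"

lemma k_borel [measurable]:
  assumes [measurable]: "f \<in> borel_measurable M" "g \<in> borel_measurable M"
  shows "(\<lambda>x. k (f x) (g x)) \<in> borel_measurable M"
proof -
  have "(\<lambda>x. (f x, g x)) \<in> M \<rightarrow>\<^sub>M borel \<Otimes>\<^sub>M borel" by measurable
  from measurable_compose[OF this k_measurable] show ?thesis by simp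
qed

lemma k_shift: "0 < t \<Longrightarrow> has_bochner_integral lborel (\<lambda>y. k t (y - x)) 1"
  using has_bochner_integral_translate[OF k_mass, of t "- x"] by simp

lemma k_shift': "0 < t \<Longrightarrow> has_bochner_integral lborel (\<lambda>x. k t (y - x)) 1"
  using has_bochner_integral_reflect[OF k_mass, of t y] by simp

lemma nn_integral_k:
  assumes "0 < t"
  shows "(\<integral>\<^sup>+y. ennreal (k t (y - x)) \<partial>lborel) = 1" "(\<integral>\<^sup>+x. ennreal (k t (y - x)) \<partial>lborel) = 1"
  using k_shift[OF assms, of x] k_shift'[OF assms, of y] k_nonneg[OF assms]
  by (subst nn_integral_eq_integral; auto simp: has_bochner_integral_iff)+

lemma P_0 [simp]: "P 0 F = F"
  by (auto simp: P_def)

lemma borel_measurable_P [measurable]: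
  fixes F :: "'a \<Rightarrow> 'b::euclidean_space"
  assumes [measurable]: "F \<in> borel_measurable borel" "f \<in> borel_measurable M" "g \<in> borel_measurable M"
  shows "(\<lambda>x. P (f x) F (g x)) \<in> borel_measurable M"
  unfolding P_def by measurable

lemma integrable_k_power:
  assumes "0 < t" "power_integrable p F"
  shows "integrable lborel (\<lambda>y. k t (y - x) * norm (F y) powr p)"
proof (rule Bochner_Integration.integrable_bound)
  note [measurable] = power_integrableD(1)[OF assms(2)]
  show "integrable lborel (\<lambda>y. k t 0 * norm (F y) powr p)"
    using power_integrableD[OF assms(2)] by auto
  show "(\<lambda>y. k t (y - x) * norm (F y) powr p) \<in> borel_measurable lborel"
    by measurable
  show "AE y in lborel. norm (k t (y - x) * norm (F y) powr p) \<le> norm (k t 0 * norm (F y) powr p)"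
    using assms(1) by (auto simp: abs_mult k_nonneg k_le_k0 intro!: mult_right_mono)
qed

text \<open>
  The kernel is both bounded and integrable, so \<open>|F| \<le> 1 + |F|^p\<close> suffices.
\<close>

lemma integrable_k_scaleR:
  fixes F :: "'a \<Rightarrow> 'b::euclidean_space"
  assumes "0 < t" "power_integrable p F" "1 < p"
  shows "integrable lborel (\<lambda>y. k t (y - x) *\<^sub>R F y)"
proof (rule Bochner_Integration.integrable_bound)
  note [measurable] = power_integrableD(1)[OF assms(2)]
  show "integrable lborel (\<lambda>y. k t (y - x) + k t (y - x) * norm (F y) powr p)"
    using k_shift[OF assms(1)] integrable_k_power[OF assms(1,2)]
    by (auto simp: has_bochner_integral_iff)
  show "(\<lambda>y. k t (y - x) *\<^sub>R F y) \<in> borel_measurable lborel"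
    by measurable
  have "k t (y - x) * norm (F y) \<le> k t (y - x) * (1 + norm (F y) powr p)" for y
    using le_cutoff_plus_powr[of 1 p "norm (F y)"] assms by (intro mult_left_mono k_nonneg) auto
  then show "AE y in lborel. norm (k t (y - x) *\<^sub>R F y) \<le> norm (k t (y - x) + k t (y - x) * norm (F y) powr p)"
    using assms(1) by (auto simp: abs_mult k_nonneg algebra_simps)
qed

text \<open>
  The divergence \<open>\<F> w z\<close> is \<open>|z|^p\<close> plus a function affine in \<open>z\<close>. Its mean over \<open>z = u y\<close> therefore differs from its
  value at the mean \<open>P h u x\<close> only by the corresponding difference for \<open>|z|^p\<close>.
\<close>

lemma bregman_variance:
  fixes u :: "'a \<Rightarrow> real^'n"
  assumes h: "0 < h" and u: "power_integrable p u" and p: "1 < p"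
  shows "has_bochner_integral lborel (\<lambda>y. bregman p w (u y) * k h (y - x))
    (P h (\<lambda>y. norm (u y) powr p) x - norm (P h u x) powr p + bregman p w (P h u x))"
proof -
  have Pu: "has_bochner_integral lborel (\<lambda>y. k h (y - x) *\<^sub>R u y) (P h u x)"
    using integrable_k_scaleR[OF h u p] h by (simp add: has_bochner_integral_iff P_def)
  have Pp: "has_bochner_integral lborel (\<lambda>y. k h (y - x) * norm (u y) powr p) (P h (\<lambda>y. norm (u y) powr p) x)"
    using integrable_k_power[OF h u] h by (simp add: has_bochner_integral_iff P_def)
  have "has_bochner_integral lborel
      (\<lambda>y. k h (y - x) * norm (u y) powr p + ((p - 1) * norm w powr p) * k h (y - x)
         - p * (french_power w (p - 1) \<bullet> (k h (y - x) *\<^sub>R u y)))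
      (P h (\<lambda>y. norm (u y) powr p) x + ((p - 1) * norm w powr p) * 1 - p * (french_power w (p - 1) \<bullet> P h u x))"
    by (intro has_bochner_integral_add has_bochner_integral_diff has_bochner_integral_mult_right Pp
        k_shift[OF h] has_bochner_integral_inner_right Pu)
  then show ?thesis
    by (rule back_subst[of "\<lambda>f. has_bochner_integral lborel f _", OF back_subst[of "has_bochner_integral lborel _"]])
       (auto simp: bregman_altdef algebra_simps)
qed

lemma nn_bregman_variance:
  fixes u :: "'a \<Rightarrow> real^'n"
  assumes h: "0 < h" and u: "power_integrable p u" and p: "1 < p"
  shows "(\<integral>\<^sup>+y. ennreal (bregman p w (u y) * k h (y - x)) \<partial>lborel) =
    ennreal (P h (\<lambda>y. norm (u y) powr p) x - norm (P h u x) powr p + bregman p w (P h u x))"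
  using bregman_variance[OF assms, of w x]
  by (subst nn_integral_eq_integral)
     (auto simp: has_bochner_integral_iff bregman_nonneg[OF p] k_nonneg[OF h])

text \<open>
  Jensen's inequality, read off from the nonnegativity of the variance for \<open>w = P h u x\<close>.
\<close>

lemma power_P_le:
  fixes u :: "'a \<Rightarrow> real^'n"
  assumes h: "0 < h" and u: "power_integrable p u" and p: "1 < p"
  shows "norm (P h u x) powr p \<le> P h (\<lambda>y. norm (u y) powr p) x"
proof -
  have "0 \<le> (LINT y|lborel. bregman p (P h u x) (u y) * k h (y - x))"
    using bregman_nonneg[OF p] k_nonneg[OF h]
    by (intro integral_nonneg_AE AE_I2 mult_nonneg_nonneg)
  then show ?thesis
    using bregman_variance[OF assms, of "P h u x" x] by (auto simp: has_bochner_integral_iff)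
qed

lemma nn_integral_convolve:
  assumes h: "0 < h" and [measurable]: "f \<in> borel_measurable borel"
  shows "(\<integral>\<^sup>+x. \<integral>\<^sup>+y. ennreal (k h (y - x)) * f y \<partial>lborel \<partial>lborel) = (\<integral>\<^sup>+y. f y \<partial>lborel)"
proof -
  have "(\<integral>\<^sup>+x. \<integral>\<^sup>+y. ennreal (k h (y - x)) * f y \<partial>lborel \<partial>lborel)
      = (\<integral>\<^sup>+y. \<integral>\<^sup>+x. ennreal (k h (y - x)) * f y \<partial>lborel \<partial>lborel)"
    by (rule lborel_pair.Fubini'[symmetric]) simp
  also have "\<dots> = (\<integral>\<^sup>+y. f y \<partial>lborel)"
    using h by (subst nn_integral_multc) (auto simp: nn_integral_k)
  finally show ?thesis .
qed

lemma ennreal_P: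
  assumes h: "0 < h" and f: "\<And>y. 0 \<le> f y" "integrable lborel (\<lambda>y. k h (y - x) * f y)"
  shows "ennreal (P h f x) = (\<integral>\<^sup>+y. ennreal (k h (y - x)) * ennreal (f y) \<partial>lborel)"
  using h f by (subst ennreal_mult'[symmetric]) (auto simp: P_def nn_integral_eq_integral k_nonneg)

lemma nn_integral_P_power:
  assumes h: "0 < h" and u: "power_integrable p u"
  shows "(\<integral>\<^sup>+x. ennreal (P h (\<lambda>y. norm (u y) powr p) x) \<partial>lborel) = power_energy p u"
  unfolding power_energy_def using power_integrableD[OF u]
  by (subst ennreal_P[OF h _ integrable_k_power[OF h u]]) (auto simp: nn_integral_convolve[OF h])

text \<open>
  The choice \<open>w = P h u x\<close> makes the bias term vanish, so the loss of energy is computed exactly.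
\<close>

lemma energy_identity:
  fixes u :: "'a \<Rightarrow> real^'n"
  assumes h: "0 < h" and u: "power_integrable p u" and p: "1 < p"
  shows "(\<integral>\<^sup>+x. \<integral>\<^sup>+y. ennreal (bregman p (P h u x) (u y) * k h (y - x)) \<partial>lborel \<partial>lborel)
    + power_energy p (P h u) = power_energy p u"
proof -
  note [measurable] = power_integrableD(1)[OF u]
  have "(\<integral>\<^sup>+x. \<integral>\<^sup>+y. ennreal (bregman p (P h u x) (u y) * k h (y - x)) \<partial>lborel \<partial>lborel)
      + power_energy p (P h u)
      = (\<integral>\<^sup>+x. ennreal (P h (\<lambda>y. norm (u y) powr p) x - norm (P h u x) powr p)
            + ennreal (norm (P h u x) powr p) \<partial>lborel)"
    unfolding power_energy_def
    by (subst nn_integral_add) (auto simp: nn_bregman_variance[OF assms])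
  also have "\<dots> = (\<integral>\<^sup>+x. ennreal (P h (\<lambda>y. norm (u y) powr p) x) \<partial>lborel)"
    using power_P_le[OF assms] by (subst ennreal_plus[symmetric]) auto
  finally show ?thesis
    by (simp add: nn_integral_P_power[OF h u])
qed

text \<open>
  Replacing \<open>w = P h u x\<close> by \<open>w = u x\<close> only adds the nonnegative bias term. The gain is that both arguments
  of the divergence now come from the same function.
\<close>

lemma energy_upper_bound:
  fixes u :: "'a \<Rightarrow> real^'n"
  assumes h: "0 < h" and u: "power_integrable p u" and p: "1 < p"
  shows "power_energy p u \<le> power_energy p (P h u) +
    (\<integral>\<^sup>+x. \<integral>\<^sup>+y. ennreal (bregman p (u x) (u y) * k h (y - x)) \<partial>lborel \<partial>lborel)"
proof -
  have "(\<integral>\<^sup>+x. \<integral>\<^sup>+y. ennreal (bregman p (P h u x) (u y) * k h (y - x)) \<partial>lborel \<partial>lborel)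
     \<le> (\<integral>\<^sup>+x. \<integral>\<^sup>+y. ennreal (bregman p (u x) (u y) * k h (y - x)) \<partial>lborel \<partial>lborel)"
    unfolding nn_bregman_variance[OF assms]
    using bregman_nonneg[OF p] by (intro nn_integral_mono ennreal_leI) auto
  then show ?thesis
    by (subst energy_identity[OF assms, symmetric]) (simp add: add.commute add_left_mono)
qed

lemma power_energy_P_le:
  fixes u :: "'a \<Rightarrow> real^'n"
  assumes "0 \<le> h" "power_integrable p u" "1 < p"
  shows "power_energy p (P h u) \<le> power_energy p u"
proof (cases "h = 0")
  case False
  then show ?thesis using assms
    by (subst energy_identity[of h p u, symmetric]) auto
qed simp

lemma power_integrable_P:
  fixes u :: "'a \<Rightarrow> real^'n"
  assumes "0 \<le> h" "power_integrable p u" "1 < p"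
  shows "power_integrable p (P h u)"
proof -
  note [measurable] = power_integrableD(1)[OF assms(2)]
  have "power_energy p u < \<infinity>"
    using assms(2) power_integrable_iff[OF power_integrableD(1)[OF assms(2)]] by auto
  with power_energy_P_le[OF assms] show ?thesis
    by (subst power_integrable_iff) (auto intro: order_le_less_trans)
qed

lemma integrable_k_conv:
  assumes "0 < s" "0 < t"
  shows "integrable lborel (\<lambda>y. k s (y - x) * k t (z - y))"
proof (rule Bochner_Integration.integrable_bound)
  show "integrable lborel (\<lambda>y. k s (y - x) * k t 0)"
    using k_shift[OF assms(1)] by (auto simp: has_bochner_integral_iff)
  show "AE y in lborel. norm (k s (y - x) * k t (z - y)) \<le> norm (k s (y - x) * k t 0)"
    using assms by (auto simp: abs_mult k_nonneg k_le_k0 intro!: mult_left_mono)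
qed auto

lemma nn_k_conv:
  assumes "0 < s" "0 < t"
  shows "(\<integral>\<^sup>+y. ennreal (k s (y - x) * k t (z - y)) \<partial>lborel) = ennreal (k (s + t) (z - x))"
  using assms integrable_k_conv[OF assms]
  by (simp add: nn_integral_eq_integral k_nonneg k_conv)

text \<open>
  The Chapman-Kolmogorov relation \<open>k_conv\<close> and Fubini's theorem; absolute convergence follows from the same relation
  applied to \<open>norm \<circ> F\<close>.
\<close>

lemma P_semigroup:
  fixes F :: "'a \<Rightarrow> 'b::euclidean_space"
  assumes s: "0 < s" and t: "0 \<le> t" and F: "power_integrable p F" and p: "1 < p"
  shows "P s (P t F) x = P (t + s) F x"
proof (cases "t = 0")
  case False
  with t have t: "0 < t" by simp
  note [measurable] = power_integrableD(1)[OF F]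
  have fin: "(\<integral>\<^sup>+z. \<integral>\<^sup>+y. ennreal (norm ((k s (y - x) * k t (z - y)) *\<^sub>R F z)) \<partial>lborel \<partial>lborel) < \<infinity>"
  proof -
    have "(\<integral>\<^sup>+z. \<integral>\<^sup>+y. ennreal (norm ((k s (y - x) * k t (z - y)) *\<^sub>R F z)) \<partial>lborel \<partial>lborel)
      = (\<integral>\<^sup>+z. \<integral>\<^sup>+y. ennreal (k s (y - x) * k t (z - y)) * ennreal (norm (F z)) \<partial>lborel \<partial>lborel)"
      using s t by (simp add: abs_mult k_nonneg ennreal_mult')
    also have "\<dots> = (\<integral>\<^sup>+z. ennreal (k (s + t) (z - x)) * ennreal (norm (F z)) \<partial>lborel)"
      using s t by (subst nn_integral_multc) (auto simp: nn_k_conv)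
    also have "\<dots> = (\<integral>\<^sup>+z. ennreal (norm (k (s + t) (z - x) *\<^sub>R F z)) \<partial>lborel)"
      using s t by (simp add: abs_mult k_nonneg ennreal_mult')
    also have "\<dots> < \<infinity>"
      using integrable_k_scaleR[OF _ F p, of "s + t" x] s t by (simp add: integrable_iff_bounded)
    finally show ?thesis .
  qed
  have int: "integrable (lborel \<Otimes>\<^sub>M lborel) (\<lambda>(z, y). (k s (y - x) * k t (z - y)) *\<^sub>R F z)"
    using fin by (subst integrable_iff_bounded) (auto simp: lborel.nn_integral_fst[symmetric] case_prod_beta')
  have "P s (P t F) x = (LINT y|lborel. LINT z|lborel. (k s (y - x) * k t (z - y)) *\<^sub>R F z)"
    using s t by (simp add: P_def flip: scaleR_scaleR)
  also have "\<dots> = (LINT z|lborel. LINT y|lborel. (k s (y - x) * k t (z - y)) *\<^sub>R F z)"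
    by (rule lborel_pair.Fubini_integral[OF int])
  also have "\<dots> = (LINT z|lborel. k (s + t) (z - x) *\<^sub>R F z)"
    using s t by (simp add: k_conv integrable_k_conv)
  finally show ?thesis using s t by (simp add: P_def add.commute)
qed simp

end

section \<open>Continuity of translations in the mean\<close>

text \<open>
  The shape of every approximation argument below: up to an arbitrarily small error, \<open>f\<close> is dominated by something that vanishes.
\<close>

lemma tendsto_0_ennreal_approx:
  fixes f :: "'i \<Rightarrow> ennreal"
  assumes "\<And>e::real. 0 < e \<Longrightarrow> \<exists>g. (g \<longlongrightarrow> 0) G \<and> (\<forall>\<^sub>F i in G. f i \<le> g i + ennreal e)"
  shows "(f \<longlongrightarrow> 0) G"
proof (rule order_tendstoI)
  fix a :: ennreal assume "0 < a"
  then obtain b where b: "0 < b" "b < a" using dense by blast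
  then obtain r where r: "b = ennreal r" "0 < r"
    by (cases b) (auto simp: top_unique dest: less_trans)
  obtain g where g: "(g \<longlongrightarrow> 0) G" "\<forall>\<^sub>F i in G. f i \<le> g i + ennreal (r / 2)"
    using assms[of "r / 2"] r by auto
  have "\<forall>\<^sub>F i in G. g i < ennreal (r / 2)"
    using order_tendstoD(2)[OF g(1)] r by auto
  with g(2) show "\<forall>\<^sub>F i in G. f i < a"
  proof eventually_elim
    case (elim i)
    have "f i \<le> ennreal (r / 2) + ennreal (r / 2)"
      using elim by (meson add_right_mono less_imp_le order_trans)
    also have "\<dots> = b"
      using r by (simp flip: ennreal_plus)
    finally show ?case using b by auto
  qed
qed auto

definition L1_modulus :: "('a::euclidean_space \<Rightarrow> 'b::euclidean_space) \<Rightarrow> 'a \<Rightarrow> ennreal" where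
  "L1_modulus f z = (\<integral>\<^sup>+x. ennreal (norm (f (z + x) - f x)) \<partial>lborel)"

lemma L1_modulus_triangle:
  fixes f g :: "'a::euclidean_space \<Rightarrow> 'b::euclidean_space"
  assumes [measurable]: "f \<in> borel_measurable borel" "g \<in> borel_measurable borel"
  shows "L1_modulus f z \<le> L1_modulus g z + 2 * (\<integral>\<^sup>+x. ennreal (norm (f x - g x)) \<partial>lborel)"
proof -
  have "L1_modulus f z \<le> (\<integral>\<^sup>+x. ennreal (norm (g (z + x) - g x)) +
      (ennreal (norm (f (z + x) - g (z + x))) + ennreal (norm (f x - g x))) \<partial>lborel)"
    unfolding L1_modulus_def
  proof (intro nn_integral_mono)
    fix x
    have "norm (f (z + x) - f x) \<le> norm (g (z + x) - g x) + (norm (f (z + x) - g (z + x)) + norm (f x - g x))"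
      using norm_triangle_ineq[of "g (z + x) - g x" "(f (z + x) - g (z + x)) - (f x - g x)"]
        norm_triangle_ineq4[of "f (z + x) - g (z + x)" "f x - g x"] by (simp add: algebra_simps)
    then show "ennreal (norm (f (z + x) - f x)) \<le> ennreal (norm (g (z + x) - g x)) +
      (ennreal (norm (f (z + x) - g (z + x))) + ennreal (norm (f x - g x)))"
      by (simp flip: ennreal_plus)
  qed
  also have "\<dots> = L1_modulus g z + ((\<integral>\<^sup>+x. ennreal (norm (f (z + x) - g (z + x))) \<partial>lborel)
      + (\<integral>\<^sup>+x. ennreal (norm (f x - g x)) \<partial>lborel))"
    unfolding L1_modulus_def by (simp add: nn_integral_add)
  also have "(\<integral>\<^sup>+x. ennreal (norm (f (z + x) - g (z + x))) \<partial>lborel) = (\<integral>\<^sup>+x. ennreal (norm (f x - g x)) \<partial>lborel)"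
    using nn_integral_translate[of "\<lambda>x. ennreal (norm (f x - g x))" z] by simp
  finally show ?thesis by (simp add: mult_2)
qed

lemma L1_modulus_le:
  fixes f :: "'a::euclidean_space \<Rightarrow> 'b::euclidean_space"
  assumes [measurable]: "f \<in> borel_measurable borel"
  shows "L1_modulus f z \<le> 2 * (\<integral>\<^sup>+x. ennreal (norm (f x)) \<partial>lborel)"
  using L1_modulus_triangle[of f "\<lambda>_. 0" z] by (simp add: L1_modulus_def)

text \<open>
  If \<open>U\<close> is open, each \<open>x \<in> U\<close> stays in \<open>U\<close> under small translations, so dominated convergence applies to \<open>U\<close> minus
  its translate. The opposite difference has the same measure by translation invariance.
\<close>

lemma L1_modulus_open:
  assumes "open U" and fin: "emeasure lborel U < \<infinity>" and Z: "Z \<longlonglongrightarrow> (0::'a::euclidean_space)"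
  shows "(\<lambda>n. L1_modulus (\<lambda>x. indicat_real U x *\<^sub>R c) (Z n)) \<longlonglongrightarrow> 0"
proof -
  have [measurable]: "U \<in> sets borel" using assms by auto
  have lim: "(\<lambda>n. \<integral>\<^sup>+x. ennreal (norm c) * indicator (U - {x. W n + x \<in> U}) x \<partial>lborel) \<longlonglongrightarrow> 0"
    if W: "W \<longlonglongrightarrow> 0" for W :: "nat \<Rightarrow> 'a"
  proof -
    have "(\<lambda>n. \<integral>\<^sup>+x. ennreal (norm c) * indicator (U - {x. W n + x \<in> U}) x \<partial>lborel)
        \<longlonglongrightarrow> (\<integral>\<^sup>+x. 0 \<partial>(lborel :: 'a measure))"
    proof (rule nn_integral_dominated_convergence[where w = "\<lambda>x. ennreal (norm c) * indicator U x"])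
      show "(\<integral>\<^sup>+ x. ennreal (norm c) * indicator U x \<partial>lborel) < \<infinity>"
        using fin by (simp add: nn_integral_cmult ennreal_mult_less_top)
      show "AE x in lborel. (\<lambda>n. ennreal (norm c) * indicator (U - {x. W n + x \<in> U}) x) \<longlonglongrightarrow> 0"
      proof (rule AE_I2)
        fix x
        have "(\<lambda>n. W n + x) \<longlonglongrightarrow> x" using tendsto_add[OF W tendsto_const[of x]] by simp
        then have "x \<in> U \<Longrightarrow> \<forall>\<^sub>F n in sequentially. W n + x \<in> U"
          using topological_tendstoD \<open>open U\<close> by blast
        then have "\<forall>\<^sub>F n in sequentially. ennreal (norm c) * indicator (U - {x. W n + x \<in> U}) x = 0"
        proof (cases "x \<in> U")
          case True
          then have "\<forall>\<^sub>F n in sequentially. W n + x \<in> U"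
            using \<open>x \<in> U \<Longrightarrow> \<forall>\<^sub>F n in sequentially. W n + x \<in> U\<close> by blast
          then show ?thesis by eventually_elim simp
        qed simp
        then show "(\<lambda>n. ennreal (norm c) * indicator (U - {x. W n + x \<in> U}) x) \<longlonglongrightarrow> 0"
          by (rule tendsto_eventually)
      qed
    qed (auto split: split_indicator)
    then show ?thesis by simp
  qed
  have le: "L1_modulus (\<lambda>x. indicat_real U x *\<^sub>R c) z \<le>
    (\<integral>\<^sup>+x. ennreal (norm c) * indicator (U - {x. - z + x \<in> U}) x \<partial>lborel) +
    (\<integral>\<^sup>+x. ennreal (norm c) * indicator (U - {x. z + x \<in> U}) x \<partial>lborel)" for z
  proof -
    have "(\<integral>\<^sup>+x. ennreal (norm c) * indicator (U - {x. - z + x \<in> U}) x \<partial>lborel) =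
      (\<integral>\<^sup>+x. ennreal (norm c) * indicator (U - {x. - z + x \<in> U}) (z + x) \<partial>lborel)"
      by (rule nn_integral_translate[symmetric]) measurable
    also have "\<dots> = (\<integral>\<^sup>+x. ennreal (norm c) * indicator ({x. z + x \<in> U} - U) x \<partial>lborel)"
      by (intro nn_integral_cong) (simp split: split_indicator)
    finally have eq: "(\<integral>\<^sup>+x. ennreal (norm c) * indicator (U - {x. - z + x \<in> U}) x \<partial>lborel) =
      (\<integral>\<^sup>+x. ennreal (norm c) * indicator ({x. z + x \<in> U} - U) x \<partial>lborel)" .
    show ?thesis
      unfolding L1_modulus_def eq
      by (subst nn_integral_add[symmetric]) (auto intro!: nn_integral_mono split: split_indicator)
  qed
  have "(\<lambda>n. - Z n) \<longlonglongrightarrow> 0" using tendsto_minus[OF Z] by simp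
  note lim0 = tendsto_add_zero[OF lim[OF this] lim[OF Z]]
  show ?thesis
    by (rule tendsto_sandwich[OF _ _ tendsto_const lim0]) (use le in \<open>auto intro!: always_eventually\<close>)
qed

text \<open>
  Indicators of open sets are covered above, outer regularity passes to Borel sets of finite measure, and linear
  combinations and limits in the mean exhaust the integrable functions.
\<close>

lemma L1_modulus_tendsto_0:
  fixes f :: "'a::euclidean_space \<Rightarrow> 'b::euclidean_space"
  assumes "integrable lborel f"
  shows "(L1_modulus f \<longlongrightarrow> 0) (at 0)"
proof -
  have "\<forall>Z. Z \<longlonglongrightarrow> 0 \<longrightarrow> (\<lambda>n. L1_modulus f (Z n)) \<longlonglongrightarrow> 0"
    using assms
  proof (induction rule: integrable_induct)
    case (base A c)
    then have [measurable]: "A \<in> sets borel" by auto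
    show ?case
    proof (intro allI impI tendsto_0_ennreal_approx)
      fix Z :: "nat \<Rightarrow> 'a" and e :: real
      assume Z: "Z \<longlonglongrightarrow> 0" and e: "0 < e"
      define d where "d = e / (2 * (norm c + 1))"
      have d: "0 < d" "2 * (d * norm c) \<le> e"
        using e by (auto simp: d_def field_simps add_pos_nonneg)
      obtain U where U: "open U" "A \<subseteq> U" "emeasure lborel (U - A) < ennreal d"
        using outer_regular_lborel[of A d] d by auto
      then have [measurable]: "U \<in> sets borel" by auto
      have "emeasure lborel U \<le> emeasure lborel A + emeasure lborel (U - A)"
        using emeasure_subadditive[of A lborel "U - A"] U by (simp add: Un_absorb1 Un_Diff_cancel)
      moreover have "emeasure lborel (U - A) < \<infinity>"
        using U(3) less_top order.strict_trans by fastforce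
      ultimately have fin: "emeasure lborel U < \<infinity>"
        using base(2) by (simp add: order_le_less_trans)
      have "L1_modulus (\<lambda>x. indicat_real A x *\<^sub>R c) z \<le> L1_modulus (\<lambda>x. indicat_real U x *\<^sub>R c) z + ennreal e" for z
      proof -
        have "(\<integral>\<^sup>+x. ennreal (norm (indicat_real A x *\<^sub>R c - indicat_real U x *\<^sub>R c)) \<partial>lborel)
            \<le> (\<integral>\<^sup>+x. ennreal (norm c) * indicator (U - A) x \<partial>lborel)"
          using U(2) by (intro nn_integral_mono) (auto split: split_indicator)
        also have "\<dots> \<le> ennreal (norm c) * ennreal d"
          using U by (subst nn_integral_cmult_indicator) (auto intro!: mult_left_mono)
        finally have "2 * (\<integral>\<^sup>+x. ennreal (norm (indicat_real A x *\<^sub>R c - indicat_real U x *\<^sub>R c)) \<partial>lborel)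
            \<le> 2 * (ennreal (norm c) * ennreal d)" by (intro mult_left_mono) auto
        also have "\<dots> = ennreal (2 * (d * norm c))"
          using d by (simp add: ennreal_mult mult.commute)
        also have "\<dots> \<le> ennreal e" using d by (intro ennreal_leI)
        finally show ?thesis
          by (intro order_trans[OF L1_modulus_triangle add_left_mono]) auto
      qed
      then show "\<exists>g. g \<longlonglongrightarrow> 0 \<and> (\<forall>\<^sub>F n in sequentially. L1_modulus (\<lambda>x. indicat_real A x *\<^sub>R c) (Z n) \<le> g n + ennreal e)"
        using L1_modulus_open[OF U(1) fin Z, of c]
        by (intro exI[of _ "\<lambda>n. L1_modulus (\<lambda>x. indicat_real U x *\<^sub>R c) (Z n)"] conjI) auto
    qed
  next
    case (add f g)
    then have [measurable]: "f \<in> borel_measurable borel" "g \<in> borel_measurable borel" by auto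
    have "L1_modulus (\<lambda>x. f x + g x) z \<le> L1_modulus f z + L1_modulus g z" for z
    proof -
      have "norm (f (z + x) + g (z + x) - (f x + g x)) \<le> norm (f (z + x) - f x) + norm (g (z + x) - g x)" for x
        using norm_triangle_ineq[of "f (z + x) - f x" "g (z + x) - g x"] by (simp add: algebra_simps)
      then show ?thesis
        unfolding L1_modulus_def
        by (subst nn_integral_add[symmetric]) (auto intro!: nn_integral_mono simp flip: ennreal_plus)
    qed
    moreover have "(\<lambda>n. L1_modulus f (Z n) + L1_modulus g (Z n)) \<longlonglongrightarrow> 0" if "Z \<longlonglongrightarrow> 0" for Z
      using add.IH that by (intro tendsto_add_zero) auto
    ultimately show ?case
      using tendsto_sandwich[OF _ _ tendsto_const] by (metis (mono_tags, lifting) always_eventually zero_le)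
  next
    case (lim f s)
    then have [measurable]: "f \<in> borel_measurable borel" "\<And>i. s i \<in> borel_measurable borel" by auto
    have "(\<lambda>i. \<integral>\<^sup>+x. ennreal (norm (f x - s i x)) \<partial>lborel) \<longlonglongrightarrow> 0"
    proof -
      have "(\<lambda>i. \<integral>\<^sup>+x. ennreal (norm (f x - s i x)) \<partial>lborel) \<longlonglongrightarrow> (\<integral>\<^sup>+x. 0 \<partial>(lborel::'a measure))"
      proof (rule nn_integral_dominated_convergence[where w = "\<lambda>x. ennreal (3 * norm (f x))"])
        have "norm (f x - s i x) \<le> 3 * norm (f x)" for i x
          using norm_triangle_ineq4[of "f x" "s i x"] lim.hyps(3)[of x i] by simp
        then show "\<And>i. AE x in lborel. ennreal (norm (f x - s i x)) \<le> ennreal (3 * norm (f x))"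
          by (auto intro: ennreal_leI)
        show "(\<integral>\<^sup>+ x. ennreal (3 * norm (f x)) \<partial>lborel) < \<infinity>"
          using lim.hyps(4) by (simp add: ennreal_mult nn_integral_cmult integrable_iff_bounded ennreal_mult_less_top)
        have "(\<lambda>i. ennreal (norm (f x - s i x))) \<longlonglongrightarrow> ennreal (norm (f x - f x))" for x
          using lim.hyps(2)[of x] by (intro tendsto_intros) auto
        then show "AE x in lborel. (\<lambda>i. ennreal (norm (f x - s i x))) \<longlonglongrightarrow> 0" by simp
      qed auto
      then show ?thesis by simp
    qed
    then have to0: "(\<lambda>i. 2 * (\<integral>\<^sup>+x. ennreal (norm (f x - s i x)) \<partial>lborel)) \<longlonglongrightarrow> 0"
      using ennreal_tendsto_cmult[of 2, OF _ \<open>_ \<longlonglongrightarrow> 0\<close>] by simp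
    show ?case
    proof (intro allI impI tendsto_0_ennreal_approx)
      fix Z :: "nat \<Rightarrow> 'a" and e :: real
      assume Z: "Z \<longlonglongrightarrow> 0" and e: "0 < e"
      obtain i where i: "2 * (\<integral>\<^sup>+x. ennreal (norm (f x - s i x)) \<partial>lborel) < ennreal e"
        using order_tendstoD(2)[OF to0, of "ennreal e"] e by (auto simp: eventually_sequentially)
      have "L1_modulus f z \<le> L1_modulus (s i) z + ennreal e" for z
        using L1_modulus_triangle[of f "s i" z] i
        by (meson add_left_mono order_trans less_imp_le \<open>f \<in> borel_measurable borel\<close> \<open>\<And>i. s i \<in> borel_measurable borel\<close>)
      then show "\<exists>g. g \<longlonglongrightarrow> 0 \<and> (\<forall>\<^sub>F n in sequentially. L1_modulus f (Z n) \<le> g n + ennreal e)"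
        using lim.IH Z by (intro exI[of _ "\<lambda>n. L1_modulus (s i) (Z n)"] conjI) auto
    qed
  qed
  then show ?thesis
    by (auto simp: tendsto_at_iff_sequentially comp_def)
qed

section \<open>Behaviour of the semigroup at positive and at large times\<close>

context convolution_semigroup
begin

lemma norm_P_le:
  fixes f :: "'a \<Rightarrow> 'b::euclidean_space"
  assumes "0 < t" and [measurable]: "f \<in> borel_measurable borel"
  shows "ennreal (norm (P t f x)) \<le> (\<integral>\<^sup>+y. ennreal (k t (y - x)) * ennreal (norm (f y)) \<partial>lborel)"
proof (cases "integrable lborel (\<lambda>y. k t (y - x) *\<^sub>R f y)")
  case True
  from integral_norm_bound_ennreal[OF this] show ?thesis
    using assms by (simp add: P_def k_nonneg abs_mult ennreal_mult')
next
  case False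
  then show ?thesis using assms by (simp add: P_def not_integrable_integral_eq)
qed

lemma L1_contraction:
  fixes f :: "'a \<Rightarrow> 'b::euclidean_space"
  assumes "0 < t" and [measurable]: "f \<in> borel_measurable borel"
  shows "(\<integral>\<^sup>+x. ennreal (norm (P t f x)) \<partial>lborel) \<le> (\<integral>\<^sup>+x. ennreal (norm (f x)) \<partial>lborel)"
proof -
  have "(\<integral>\<^sup>+x. ennreal (norm (P t f x)) \<partial>lborel)
    \<le> (\<integral>\<^sup>+x. \<integral>\<^sup>+y. ennreal (k t (y - x)) * ennreal (norm (f y)) \<partial>lborel \<partial>lborel)"
    by (intro nn_integral_mono norm_P_le assms)
  then show ?thesis
    using assms by (subst (asm) nn_integral_convolve) auto
qed

text \<open>
  \<open>P t f x - f x\<close> is the mean of \<open>f (z + x) - f x\<close> over the increment \<open>z\<close>.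
\<close>

lemma P_diff_le_L1_modulus:
  fixes f :: "'a \<Rightarrow> 'b::euclidean_space"
  assumes t: "0 < t" and f: "integrable lborel f"
  shows "(\<integral>\<^sup>+x. ennreal (norm (P t f x - f x)) \<partial>lborel) \<le> (\<integral>\<^sup>+z. ennreal (k t z) * L1_modulus f z \<partial>lborel)"
proof -
  have [measurable]: "f \<in> borel_measurable borel" using f by auto
  have bound: "ennreal (norm (P t f x - f x)) \<le> (\<integral>\<^sup>+z. ennreal (k t z) * ennreal (norm (f (z + x) - f x)) \<partial>lborel)" for x
  proof -
    have int: "integrable lborel (\<lambda>y. k t (y - x) *\<^sub>R f y)"
    proof (rule Bochner_Integration.integrable_bound)
      show "integrable lborel (\<lambda>y. k t 0 *\<^sub>R f y)" using f by auto
      show "AE y in lborel. norm (k t (y - x) *\<^sub>R f y) \<le> norm (k t 0 *\<^sub>R f y)"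
        using t by (auto simp: k_nonneg k_le_k0 intro!: mult_right_mono)
    qed auto
    have int': "integrable lborel (\<lambda>y. k t (y - x) *\<^sub>R f x)" "(LINT y|lborel. k t (y - x) *\<^sub>R f x) = f x"
      using k_shift[OF t, of x] by (auto simp: has_bochner_integral_iff)
    have "P t f x - f x = (LINT y|lborel. k t (y - x) *\<^sub>R (f y - f x))"
      using t int int' by (simp add: P_def scaleR_diff_right)
    also have "ennreal (norm \<dots>) \<le> (\<integral>\<^sup>+y. ennreal (norm (k t (y - x) *\<^sub>R (f y - f x))) \<partial>lborel)"
      using int int' by (intro integral_norm_bound_ennreal) (simp add: scaleR_diff_right)
    also have "\<dots> = (\<integral>\<^sup>+y. ennreal (k t (y - x)) * ennreal (norm (f y - f x)) \<partial>lborel)"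
      using t by (simp add: abs_mult k_nonneg ennreal_mult')
    also have "\<dots> = (\<integral>\<^sup>+z. ennreal (k t z) * ennreal (norm (f (z + x) - f x)) \<partial>lborel)"
      using nn_integral_translate[of "\<lambda>y. ennreal (k t (y - x)) * ennreal (norm (f y - f x))" x]
      by (simp add: add.commute)
    finally show ?thesis .
  qed
  have "(\<integral>\<^sup>+x. ennreal (norm (P t f x - f x)) \<partial>lborel)
    \<le> (\<integral>\<^sup>+x. \<integral>\<^sup>+z. ennreal (k t z) * ennreal (norm (f (z + x) - f x)) \<partial>lborel \<partial>lborel)"
    by (intro nn_integral_mono bound)
  also have "\<dots> = (\<integral>\<^sup>+z. \<integral>\<^sup>+x. ennreal (k t z) * ennreal (norm (f (z + x) - f x)) \<partial>lborel \<partial>lborel)"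
    by (rule lborel_pair.Fubini') simp
  also have "\<dots> = (\<integral>\<^sup>+z. ennreal (k t z) * L1_modulus f z \<partial>lborel)"
    by (simp add: L1_modulus_def nn_integral_cmult)
  finally show ?thesis .
qed

text \<open>
  Split \<open>F\<close> at height \<open>e\<close>. The bounded part contributes at most \<open>2 * e\<close> because the kernels have mass one, and on
  the integrable part the uniform continuity of the kernels in time applies.
\<close>

lemma P_right_continuous:
  fixes F :: "'a \<Rightarrow> 'b::euclidean_space"
  assumes t: "0 < t" and F: "power_integrable p F" and p: "1 < p"
  shows "((\<lambda>s. P s F x) \<longlongrightarrow> P t F x) (at_right t)"
proof (rule tendstoI)
  fix \<eta> :: real assume \<eta>: "0 < \<eta>"
  define e where "e = \<eta> / 4"
  define C where "C = e powr (1 - p) * (LINT y|lborel. norm (F y) powr p)"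
  have e: "0 < e" using \<eta> by (simp add: e_def)
  have bound: "norm (P s F x - P t F x) \<le> 2 * e + C * (k t 0 - k s 0)" if s: "t \<le> s" for s
  proof -
    have "P s F x - P t F x = (LINT y|lborel. (k s (y - x) - k t (y - x)) *\<^sub>R F y)"
      using t s integrable_k_scaleR[OF _ F p] by (simp add: P_def scaleR_diff_left)
    also have "norm \<dots> \<le> (LINT y|lborel. (k s (y - x) + k t (y - x)) * e
        + (k t 0 - k s 0) * (e powr (1 - p) * norm (F y) powr p))"
    proof (rule order_trans[OF integral_norm_bound integral_mono])
      show "integrable lborel (\<lambda>y. norm ((k s (y - x) - k t (y - x)) *\<^sub>R F y))"
        using t s integrable_k_scaleR[OF _ F p]
        by (intro integrable_norm) (simp add: scaleR_diff_left)
      show "integrable lborel (\<lambda>y. (k s (y - x) + k t (y - x)) * e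
        + (k t 0 - k s 0) * (e powr (1 - p) * norm (F y) powr p))"
        using k_shift[of s x] k_shift[of t x] t s power_integrableD[OF F]
        by (auto simp: has_bochner_integral_iff)
      fix y
      have "norm ((k s (y - x) - k t (y - x)) *\<^sub>R F y)
        \<le> \<bar>k s (y - x) - k t (y - x)\<bar> * (e + e powr (1 - p) * norm (F y) powr p)"
        using le_cutoff_plus_powr[OF e p, of "norm (F y)"] by (simp add: mult_left_mono)
      also have "\<dots> = \<bar>k s (y - x) - k t (y - x)\<bar> * e
        + \<bar>k t (y - x) - k s (y - x)\<bar> * (e powr (1 - p) * norm (F y) powr p)"
        by (simp add: distrib_left abs_minus_commute)
      also have "\<dots> \<le> (k s (y - x) + k t (y - x)) * e
        + (k t 0 - k s 0) * (e powr (1 - p) * norm (F y) powr p)"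
        using k_oscillation[OF t s, of "y - x"] k_nonneg[of s "y - x"] k_nonneg[of t "y - x"] t s e
        by (intro add_mono mult_right_mono) auto
      finally show "norm ((k s (y - x) - k t (y - x)) *\<^sub>R F y) \<le> (k s (y - x) + k t (y - x)) * e
        + (k t 0 - k s 0) * (e powr (1 - p) * norm (F y) powr p)" .
    qed
    also have "\<dots> = 2 * e + C * (k t 0 - k s 0)"
      using k_shift[of s x] k_shift[of t x] t s power_integrableD[OF F]
      by (simp add: has_bochner_integral_iff C_def)
    finally show ?thesis .
  qed
  have "((\<lambda>s. 2 * e + C * (k t 0 - k s 0)) \<longlongrightarrow> 2 * e + C * (k t 0 - k t 0)) (at_right t)"
    by (intro tendsto_intros k_right_continuous t)
  then have "\<forall>\<^sub>F s in at_right t. 2 * e + C * (k t 0 - k s 0) < \<eta>"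
    by (rule order_tendstoD(2)) (use \<eta> in \<open>simp add: e_def\<close>)
  moreover have "\<forall>\<^sub>F s in at_right t. t \<le> s"
    by (auto simp: eventually_at_filter)
  ultimately show "\<forall>\<^sub>F s in at_right t. dist (P s F x) (P t F x) < \<eta>"
    by eventually_elim (use bound in \<open>force simp: dist_norm\<close>)
qed

text \<open>
  The truncation that turns statements about power-integrable functions into statements about integrable functions
  and functions bounded by \<open>e\<close>.
\<close>

lemma cutoff_decomposition:
  fixes F :: "'a \<Rightarrow> 'b::euclidean_space"
  assumes F: "power_integrable p F" and p: "1 < p" and e: "0 < e"
  defines "F1 \<equiv> \<lambda>x. if norm (F x) \<le> e then 0 else F x" and "F2 \<equiv> \<lambda>x. if norm (F x) \<le> e then F x else 0"
  shows "integrable lborel F1" "power_integrable p F1" "power_integrable p F2"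
    "\<And>x. F x = F1 x + F2 x" "\<And>x. norm (F2 x) \<le> e" "\<And>t x. 0 < t \<Longrightarrow> P t F x = P t F1 x + P t F2 x"
proof -
  note [measurable] = power_integrableD(1)[OF F]
  show F1: "power_integrable p F1" and F2: "power_integrable p F2"
    unfolding power_integrable_def F1_def F2_def
    by (auto intro!: Bochner_Integration.integrable_bound[OF power_integrableD(2)[OF F]])
  show "integrable lborel F1"
  proof (rule Bochner_Integration.integrable_bound)
    show "integrable lborel (\<lambda>x. e powr (1 - p) * norm (F x) powr p)"
      using power_integrableD[OF F] by auto
    have "norm (F1 x) \<le> e powr (1 - p) * norm (F x) powr p" for x
    proof (cases "norm (F x) \<le> e")
      case False
      then have n0: "0 < norm (F x)" using e by linarith
      have "norm (F x) = norm (F x) powr (1 - p) * norm (F x) powr p"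
        using n0 by (simp flip: powr_add)
      also have "\<dots> \<le> e powr (1 - p) * norm (F x) powr p"
        using False e p by (intro mult_right_mono powr_mono2') auto
      finally show ?thesis using False by (simp add: F1_def)
    qed (simp add: F1_def)
    then show "AE x in lborel. norm (F1 x) \<le> norm (e powr (1 - p) * norm (F x) powr p)"
      by simp
  qed (simp add: F1_def)
  show sum: "\<And>x. F x = F1 x + F2 x" and "\<And>x. norm (F2 x) \<le> e"
    using e by (auto simp: F1_def F2_def)
  show "\<And>t x. 0 < t \<Longrightarrow> P t F x = P t F1 x + P t F2 x"
    using integrable_k_scaleR[OF _ F1 p] integrable_k_scaleR[OF _ F2 p]
    by (simp add: P_def sum scaleR_add_right)
qed

text \<open>
  Above the height \<open>e\<close> the function is integrable, so \<open>P t\<close> maps it to a function with bounded \<open>L\<^sup>1\<close> norm and with supremum at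
  most a multiple of \<open>k t 0\<close>, which tends to zero. The part below \<open>e\<close> has small energy for small \<open>e\<close>, and \<open>P t\<close> does not
  increase that energy.
\<close>

lemma power_energy_vanishes:
  fixes F :: "'a \<Rightarrow> real^'n"
  assumes F: "power_integrable p F" and p: "1 < p"
  shows "((\<lambda>t. power_energy p (P t F)) \<longlongrightarrow> 0) at_top"
proof (rule tendsto_0_ennreal_approx)
  fix \<eta> :: real assume \<eta>: "0 < \<eta>"
  note [measurable] = power_integrableD(1)[OF F]
  define F1 where "F1 e x = (if norm (F x) \<le> e then 0 else F x)" for e x
  define F2 where "F2 e x = (if norm (F x) \<le> e then F x else 0)" for e x
  have [measurable]: "F1 e \<in> borel_measurable borel" "F2 e \<in> borel_measurable borel" for e
    by (auto simp: F1_def[abs_def] F2_def[abs_def])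
  have "(\<lambda>n. power_energy p (F2 (inverse (real (Suc n))))) \<longlonglongrightarrow> (\<integral>\<^sup>+x. 0 \<partial>(lborel :: 'a measure))"
    unfolding power_energy_def
  proof (rule nn_integral_dominated_convergence[where w = "\<lambda>x. ennreal (norm (F x) powr p)"])
    show "(\<integral>\<^sup>+ x. ennreal (norm (F x) powr p) \<partial>lborel) < \<infinity>"
      using power_integrableD[OF F] by (simp add: integrable_iff_bounded)
    show "\<And>j. AE x in lborel. ennreal (norm (F2 (inverse (real (Suc j))) x) powr p) \<le> ennreal (norm (F x) powr p)"
      by (auto simp: F2_def)
    show "AE x in lborel. (\<lambda>i. ennreal (norm (F2 (inverse (real (Suc i))) x) powr p)) \<longlonglongrightarrow> 0"
    proof (rule AE_I2, rule tendsto_eventually)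
      fix x
      show "\<forall>\<^sub>F i in sequentially. ennreal (norm (F2 (inverse (real (Suc i))) x) powr p) = 0"
      proof (cases "F x = 0")
        case False
        then have "\<forall>\<^sub>F i in sequentially. inverse (real (Suc i)) < norm (F x)"
          using order_tendstoD(2)[OF LIMSEQ_inverse_real_of_nat] by simp
        then show ?thesis
          by eventually_elim (simp add: F2_def)
      qed (simp add: F2_def)
    qed
  qed auto
  then have "(\<lambda>n. power_energy p (F2 (inverse (real (Suc n))))) \<longlonglongrightarrow> 0" by simp
  then have "\<forall>\<^sub>F n in sequentially. power_energy p (F2 (inverse (real (Suc n)))) < ennreal (\<eta> / 2 powr p)"
    using \<eta> by (intro order_tendstoD(2)) auto
  then obtain n where "power_energy p (F2 (inverse (real (Suc n)))) < ennreal (\<eta> / 2 powr p)"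
    by (auto simp: eventually_sequentially)
  then obtain e where e: "0 < e" "power_energy p (F2 e) < ennreal (\<eta> / 2 powr p)"
    using that[of "inverse (real (Suc n))"] by simp
  have dec1: "integrable lborel (F1 e)" and dec3: "power_integrable p (F2 e)"
    and decP: "\<And>t x. 0 < t \<Longrightarrow> P t F x = P t (F1 e) x + P t (F2 e) x"
    using cutoff_decomposition[OF F p e(1)] by (simp_all add: F1_def[abs_def] F2_def[abs_def])
  define A where "A = (LINT x|lborel. norm (F1 e x))"
  have A: "(\<integral>\<^sup>+x. ennreal (norm (F1 e x)) \<partial>lborel) = ennreal A" "0 \<le> A"
    using dec1 by (auto simp: A_def nn_integral_eq_integral)
  define g where "g t = ennreal (2 powr p * ((k t 0 * A) powr (p - 1) * A))" for t
  have bound: "power_energy p (P t F) \<le> g t + ennreal \<eta>" if t: "0 < t" for t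
  proof -
    have sup: "norm (P t (F1 e) x) \<le> k t 0 * A" for x
    proof -
      have "ennreal (norm (P t (F1 e) x)) \<le> (\<integral>\<^sup>+y. ennreal (k t (y - x)) * ennreal (norm (F1 e y)) \<partial>lborel)"
        by (rule norm_P_le[OF t]) auto
      also have "\<dots> \<le> (\<integral>\<^sup>+y. ennreal (k t 0) * ennreal (norm (F1 e y)) \<partial>lborel)"
        using t by (intro nn_integral_mono mult_right_mono ennreal_leI k_le_k0) auto
      also have "\<dots> = ennreal (k t 0 * A)"
        using t A by (simp add: nn_integral_cmult ennreal_mult k_nonneg)
      finally show ?thesis
        using t A by (simp add: k_nonneg)
    qed
    have "power_energy p (P t (F1 e)) \<le> (\<integral>\<^sup>+x. ennreal ((k t 0 * A) powr (p - 1)) * ennreal (norm (P t (F1 e) x)) \<partial>lborel)"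
      unfolding power_energy_def
    proof (intro nn_integral_mono)
      fix x
      have "norm (P t (F1 e) x) powr p = norm (P t (F1 e) x) powr (p - 1) * norm (P t (F1 e) x)"
        using powr_mult_base[of "norm (P t (F1 e) x)" "p - 1"] by (simp add: mult.commute)
      also have "\<dots> \<le> (k t 0 * A) powr (p - 1) * norm (P t (F1 e) x)"
        using sup p by (intro mult_right_mono powr_mono2) auto
      finally show "ennreal (norm (P t (F1 e) x) powr p) \<le> ennreal ((k t 0 * A) powr (p - 1)) * ennreal (norm (P t (F1 e) x))"
        by (simp flip: ennreal_mult')
    qed
    also have "\<dots> \<le> ennreal ((k t 0 * A) powr (p - 1)) * ennreal A"
      using L1_contraction[OF t, of "F1 e"] A by (simp add: nn_integral_cmult mult_left_mono)
    finally have E1: "power_energy p (P t (F1 e)) \<le> ennreal ((k t 0 * A) powr (p - 1) * A)"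
      by (simp add: ennreal_mult')
    have E2: "power_energy p (P t (F2 e)) \<le> ennreal (\<eta> / 2 powr p)"
      using power_energy_P_le[OF less_imp_le[OF t] dec3 p] e by auto
    have "power_energy p (P t F) \<le> (\<integral>\<^sup>+x. ennreal (2 powr p) * ennreal (norm (P t (F1 e) x) powr p)
       + ennreal (2 powr p) * ennreal (norm (P t (F2 e) x) powr p) \<partial>lborel)"
      unfolding power_energy_def
    proof (intro nn_integral_mono)
      fix x
      define a b where "a = norm (P t (F1 e) x)" and "b = norm (P t (F2 e) x)"
      have "norm (P t F x) powr p \<le> (2 * max a b) powr p"
        using p norm_triangle_ineq[of "P t (F1 e) x" "P t (F2 e) x"] decP[OF t, of x]
        by (intro powr_mono2) (auto simp: a_def b_def)
      also have "\<dots> \<le> 2 powr p * (a powr p + b powr p)"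
        by (auto simp: powr_mult max_def a_def b_def distrib_left)
      finally show "ennreal (norm (P t F x) powr p) \<le> ennreal (2 powr p) * ennreal (norm (P t (F1 e) x) powr p)
       + ennreal (2 powr p) * ennreal (norm (P t (F2 e) x) powr p)"
        by (simp add: a_def b_def distrib_left flip: ennreal_mult' ennreal_plus)
    qed
    also have "\<dots> = ennreal (2 powr p) * power_energy p (P t (F1 e)) + ennreal (2 powr p) * power_energy p (P t (F2 e))"
      unfolding power_energy_def by (subst nn_integral_add) (auto simp: nn_integral_cmult)
    also have "\<dots> \<le> ennreal (2 powr p) * ennreal ((k t 0 * A) powr (p - 1) * A) + ennreal (2 powr p) * ennreal (\<eta> / 2 powr p)"
      by (intro add_mono mult_left_mono E1 E2) auto
    also have "\<dots> = g t + ennreal \<eta>"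
      by (simp add: g_def flip: ennreal_mult')
    finally show ?thesis .
  qed
  have "\<forall>\<^sub>F t in at_top. 0 \<le> k t 0 * A"
    using eventually_gt_at_top[of "0::real"] by eventually_elim (simp add: A k_nonneg)
  then have "((\<lambda>t. (k t 0 * A) powr (p - 1)) \<longlongrightarrow> (0 * A) powr (p - 1)) at_top"
    using p by (intro tendsto_powr' tendsto_intros k_vanishes) auto
  then have "(g \<longlongrightarrow> ennreal (2 powr p * (0 * A))) at_top"
    using p unfolding g_def by (intro tendsto_intros) auto
  then have "(g \<longlongrightarrow> 0) at_top" by simp
  moreover have "\<forall>\<^sub>F t in at_top. power_energy p (P t F) \<le> g t + ennreal \<eta>"
    using eventually_gt_at_top[of 0] by eventually_elim (rule bound)
  ultimately show "\<exists>g. (g \<longlongrightarrow> 0) at_top \<and> (\<forall>\<^sub>F t in at_top. power_energy p (P t F) \<le> g t + ennreal \<eta>)"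
    by blast
qed

end

section \<open>Behaviour of the semigroup at time zero\<close>

text \<open>
  The density \<open>\<nu>\<close> is the limit of the quotients \<open>k t x / t\<close>, and the bound \<open>c * \<nu> x\<close> on these quotients is what allows
  passing to the limit under integrals.
\<close>

locale levy_semigroup = convolution_semigroup k for k :: "real \<Rightarrow> 'a::euclidean_space \<Rightarrow> real" +
  fixes \<nu> :: "'a \<Rightarrow> real" and c :: real
  assumes nu_measurable [measurable]: "\<nu> \<in> borel_measurable borel"
    and nu_nonneg: "0 \<le> \<nu> x"
    and nu_tail: "0 < \<delta> \<Longrightarrow> (\<integral>\<^sup>+z. ennreal (\<nu> z) * indicator {z. \<delta> \<le> norm z} z \<partial>lborel) < \<infinity>"
    and c_nonneg: "0 \<le> c"
    and k_le_nu: "0 < t \<Longrightarrow> x \<noteq> 0 \<Longrightarrow> k t x \<le> t * (c * \<nu> x)"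
    and k_over_t: "x \<noteq> 0 \<Longrightarrow> ((\<lambda>t. k t x / t) \<longlongrightarrow> \<nu> x) (at_right 0)"
begin

text \<open>
  The mass that \<open>k t\<close> puts outside a ball is at most \<open>c t\<close> times the finite mass that \<open>\<nu>\<close> puts there.
\<close>

lemma tail_vanishes:
  assumes \<delta>: "0 < \<delta>"
  shows "((\<lambda>t. \<integral>\<^sup>+z. ennreal (k t z) * indicator {z. \<delta> \<le> norm z} z \<partial>lborel) \<longlongrightarrow> 0) (at_right 0)"
proof -
  obtain N where N: "(\<integral>\<^sup>+z. ennreal (\<nu> z) * indicator {z. \<delta> \<le> norm z} z \<partial>lborel) = ennreal N" "0 \<le> N"
    using nu_tail[OF \<delta>] by (cases "\<integral>\<^sup>+z. ennreal (\<nu> z) * indicator {z. \<delta> \<le> norm z} z \<partial>lborel") auto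
  have bound: "(\<integral>\<^sup>+z. ennreal (k t z) * indicator {z. \<delta> \<le> norm z} z \<partial>lborel) \<le> ennreal (t * (c * N))" if t: "0 < t" for t
  proof -
    have "(\<integral>\<^sup>+z. ennreal (k t z) * indicator {z. \<delta> \<le> norm z} z \<partial>lborel) \<le>
      (\<integral>\<^sup>+z. ennreal (t * c) * (ennreal (\<nu> z) * indicator {z. \<delta> \<le> norm z} z) \<partial>lborel)"
    proof (intro nn_integral_mono)
      fix z
      show "ennreal (k t z) * indicator {z. \<delta> \<le> norm z} z \<le> ennreal (t * c) * (ennreal (\<nu> z) * indicator {z. \<delta> \<le> norm z} z)"
        using k_le_nu[OF t, of z] \<delta> t c_nonneg nu_nonneg[of z]
        by (cases "z = 0") (auto split: split_indicator simp: mult.assoc simp flip: ennreal_mult')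
    qed
    also have "\<dots> = ennreal (t * (c * N))"
      using N t c_nonneg by (simp add: nn_integral_cmult mult.assoc flip: ennreal_mult')
    finally show ?thesis .
  qed
  have "((\<lambda>t. ennreal (t * (c * N))) \<longlongrightarrow> ennreal (0 * (c * N))) (at_right 0)"
    by (intro tendsto_intros)
  then have lim: "((\<lambda>t. ennreal (t * (c * N))) \<longlongrightarrow> 0) (at_right 0)" by simp
  have ev: "\<forall>\<^sub>F t in at_right (0::real). (\<integral>\<^sup>+z. ennreal (k t z) * indicator {z. \<delta> \<le> norm z} z \<partial>lborel) \<le> ennreal (t * (c * N))"
    using eventually_at_right_less[of "0::real"] by eventually_elim (rule bound)
  show ?thesis
    by (rule tendsto_sandwich[OF _ ev tendsto_const lim]) simp
qed

text \<open>
  An approximate identity argument: near the origin the modulus of continuity is small, and away from the origin the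
  kernel has little mass.
\<close>

lemma L1_strongly_continuous:
  fixes f :: "'a \<Rightarrow> 'b::euclidean_space"
  assumes f: "integrable lborel f"
  shows "((\<lambda>t. \<integral>\<^sup>+x. ennreal (norm (P t f x - f x)) \<partial>lborel) \<longlongrightarrow> 0) (at_right 0)"
proof (rule tendsto_0_ennreal_approx)
  fix e :: real assume e: "0 < e"
  have [measurable]: "f \<in> borel_measurable borel" using f by auto
  have [measurable]: "L1_modulus f \<in> borel_measurable borel"
    unfolding L1_modulus_def[abs_def] by measurable
  have "\<forall>\<^sub>F z in at 0. L1_modulus f z < ennreal e"
    using order_tendstoD(2)[OF L1_modulus_tendsto_0[OF f]] e by auto
  then obtain \<delta> where \<delta>: "0 < \<delta>" "\<And>z. z \<noteq> 0 \<Longrightarrow> norm z < \<delta> \<Longrightarrow> L1_modulus f z < ennreal e"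
    by (auto simp: eventually_at)
  have small: "L1_modulus f z \<le> ennreal e" if "norm z < \<delta>" for z
    using \<delta>(2)[of z] that by (cases "z = 0") (auto simp: L1_modulus_def)
  define M where "M = 2 * (\<integral>\<^sup>+x. ennreal (norm (f x)) \<partial>lborel)"
  have M: "M < \<infinity>"
    using f by (auto simp: M_def integrable_iff_bounded ennreal_mult_less_top)
  define g where "g t = M * (\<integral>\<^sup>+z. ennreal (k t z) * indicator {z. \<delta> \<le> norm z} z \<partial>lborel)" for t
  have "(\<integral>\<^sup>+x. ennreal (norm (P t f x - f x)) \<partial>lborel) \<le> g t + ennreal e" if t: "0 < t" for t
  proof -
    have "(\<integral>\<^sup>+x. ennreal (norm (P t f x - f x)) \<partial>lborel) \<le> (\<integral>\<^sup>+z. ennreal (k t z) * L1_modulus f z \<partial>lborel)"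
      by (rule P_diff_le_L1_modulus[OF t f])
    also have "\<dots> \<le> (\<integral>\<^sup>+z. M * (ennreal (k t z) * indicator {z. \<delta> \<le> norm z} z) + ennreal (k t z) * ennreal e \<partial>lborel)"
    proof (intro nn_integral_mono)
      fix z
      show "ennreal (k t z) * L1_modulus f z \<le> M * (ennreal (k t z) * indicator {z. \<delta> \<le> norm z} z) + ennreal (k t z) * ennreal e"
      proof (cases "norm z < \<delta>")
        case True
        then show ?thesis using small[of z] by (simp add: mult_left_mono)
      next
        case False
        have "ennreal (k t z) * L1_modulus f z \<le> ennreal (k t z) * M"
          using L1_modulus_le[of f z] by (intro mult_left_mono) (auto simp: M_def)
        then show ?thesis using False by (simp add: mult.commute add_increasing2)
      qed
    qed
    also have "\<dots> = g t + ennreal e"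
      using nn_integral_k(1)[OF t, of 0] by (simp add: nn_integral_add nn_integral_cmult nn_integral_multc g_def)
    finally show ?thesis .
  qed
  then have "\<forall>\<^sub>F t in at_right 0. (\<integral>\<^sup>+x. ennreal (norm (P t f x - f x)) \<partial>lborel) \<le> g t + ennreal e"
    using eventually_at_right_less[of "0::real"] by (auto elim: eventually_mono)
  moreover have "(g \<longlongrightarrow> 0) (at_right 0)"
    using ennreal_tendsto_cmult[OF _ tail_vanishes[OF \<delta>(1)], of M] M unfolding g_def by simp
  ultimately show "\<exists>g. (g \<longlongrightarrow> 0) (at_right 0) \<and>
    (\<forall>\<^sub>F t in at_right 0. (\<integral>\<^sup>+x. ennreal (norm (P t f x - f x)) \<partial>lborel) \<le> g t + ennreal e)"
    by blast
qed

text \<open>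
  Strong continuity in the space of \<open>p\<close>-integrable functions itself would do, but convergence in a weighted \<open>L\<^sup>1\<close> space is
  easier to get and still yields almost everywhere convergence along a subsequence. The integrable weight absorbs the
  bounded part of \<open>F\<close>.
\<close>

lemma weighted_L1_continuous:
  fixes F :: "'a \<Rightarrow> 'b::euclidean_space"
  assumes F: "power_integrable p F" and p: "1 < p"
    and w: "integrable lborel w" "\<And>x. 0 < w x" "\<And>x. w x \<le> 1"
  shows "((\<lambda>t. \<integral>\<^sup>+x. ennreal (w x * norm (P t F x - F x)) \<partial>lborel) \<longlongrightarrow> 0) (at_right 0)"
proof (rule tendsto_0_ennreal_approx)
  fix e :: real assume e: "0 < e"
  note [measurable] = power_integrableD(1)[OF F]
  have [measurable]: "w \<in> borel_measurable borel" using w by auto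
  define W where "W = (LINT x|lborel. w x)"
  have W: "0 \<le> W" unfolding W_def using w(2) by (intro integral_nonneg_AE AE_I2 less_imp_le)
  define d where "d = e / (2 * (W + 1))"
  have d: "0 < d" "2 * d * W \<le> e"
    using e W by (auto simp: d_def field_simps)
  define F1 F2 where "F1 x = (if norm (F x) \<le> d then 0 else F x)" and "F2 x = (if norm (F x) \<le> d then F x else 0)" for x
  have dec: "integrable lborel F1" "\<And>x. F x = F1 x + F2 x" "\<And>x. norm (F2 x) \<le> d"
    "\<And>t x. 0 < t \<Longrightarrow> P t F x = P t F1 x + P t F2 x"
    using cutoff_decomposition[OF F p d(1)] by (simp_all add: F1_def[abs_def] F2_def[abs_def])
  have [measurable]: "F1 \<in> borel_measurable borel" "F2 \<in> borel_measurable borel"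
    by (auto simp: F1_def[abs_def] F2_def[abs_def])
  have "(\<integral>\<^sup>+x. ennreal (w x * norm (P t F x - F x)) \<partial>lborel)
     \<le> (\<integral>\<^sup>+x. ennreal (norm (P t F1 x - F1 x)) \<partial>lborel) + ennreal e" if t: "0 < t" for t
  proof -
    have P2: "norm (P t F2 x) \<le> d" for x
    proof -
      have "ennreal (norm (P t F2 x)) \<le> (\<integral>\<^sup>+y. ennreal (k t (y - x)) * ennreal (norm (F2 y)) \<partial>lborel)"
        by (rule norm_P_le[OF t]) auto
      also have "\<dots> \<le> (\<integral>\<^sup>+y. ennreal (k t (y - x)) * ennreal d \<partial>lborel)"
        using dec(3) by (intro nn_integral_mono mult_left_mono ennreal_leI) auto
      also have "\<dots> = ennreal d"
        using t by (simp add: nn_integral_multc nn_integral_k)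
      finally show ?thesis using d by simp
    qed
    have "(\<integral>\<^sup>+x. ennreal (w x * norm (P t F x - F x)) \<partial>lborel)
      \<le> (\<integral>\<^sup>+x. ennreal (norm (P t F1 x - F1 x)) + ennreal (w x * (2 * d)) \<partial>lborel)"
    proof (intro nn_integral_mono)
      fix x
      have "norm (P t F x - F x) \<le> norm (P t F1 x - F1 x) + norm (P t F2 x - F2 x)"
        using norm_triangle_ineq[of "P t F1 x - F1 x" "P t F2 x - F2 x"] dec(4)[OF t, of x] dec(2)[of x]
        by (simp add: algebra_simps)
      moreover have "norm (P t F2 x - F2 x) \<le> 2 * d"
        using norm_triangle_ineq4[of "P t F2 x" "F2 x"] P2[of x] dec(3)[of x] by simp
      ultimately have "w x * norm (P t F x - F x) \<le> w x * (norm (P t F1 x - F1 x) + 2 * d)"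
        using w(2)[of x] by (intro mult_left_mono) auto
      also have "\<dots> \<le> 1 * norm (P t F1 x - F1 x) + w x * (2 * d)"
        unfolding distrib_left using w(3)[of x] by (intro add_right_mono mult_right_mono) auto
      finally show "ennreal (w x * norm (P t F x - F x)) \<le> ennreal (norm (P t F1 x - F1 x)) + ennreal (w x * (2 * d))"
        using w(2)[of x] d by (simp flip: ennreal_plus)
    qed
    also have "\<dots> = (\<integral>\<^sup>+x. ennreal (norm (P t F1 x - F1 x)) \<partial>lborel) + (\<integral>\<^sup>+x. ennreal (w x * (2 * d)) \<partial>lborel)"
      by (rule nn_integral_add) auto
    also have "(\<integral>\<^sup>+x. ennreal (w x * (2 * d)) \<partial>lborel) = ennreal (W * (2 * d))"
      using w d by (subst nn_integral_eq_integral) (auto simp: W_def less_imp_le)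
    also have "\<dots> \<le> ennreal e" using d by (intro ennreal_leI) (simp add: mult.commute)
    finally show ?thesis by (simp add: add_left_mono)
  qed
  then have "\<forall>\<^sub>F t in at_right 0. (\<integral>\<^sup>+x. ennreal (w x * norm (P t F x - F x)) \<partial>lborel)
     \<le> (\<integral>\<^sup>+x. ennreal (norm (P t F1 x - F1 x)) \<partial>lborel) + ennreal e"
    using eventually_at_right_less[of "0::real"] by (auto elim: eventually_mono)
  then show "\<exists>g. (g \<longlongrightarrow> 0) (at_right 0) \<and> (\<forall>\<^sub>F t in at_right 0.
      (\<integral>\<^sup>+x. ennreal (w x * norm (P t F x - F x)) \<partial>lborel) \<le> g t + ennreal e)"
    using L1_strongly_continuous[OF dec(1)] by blast
qed

lemma P_AE_subsequence:
  fixes F :: "'a \<Rightarrow> 'b::euclidean_space"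
  assumes F: "power_integrable p F" and p: "1 < p"
  obtains T :: "nat \<Rightarrow> real" where "\<And>n. 0 < T n" "AE x in lborel. (\<lambda>n. P (T n) F x) \<longlonglongrightarrow> F x"
proof -
  note [measurable] = power_integrableD(1)[OF F]
  obtain w :: "'a \<Rightarrow> real" where w: "w \<in> borel_measurable lborel" "\<And>x. 0 < w x" "\<And>x. w x \<le> 1" "integrable lborel w"
    using sigma_finite_measure.obtain_positive_integrable_function[OF lborel.sigma_finite_measure_axioms] by blast
  then have [measurable]: "w \<in> borel_measurable borel" by auto
  define W where "W t = (\<integral>\<^sup>+x. ennreal (w x * norm (P t F x - F x)) \<partial>lborel)" for t
  have W0: "(W \<longlongrightarrow> 0) (at_right 0)"
    unfolding W_def by (rule weighted_L1_continuous[OF F p w(4,2,3)])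
  have seq: "filterlim (\<lambda>n. inverse (real (Suc n))) (at_right 0) sequentially"
    using LIMSEQ_inverse_real_of_nat by (auto simp: filterlim_at)
  have W1: "(\<lambda>n. W (inverse (real (Suc n)))) \<longlonglongrightarrow> 0"
    using filterlim_compose[OF W0 seq] by simp
  then have "\<forall>\<^sub>F n in sequentially. W (inverse (real (Suc n))) < 1"
    by (rule order_tendstoD(2)) simp
  \<comment> \<open>Dropping the first \<open>N\<close> terms makes every remaining function integrable.\<close>
  then obtain N where N: "\<And>n. N \<le> n \<Longrightarrow> W (inverse (real (Suc n))) < 1"
    by (auto simp: eventually_sequentially)
  define S where "S n = inverse (real (Suc (n + N)))" for n
  have S: "0 < S n" for n by (simp add: S_def)
  have WS: "(\<lambda>n. W (S n)) \<longlonglongrightarrow> 0"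
    using LIMSEQ_ignore_initial_segment[OF W1, of N] by (simp add: S_def)
  have WS1: "W (S n) < 1" for n
    using N[of "n + N"] by (simp add: S_def)
  define u where "u n x = w x *\<^sub>R (P (S n) F x - F x)" for n x
  have normu: "norm (u n x) = w x * norm (P (S n) F x - F x)" for n x
    using w(2)[of x] by (simp add: u_def)
  have [measurable]: "u n \<in> borel_measurable borel" for n
    unfolding u_def[abs_def] by measurable
  have intu: "integrable lborel (u n)" for n
    using WS1[of n] by (auto simp: integrable_iff_bounded normu W_def intro: order_less_trans)
  have "W (S n) = ennreal (LINT x|lborel. norm (u n x))" for n
    unfolding W_def normu[symmetric] using intu by (subst nn_integral_eq_integral) auto
  with WS have "(\<lambda>n. ennreal (LINT x|lborel. norm (u n x))) \<longlonglongrightarrow> ennreal 0" by simp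
  then have "(\<lambda>n. LINT x|lborel. norm (u n x)) \<longlonglongrightarrow> 0"
    by (subst (asm) tendsto_ennreal_iff) auto
  from tendsto_L1_AE_subseq[OF intu this] obtain r where r: "strict_mono r" "AE x in lborel. (\<lambda>n. u (r n) x) \<longlonglongrightarrow> 0"
    by blast
  from r(2) have "AE x in lborel. (\<lambda>n. P (S (r n)) F x) \<longlonglongrightarrow> F x"
  proof eventually_elim
    case (elim x)
    have "(\<lambda>n. inverse (w x) *\<^sub>R u (r n) x + F x) \<longlonglongrightarrow> inverse (w x) *\<^sub>R 0 + F x"
      by (intro tendsto_intros elim)
    then show ?case using w(2)[of x] by (simp add: u_def)
  qed
  then show ?thesis using S by (intro that[of "\<lambda>n. S (r n)"])
qed

lemma power_energy_lower_semicontinuous: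
  fixes F :: "'a \<Rightarrow> 'b::euclidean_space"
  assumes F: "power_integrable p F" and p: "1 < p"
    and C: "\<And>t. 0 < t \<Longrightarrow> power_energy p (P t F) \<le> C"
  shows "power_energy p F \<le> C"
proof -
  note [measurable] = power_integrableD(1)[OF F]
  obtain T where T: "\<And>n::nat. 0 < T n" "AE x in lborel. (\<lambda>n. P (T n) F x) \<longlonglongrightarrow> F x"
    using P_AE_subsequence[OF F p] by blast
  have "power_energy p F = (\<integral>\<^sup>+x. liminf (\<lambda>n. ennreal (norm (P (T n) F x) powr p)) \<partial>lborel)"
    unfolding power_energy_def
  proof (rule nn_integral_cong_AE)
    show "AE x in lborel. ennreal (norm (F x) powr p) = liminf (\<lambda>n. ennreal (norm (P (T n) F x) powr p))"
      using T(2)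
    proof eventually_elim
      case (elim x)
      have "(\<lambda>n. ennreal (norm (P (T n) F x) powr p)) \<longlonglongrightarrow> ennreal (norm (F x) powr p)"
        using p by (intro tendsto_intros tendsto_powr' elim) auto
      from lim_imp_Liminf[OF _ this] show ?case by simp
    qed
  qed
  also have "\<dots> \<le> liminf (\<lambda>n. power_energy p (P (T n) F))"
    unfolding power_energy_def by (rule nn_integral_liminf) measurable
  also have "\<dots> \<le> liminf (\<lambda>n::nat. C)"
    using C T(1) by (intro Liminf_mono) auto
  finally show ?thesis by (simp add: Liminf_const)
qed

end

section \<open>Energy balance\<close>

text \<open>
  Regarding the threefold iterated integral as one integral allows a single use of Fatou's lemma and of dominated convergence.
\<close>

lemma nn_integral_triple:
  fixes f :: "real \<Rightarrow> 'a::euclidean_space \<Rightarrow> 'b::euclidean_space \<Rightarrow> ennreal"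
  assumes f: "(\<lambda>(t, x, y). f t x y) \<in> borel_measurable borel"
  shows "(\<integral>\<^sup>+t. \<integral>\<^sup>+x. \<integral>\<^sup>+y. f t x y \<partial>lborel \<partial>lborel \<partial>lborel) = (\<integral>\<^sup>+(t, x, y). f t x y \<partial>lborel)"
proof -
  have [measurable]: "(\<lambda>(t, x, y). f t x y) \<in> borel_measurable (borel \<Otimes>\<^sub>M borel \<Otimes>\<^sub>M borel)"
    using f by (simp add: borel_prod)
  have "(\<integral>\<^sup>+t. \<integral>\<^sup>+x. \<integral>\<^sup>+y. f t x y \<partial>lborel \<partial>lborel \<partial>lborel)
    = (\<integral>\<^sup>+t. (\<integral>\<^sup>+z. (case z of (x, y) \<Rightarrow> f t x y) \<partial>(lborel \<Otimes>\<^sub>M lborel)) \<partial>lborel)"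
  proof (intro nn_integral_cong)
    fix t
    show "(\<integral>\<^sup>+x. \<integral>\<^sup>+y. f t x y \<partial>lborel \<partial>lborel) = (\<integral>\<^sup>+z. (case z of (x, y) \<Rightarrow> f t x y) \<partial>(lborel \<Otimes>\<^sub>M lborel))"
      using lborel.nn_integral_fst[of "\<lambda>(x, y). f t x y" lborel] by simp
  qed
  also have "\<dots> = (\<integral>\<^sup>+t. (\<integral>\<^sup>+z. (case z of (x, y) \<Rightarrow> f t x y) \<partial>(lborel :: ('a \<times> 'b) measure)) \<partial>lborel)"
    by (simp add: lborel_prod)
  also have "\<dots> = (\<integral>\<^sup>+(t, x, y). f t x y \<partial>(lborel \<Otimes>\<^sub>M lborel))"
    using lborel.nn_integral_fst[of "\<lambda>(t, x, y). f t x y" lborel] f by (simp add: borel_prod lborel_prod)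
  finally show ?thesis by (simp add: lborel_prod)
qed

lemma nn_integral_shift_Ioc:
  fixes a :: "real \<Rightarrow> ennreal"
  assumes [measurable]: "a \<in> borel_measurable borel"
  shows "(\<integral>\<^sup>+t\<in>{0<..T}. a (t + h) \<partial>lborel) = (\<integral>\<^sup>+t\<in>{h<..T + h}. a t \<partial>lborel)"
proof -
  have "(\<integral>\<^sup>+t\<in>{h<..T + h}. a t \<partial>lborel) = (\<integral>\<^sup>+t. a (h + t) * indicator {h<..T + h} (h + t) \<partial>lborel)"
    by (rule nn_integral_translate[symmetric]) measurable
  also have "\<dots> = (\<integral>\<^sup>+t\<in>{0<..T}. a (t + h) \<partial>lborel)"
    by (intro nn_integral_cong) (auto split: split_indicator simp: add.commute)
  finally show ?thesis by simp
qed

text \<open>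
  Together with the next lemma: the integral of \<open>a t - a (t + h)\<close> over \<open>{0<..T}\<close> telescopes to the difference of the
  integrals of \<open>a\<close> over \<open>{0<..h}\<close> and \<open>{T<..T + h}\<close>, and monotonicity bounds these by values of \<open>a\<close>. The subtrahends
  are moved to the other side since the values are extended nonnegative reals.
\<close>

lemma antitone_increment_le:
  fixes a :: "real \<Rightarrow> ennreal"
  assumes [measurable]: "a \<in> borel_measurable borel"
    and mono: "\<And>s t. 0 \<le> s \<Longrightarrow> s \<le> t \<Longrightarrow> a t \<le> a s" and h: "0 < h"
  shows "(\<integral>\<^sup>+t\<in>{0<..T}. a t \<partial>lborel) \<le> ennreal h * a 0 + (\<integral>\<^sup>+t\<in>{0<..T}. a (t + h) \<partial>lborel)"
proof -
  have "(\<integral>\<^sup>+t\<in>{0<..T}. a t \<partial>lborel) \<le> (\<integral>\<^sup>+t. a 0 * indicator {0<..h} t + a t * indicator {h<..T + h} t \<partial>lborel)"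
    using h by (intro nn_integral_mono) (auto split: split_indicator intro: mono)
  also have "\<dots> = ennreal h * a 0 + (\<integral>\<^sup>+t\<in>{h<..T + h}. a t \<partial>lborel)"
    using h by (simp add: nn_integral_add nn_integral_cmult mult.commute)
  finally show ?thesis by (simp add: nn_integral_shift_Ioc)
qed

lemma antitone_increment_ge:
  fixes a :: "real \<Rightarrow> ennreal"
  assumes [measurable]: "a \<in> borel_measurable borel"
    and mono: "\<And>s t. 0 \<le> s \<Longrightarrow> s \<le> t \<Longrightarrow> a t \<le> a s" and h: "0 < h" "h \<le> T"
  shows "ennreal h * a h + (\<integral>\<^sup>+t\<in>{0<..T}. a (t + h) \<partial>lborel) \<le> (\<integral>\<^sup>+t\<in>{0<..T}. a t \<partial>lborel) + ennreal h * a T"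
proof -
  have "ennreal h * a h + (\<integral>\<^sup>+t\<in>{h<..T + h}. a t \<partial>lborel)
    = (\<integral>\<^sup>+t. a h * indicator {0<..h} t + a t * indicator {h<..T + h} t \<partial>lborel)"
    using h by (simp add: nn_integral_add nn_integral_cmult mult.commute)
  also have "\<dots> \<le> (\<integral>\<^sup>+t. a t * indicator {0<..T} t + a T * indicator {T<..T + h} t \<partial>lborel)"
    using h by (intro nn_integral_mono) (auto split: split_indicator intro: mono)
  also have "\<dots> = (\<integral>\<^sup>+t\<in>{0<..T}. a t \<partial>lborel) + ennreal h * a T"
    using h by (simp add: nn_integral_add nn_integral_cmult mult.commute)
  finally show ?thesis by (simp add: nn_integral_shift_Ioc)
qed

context levy_semigroup
begin

definition dissipation :: "real \<Rightarrow> ('a \<Rightarrow> real^'n) \<Rightarrow> real \<Rightarrow> ennreal" where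
  "dissipation p F t = (\<integral>\<^sup>+x. \<integral>\<^sup>+y. ennreal (bregman p (P t F x) (P t F y) * \<nu> (y - x)) \<partial>lborel \<partial>lborel)"

lemma energy_antitone:
  fixes F :: "'a \<Rightarrow> real^'n"
  assumes F: "power_integrable p F" and p: "1 < p" and "0 \<le> s" "s \<le> t"
  shows "power_energy p (P t F) \<le> power_energy p (P s F)"
proof (cases "s = t")
  case False
  then have "P t F = P (t - s) (P s F)"
    using assms P_semigroup[of "t - s" s p F] by (auto simp: fun_eq_iff)
  then show ?thesis
    using power_energy_P_le[OF _ power_integrable_P[OF \<open>0 \<le> s\<close> F p] p, of "t - s"] assms by simp
qed simp

lemma borel_measurable_energy:
  fixes F :: "'a \<Rightarrow> real^'n"
  assumes F: "power_integrable p F"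
  shows "(\<lambda>t. power_energy p (P t F)) \<in> borel_measurable borel"
proof -
  note [measurable] = power_integrableD(1)[OF F]
  show ?thesis unfolding power_energy_def by measurable
qed

lemma nn_integral_energy_finite:
  fixes F :: "'a \<Rightarrow> real^'n"
  assumes F: "power_integrable p F" and p: "1 < p" and h: "0 \<le> h"
  shows "(\<integral>\<^sup>+t\<in>{0<..T}. power_energy p (P (t + h) F) \<partial>lborel) < \<infinity>"
proof -
  have "(\<integral>\<^sup>+t\<in>{0<..T}. power_energy p (P (t + h) F) \<partial>lborel) \<le> (\<integral>\<^sup>+t\<in>{0<..T}. power_energy p F \<partial>(lborel :: real measure))"
    using energy_antitone[OF F p, of 0] h by (intro nn_integral_mono) (auto split: split_indicator)
  also have "\<dots> < \<infinity>"
    using F power_integrable_iff[OF power_integrableD(1)[OF F]]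
    by (cases "0 \<le> T") (auto simp: nn_integral_cmult_indicator ennreal_mult_less_top)
  finally show ?thesis .
qed

lemma P_shift_continuous:
  fixes F :: "'a \<Rightarrow> 'b::euclidean_space"
  assumes F: "power_integrable p F" and p: "1 < p" and t: "0 < t"
    and H: "filterlim H (at_right 0) G"
  shows "((\<lambda>n. P (t + H n) F x) \<longlongrightarrow> P t F x) G"
proof -
  have "filterlim (\<lambda>h. t + h) (at_right t) (at_right 0)"
    by (subst at_right_to_0[of t]) (simp add: filterlim_iff eventually_filtermap add.commute)
  from filterlim_compose[OF P_right_continuous[OF t F p] filterlim_compose[OF this H]]
  show ?thesis .
qed

lemma nn_integral_scaled:
  fixes f :: "'a \<Rightarrow> 'a \<Rightarrow> real"
  assumes h: "0 < h" and [measurable]: "(\<lambda>(x, y). f x y) \<in> borel_measurable (borel \<Otimes>\<^sub>M borel)"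
  shows "(\<integral>\<^sup>+x. \<integral>\<^sup>+y. ennreal (f x y * k h (y - x)) \<partial>lborel \<partial>lborel)
    = ennreal h * (\<integral>\<^sup>+x. \<integral>\<^sup>+y. ennreal (f x y * (k h (y - x) / h)) \<partial>lborel \<partial>lborel)"
proof -
  have "ennreal (f x y * k h (y - x)) = ennreal h * ennreal (f x y * (k h (y - x) / h))" for x y
    using h by (subst ennreal_mult'[symmetric]) auto
  then show ?thesis
    by (simp add: nn_integral_cmult)
qed

text \<open>
  Fatou's lemma for the difference quotients in the exact energy identity. Their integrals over \<open>{0<..T}\<close> are at most the
  initial energy since they telescope.
\<close>

lemma dissipation_le_energy:
  fixes F :: "'a \<Rightarrow> real^'n"
  assumes F: "power_integrable p F" and p: "1 < p"
  shows "(\<integral>\<^sup>+t\<in>{0<..T}. dissipation p F t \<partial>lborel) \<le> power_energy p F"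
proof -
  note [measurable] = power_integrableD(1)[OF F]
  define H where "H n = inverse (real (Suc n))" for n
  have H0: "0 < H n" for n by (simp add: H_def)
  have H: "filterlim H (at_right 0) sequentially"
    using LIMSEQ_inverse_real_of_nat by (auto simp: filterlim_at H_def[abs_def])
  \<comment> \<open>At \<open>x = y\<close> the quotients may blow up, but there the limit \<open>I\<close> is \<open>0\<close>, which is all that Fatou's lemma needs.\<close>
  define J where "J h t x y = ennreal (bregman p (P (t + h) F x) (P t F y) * (k h (y - x) / h)) * indicator {0<..T} t" for h t x y
  define I where "I t x y = ennreal (bregman p (P t F x) (P t F y) * \<nu> (y - x)) * indicator {0<..T} t" for t x y
  have Jm [measurable]: "(\<lambda>(t, x, y). J h t x y) \<in> borel_measurable borel" for h
    unfolding J_def borel_prod[symmetric] by measurable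
  have Im [measurable]: "(\<lambda>(t, x, y). I t x y) \<in> borel_measurable borel"
    unfolding I_def borel_prod[symmetric] by measurable
  have JE: "(\<integral>\<^sup>+(t, x, y). J h t x y \<partial>lborel) \<le> power_energy p F" if h: "0 < h" for h
  proof -
    define j where "j t = (\<integral>\<^sup>+x. \<integral>\<^sup>+y. J h t x y \<partial>lborel \<partial>lborel)" for t
    have [measurable]: "j \<in> borel_measurable borel"
      unfolding j_def[abs_def] J_def by measurable
    note [measurable] = borel_measurable_energy[OF F]
    have "ennreal h * j t + power_energy p (P (t + h) F) * indicator {0<..T} t = power_energy p (P t F) * indicator {0<..T} t" for t
    proof (cases "t \<in> {0<..T}")
      case True
      then have t: "0 \<le> t" by simp
      have "ennreal h * j t = (\<integral>\<^sup>+x. \<integral>\<^sup>+y. ennreal (bregman p (P (t + h) F x) (P t F y) * k h (y - x)) \<partial>lborel \<partial>lborel)"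
        using True by (subst nn_integral_scaled[OF h]) (simp_all add: j_def J_def)
      then show ?thesis
        using True energy_identity[OF h power_integrable_P[OF t F p] p] P_semigroup[OF h t F p]
        by (simp add: fun_eq_iff[symmetric] ext[of "P h (P t F)" "P (t + h) F"])
    qed (simp add: j_def J_def)
    then have "ennreal h * (\<integral>\<^sup>+t. j t \<partial>lborel) + (\<integral>\<^sup>+t\<in>{0<..T}. power_energy p (P (t + h) F) \<partial>lborel)
      = (\<integral>\<^sup>+t\<in>{0<..T}. power_energy p (P t F) \<partial>lborel)"
      by (simp add: nn_integral_cmult[symmetric] nn_integral_add[symmetric])
    also have "\<dots> \<le> ennreal h * power_energy p F + (\<integral>\<^sup>+t\<in>{0<..T}. power_energy p (P (t + h) F) \<partial>lborel)"
      using antitone_increment_le[OF borel_measurable_energy[OF F] energy_antitone[OF F p] h] by simp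
    finally have "ennreal h * (\<integral>\<^sup>+t. j t \<partial>lborel) \<le> ennreal h * power_energy p F"
      using nn_integral_energy_finite[OF F p less_imp_le[OF h], of T]
      by (auto simp: ennreal_add_left_cancel_le add.commute)
    then have "(\<integral>\<^sup>+t. j t \<partial>lborel) \<le> power_energy p F"
      using h by (simp add: ennreal_mult_le_mult_iff)
    then show ?thesis
      unfolding j_def by (simp add: nn_integral_triple[OF Jm])
  qed
  have "I t x y \<le> liminf (\<lambda>n. J (H n) t x y)" for t x y
  proof (cases "t \<in> {0<..T} \<and> y \<noteq> x")
    case True
    then have t: "0 < t" by simp
    have "(\<lambda>n. k (H n) (y - x) / H n) \<longlonglongrightarrow> \<nu> (y - x)"
      using True filterlim_compose[OF k_over_t H, of "y - x"] by simp
    then have "(\<lambda>n. ennreal (bregman p (P (t + H n) F x) (P t F y) * (k (H n) (y - x) / H n)))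
        \<longlonglongrightarrow> ennreal (bregman p (P t F x) (P t F y) * \<nu> (y - x))"
      by (intro tendsto_ennrealI tendsto_mult tendsto_bregman[OF p] tendsto_const P_shift_continuous[OF F p t H])
    then have "(\<lambda>n. J (H n) t x y) \<longlonglongrightarrow> I t x y"
      using True by (simp add: J_def I_def del: times_divide_eq_right)
    from lim_imp_Liminf[OF _ this] show ?thesis by simp
  next
    case False
    then have "I t x y = 0" by (auto simp: I_def)
    then show ?thesis by simp
  qed
  then have "(\<integral>\<^sup>+(t, x, y). I t x y \<partial>lborel) \<le> (\<integral>\<^sup>+z. liminf (\<lambda>n. case z of (t, x, y) \<Rightarrow> J (H n) t x y) \<partial>lborel)"
    by (intro nn_integral_mono) auto
  also have "\<dots> \<le> liminf (\<lambda>n. \<integral>\<^sup>+(t, x, y). J (H n) t x y \<partial>lborel)"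
    by (rule nn_integral_liminf) (use Jm in auto)
  also have "\<dots> \<le> liminf (\<lambda>n::nat. power_energy p F)"
    using JE H0 by (intro Liminf_mono) auto
  also have "\<dots> = power_energy p F" by (simp add: Liminf_const)
  finally show ?thesis
    unfolding nn_integral_triple[OF Im, symmetric]
    by (simp add: I_def[abs_def] dissipation_def nn_integral_multc)
qed

text \<open>
  Dominated convergence for the difference quotients in the upper energy bound. The dominating function \<open>c\<close> times the
  integrand of the dissipation is integrable by \<open>dissipation_le_energy\<close>. What results is a bound for the energy at every
  positive time \<open>s\<close>, extended to time zero by lower semicontinuity.
\<close>

lemma energy_le_dissipation:
  fixes F :: "'a \<Rightarrow> real^'n"
  assumes F: "power_integrable p F" and p: "1 < p" and T: "0 < T"
  shows "power_energy p F \<le> power_energy p (P T F) + (\<integral>\<^sup>+t\<in>{0<..T}. dissipation p F t \<partial>lborel)"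
proof -
  note [measurable] = power_integrableD(1)[OF F]
  define H where "H n = inverse (real (Suc n))" for n
  have H0: "0 < H n" for n by (simp add: H_def)
  have H: "filterlim H (at_right 0) sequentially"
    using LIMSEQ_inverse_real_of_nat by (auto simp: filterlim_at H_def[abs_def])
  have Hlim: "H \<longlonglongrightarrow> 0"
    using LIMSEQ_inverse_real_of_nat by (simp add: H_def[abs_def])
  define K where "K h t x y = ennreal (bregman p (P t F x) (P t F y) * (k h (y - x) / h)) * indicator {0<..T} t" for h t x y
  define I where "I t x y = ennreal (bregman p (P t F x) (P t F y) * \<nu> (y - x)) * indicator {0<..T} t" for t x y
  have Km [measurable]: "(\<lambda>(t, x, y). K h t x y) \<in> borel_measurable borel" for h
    unfolding K_def borel_prod[symmetric] by measurable
  have Im [measurable]: "(\<lambda>(t, x, y). I t x y) \<in> borel_measurable borel"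
    unfolding I_def borel_prod[symmetric] by measurable
  have Ieq: "(\<integral>\<^sup>+(t, x, y). I t x y \<partial>lborel) = (\<integral>\<^sup>+t\<in>{0<..T}. dissipation p F t \<partial>lborel)"
    by (rule trans[OF nn_integral_triple[OF Im, symmetric]])
       (simp add: I_def[abs_def] dissipation_def nn_integral_multc)
  have KE: "power_energy p (P h F) \<le> power_energy p (P T F) + (\<integral>\<^sup>+(t, x, y). K h t x y \<partial>lborel)"
    if h: "0 < h" "h \<le> T" for h
  proof -
    define j where "j t = (\<integral>\<^sup>+x. \<integral>\<^sup>+y. K h t x y \<partial>lborel \<partial>lborel)" for t
    have [measurable]: "j \<in> borel_measurable borel"
      unfolding j_def[abs_def] K_def by measurable
    note [measurable] = borel_measurable_energy[OF F]
    define A where "A = (\<integral>\<^sup>+t\<in>{0<..T}. power_energy p (P (t + h) F) \<partial>lborel)"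
    have "power_energy p (P t F) * indicator {0<..T} t \<le> power_energy p (P (t + h) F) * indicator {0<..T} t + ennreal h * j t" for t
    proof (cases "t \<in> {0<..T}")
      case True
      then have t: "0 \<le> t" by simp
      have "ennreal h * j t = (\<integral>\<^sup>+x. \<integral>\<^sup>+y. ennreal (bregman p (P t F x) (P t F y) * k h (y - x)) \<partial>lborel \<partial>lborel)"
        using True by (subst nn_integral_scaled[OF h(1)]) (simp_all add: j_def K_def)
      then show ?thesis
        using True energy_upper_bound[OF h(1) power_integrable_P[OF t F p] p] P_semigroup[OF h(1) t F p]
        by (simp add: ext[of "P h (P t F)" "P (t + h) F"])
    qed simp
    then have "(\<integral>\<^sup>+t\<in>{0<..T}. power_energy p (P t F) \<partial>lborel) \<le>
      (\<integral>\<^sup>+t. power_energy p (P (t + h) F) * indicator {0<..T} t + ennreal h * j t \<partial>lborel)"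
      by (intro nn_integral_mono)
    also have "\<dots> = A + ennreal h * (\<integral>\<^sup>+t. j t \<partial>lborel)"
      by (simp add: nn_integral_cmult nn_integral_add A_def)
    finally have up: "(\<integral>\<^sup>+t\<in>{0<..T}. power_energy p (P t F) \<partial>lborel) \<le> A + ennreal h * (\<integral>\<^sup>+t. j t \<partial>lborel)" .
    have "ennreal h * power_energy p (P h F) + A
        \<le> (\<integral>\<^sup>+t\<in>{0<..T}. power_energy p (P t F) \<partial>lborel) + ennreal h * power_energy p (P T F)"
      unfolding A_def
      by (rule antitone_increment_ge[where a = "\<lambda>t. power_energy p (P t F)"])
         (use energy_antitone[OF F p] h in auto)
    also have "\<dots> \<le> A + ennreal h * (\<integral>\<^sup>+t. j t \<partial>lborel) + ennreal h * power_energy p (P T F)"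
      by (intro add_right_mono up)
    finally have "ennreal h * power_energy p (P h F) + A
        \<le> A + ennreal h * (\<integral>\<^sup>+t. j t \<partial>lborel) + ennreal h * power_energy p (P T F)" .
    then have "A + ennreal h * power_energy p (P h F) \<le> A + ennreal h * (power_energy p (P T F) + (\<integral>\<^sup>+t. j t \<partial>lborel))"
      by (simp add: algebra_simps)
    then have "ennreal h * power_energy p (P h F) \<le> ennreal h * (power_energy p (P T F) + (\<integral>\<^sup>+t. j t \<partial>lborel))"
      using nn_integral_energy_finite[OF F p less_imp_le[OF h(1)], of T]
      by (auto simp: ennreal_add_left_cancel_le A_def)
    then have "power_energy p (P h F) \<le> power_energy p (P T F) + (\<integral>\<^sup>+t. j t \<partial>lborel)"
      using h by (simp add: ennreal_mult_le_mult_iff)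
    then show ?thesis
      unfolding j_def by (simp add: nn_integral_triple[OF Km])
  qed
  have "(\<lambda>n. \<integral>\<^sup>+(t, x, y). K (H n) t x y \<partial>lborel) \<longlonglongrightarrow> (\<integral>\<^sup>+(t, x, y). I t x y \<partial>lborel)"
  proof (rule nn_integral_dominated_convergence[where w = "\<lambda>(t, x, y). ennreal c * I t x y"])
    show "(\<integral>\<^sup>+(t, x, y). ennreal c * I t x y \<partial>lborel) < \<infinity>"
    proof -
      have "(\<integral>\<^sup>+(t, x, y). ennreal c * I t x y \<partial>lborel) = ennreal c * (\<integral>\<^sup>+(t, x, y). I t x y \<partial>lborel)"
        using nn_integral_cmult[of "\<lambda>(t, x, y). I t x y" lborel "ennreal c"] Im by (simp add: case_prod_beta')
      also have "\<dots> \<le> ennreal c * power_energy p F"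
        unfolding Ieq by (intro mult_left_mono dissipation_le_energy[OF F p]) auto
      also have "\<dots> < \<infinity>"
        using F power_integrable_iff[OF power_integrableD(1)[OF F]] by (auto simp: ennreal_mult_less_top)
      finally show ?thesis .
    qed
    have "K (H n) t x y \<le> ennreal c * I t x y" for n t x y
    proof (cases "y = x")
      case False
      then have "k (H n) (y - x) / H n \<le> c * \<nu> (y - x)"
        using k_le_nu[OF H0[of n], of "y - x"] H0[of n] by (simp add: field_simps)
      then have "bregman p (P t F x) (P t F y) * (k (H n) (y - x) / H n) \<le> bregman p (P t F x) (P t F y) * (c * \<nu> (y - x))"
        by (intro mult_left_mono bregman_nonneg p)
      then show ?thesis
        using c_nonneg by (auto simp: K_def I_def ac_simps ennreal_leI split: split_indicator simp flip: ennreal_mult')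
    qed (simp add: K_def)
    then show "\<And>n. AE z in lborel. (case z of (t, x, y) \<Rightarrow> K (H n) t x y) \<le> (case z of (t, x, y) \<Rightarrow> ennreal c * I t x y)"
      by (auto simp: split_beta')
    have "(\<lambda>n. K (H n) t x y) \<longlonglongrightarrow> I t x y" for t x y
    proof (cases "y = x")
      case False
      then have "(\<lambda>n. k (H n) (y - x) / H n) \<longlonglongrightarrow> \<nu> (y - x)"
        using filterlim_compose[OF k_over_t H, of "y - x"] by simp
      then have "(\<lambda>n. ennreal (bregman p (P t F x) (P t F y) * (k (H n) (y - x) / H n)))
          \<longlonglongrightarrow> ennreal (bregman p (P t F x) (P t F y) * \<nu> (y - x))"
        by (intro tendsto_ennrealI tendsto_mult tendsto_const)
      then show ?thesis
        by (cases "t \<in> {0<..T}") (auto simp: K_def I_def simp del: times_divide_eq_right)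
    qed (simp add: K_def I_def)
    then show "AE z in lborel. (\<lambda>n. case z of (t, x, y) \<Rightarrow> K (H n) t x y) \<longlonglongrightarrow> (case z of (t, x, y) \<Rightarrow> I t x y)"
      by (auto simp: split_beta')
  qed (use Km Im in \<open>auto simp: split_beta'\<close>)
  then have lim: "(\<lambda>n. power_energy p (P T F) + (\<integral>\<^sup>+(t, x, y). K (H n) t x y \<partial>lborel))
    \<longlonglongrightarrow> power_energy p (P T F) + (\<integral>\<^sup>+t\<in>{0<..T}. dissipation p F t \<partial>lborel)"
    unfolding Ieq by (intro tendsto_intros)
  show ?thesis
  proof (rule power_energy_lower_semicontinuous[OF F p])
    fix s :: real assume s: "0 < s"
    have "\<forall>\<^sub>F n in sequentially. H n < min s T"
      by (rule order_tendstoD(2)[OF Hlim]) (use s T in simp)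
    then have "\<forall>\<^sub>F n in sequentially. power_energy p (P s F) \<le> power_energy p (P T F) + (\<integral>\<^sup>+(t, x, y). K (H n) t x y \<partial>lborel)"
    proof eventually_elim
      case (elim n)
      then have "power_energy p (P s F) \<le> power_energy p (P (H n) F)"
        using H0[of n] by (intro energy_antitone[OF F p]) auto
      also have "\<dots> \<le> power_energy p (P T F) + (\<integral>\<^sup>+(t, x, y). K (H n) t x y \<partial>lborel)"
        using elim H0[of n] by (intro KE) auto
      finally show ?case .
    qed
    then show "power_energy p (P s F) \<le> power_energy p (P T F) + (\<integral>\<^sup>+t\<in>{0<..T}. dissipation p F t \<partial>lborel)"
      by (intro tendsto_lowerbound[OF lim]) auto
  qed
qed

text \<open>
  Both inequalities hold on each \<open>{0<..T}\<close>; for \<open>T \<rightarrow> \<infinity>\<close> the remaining energy at time \<open>T\<close> disappears.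
\<close>

theorem hardy_stein:
  fixes F :: "'a \<Rightarrow> real^'n"
  assumes F: "power_integrable p F" and p: "1 < p"
  shows "power_energy p F = (\<integral>\<^sup>+t\<in>{0..}. dissipation p F t \<partial>lborel)"
proof (rule antisym)
  note [measurable] = power_integrableD(1)[OF F]
  have [measurable]: "dissipation p F \<in> borel_measurable borel"
    unfolding dissipation_def[abs_def] by measurable
  have "AE t in lborel. t \<noteq> (0::real)"
    by (rule AE_lborel_singleton)
  then have eq: "(\<integral>\<^sup>+t\<in>{0..}. dissipation p F t \<partial>lborel) = (\<integral>\<^sup>+t\<in>{0<..}. dissipation p F t \<partial>lborel)"
    by (intro nn_integral_cong_AE) (auto split: split_indicator)
  have Icc: "(\<integral>\<^sup>+t\<in>{0<..T}. dissipation p F t \<partial>lborel) \<le> (\<integral>\<^sup>+t\<in>{0<..}. dissipation p F t \<partial>lborel)" for T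
    by (intro nn_integral_mono) (auto split: split_indicator)
  show "power_energy p F \<le> (\<integral>\<^sup>+t\<in>{0..}. dissipation p F t \<partial>lborel)"
  proof (rule tendsto_lowerbound)
    show "((\<lambda>T. power_energy p (P T F) + (\<integral>\<^sup>+t\<in>{0..}. dissipation p F t \<partial>lborel))
      \<longlongrightarrow> (\<integral>\<^sup>+t\<in>{0..}. dissipation p F t \<partial>lborel)) at_top"
      using tendsto_add[OF power_energy_vanishes[OF F p] tendsto_const] by simp
    show "\<forall>\<^sub>F T in at_top. power_energy p F \<le> power_energy p (P T F) + (\<integral>\<^sup>+t\<in>{0..}. dissipation p F t \<partial>lborel)"
      using eventually_gt_at_top[of "0::real"]
    proof eventually_elim
      case (elim T)
      show ?case
        unfolding eq by (rule order_trans[OF energy_le_dissipation[OF F p elim] add_left_mono[OF Icc]])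
    qed
  qed simp
  have "(\<integral>\<^sup>+t\<in>{0<..}. dissipation p F t \<partial>lborel) = (\<integral>\<^sup>+t. (SUP n. dissipation p F t * indicator {0<..real n} t) \<partial>lborel)"
  proof (intro nn_integral_cong antisym)
    fix t :: real
    obtain n where "t \<le> real n" using real_arch_simple by blast
    then have "dissipation p F t * indicator {0<..} t \<le> dissipation p F t * indicator {0<..real n} t"
      by (auto split: split_indicator)
    then show "dissipation p F t * indicator {0<..} t \<le> (SUP n. dissipation p F t * indicator {0<..real n} t)"
      by (rule SUP_upper2[OF UNIV_I])
    show "(SUP n. dissipation p F t * indicator {0<..real n} t) \<le> dissipation p F t * indicator {0<..} t"
      by (rule SUP_least) (auto split: split_indicator)
  qed
  also have "\<dots> = (SUP n. \<integral>\<^sup>+t\<in>{0<..real n}. dissipation p F t \<partial>lborel)"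
    by (intro nn_integral_monotone_convergence_SUP) (auto simp: incseq_def le_fun_def split: split_indicator)
  also have "\<dots> \<le> power_energy p F"
    by (intro SUP_least dissipation_le_energy[OF F p])
  finally show "(\<integral>\<^sup>+t\<in>{0..}. dissipation p F t \<partial>lborel) \<le> power_energy p F"
    unfolding eq .
qed

end

section \<open>Gaussian functions and Fourier inversion\<close>

lemma has_bochner_integral_affine:
  fixes f :: "'a::euclidean_space \<Rightarrow> real"
  assumes f: "has_bochner_integral lborel f I" and c: "0 < c"
  shows "has_bochner_integral lborel (\<lambda>x. f (a + c *\<^sub>R x)) (I / c ^ DIM('a))"
proof -
  have [measurable]: "f \<in> borel_measurable borel"
    using f by (auto simp: has_bochner_integral_iff)
  have "has_bochner_integral (density (distr lborel borel (\<lambda>x. a + c *\<^sub>R x)) (\<lambda>_. ennreal (c ^ DIM('a)))) f I"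
    using f lborel_affine[of c a] c by simp
  then have "has_bochner_integral lborel (\<lambda>x. c ^ DIM('a) * f (a + c *\<^sub>R x)) I"
    using c by (simp add: has_bochner_integral_iff integrable_density integral_density integrable_distr_eq integral_distr)
  from has_bochner_integral_mult_right[OF this, of "1 / c ^ DIM('a)"] show ?thesis
    using c by simp
qed

text \<open>
  The characteristic function of the standard normal distribution, without the normalizing constant.
\<close>

lemma has_bochner_integral_iexp_gaussian:
  "has_bochner_integral lborel (\<lambda>x. iexp (s * x) * complex_of_real (exp (- x\<^sup>2 / 2)))
    (complex_of_real (sqrt (2 * pi) * exp (- s\<^sup>2 / 2)))"
proof -
  have dens: "std_normal_density x = 1 / sqrt (2 * pi) * exp (- x\<^sup>2 / 2)" for x
    by (simp add: normal_density_def)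
  have int: "integrable lborel (\<lambda>x. std_normal_density x *\<^sub>R iexp (s * x))"
    by (rule Bochner_Integration.integrable_bound[OF integrable_normal_density[of 1 0]])
       (auto simp: norm_mult)
  have "(LINT x|lborel. std_normal_density x *\<^sub>R iexp (s * x)) = complex_of_real (exp (- s\<^sup>2 / 2))"
    using fun_cong[OF char_std_normal_distribution, of s]
    by (simp add: char_def integral_density)
  with int have "has_bochner_integral lborel (\<lambda>x. sqrt (2 * pi) *\<^sub>R (std_normal_density x *\<^sub>R iexp (s * x)))
      (sqrt (2 * pi) *\<^sub>R complex_of_real (exp (- s\<^sup>2 / 2)))"
    by (intro has_bochner_integral_scaleR_right) (simp add: has_bochner_integral_iff)
  then show ?thesis
    by (simp add: dens scaleR_conv_of_real mult.commute)
qed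

text \<open>
  Lebesgue measure on a Euclidean space is the image of the product measure over the basis.
\<close>

lemma has_bochner_integral_Basis_prod:
  fixes f :: "'a::euclidean_space \<Rightarrow> real \<Rightarrow> 'b::{real_normed_field,banach,second_countable_topology}"
  assumes f: "\<And>b. b \<in> Basis \<Longrightarrow> has_bochner_integral lborel (f b) (I b)"
  shows "has_bochner_integral lborel (\<lambda>x::'a. \<Prod>b\<in>Basis. f b (x \<bullet> b)) (\<Prod>b\<in>Basis. I b)"
proof -
  interpret product_sigma_finite "\<lambda>_::'a. lborel :: real measure" ..
  have [measurable]: "b \<in> Basis \<Longrightarrow> f b \<in> borel_measurable borel" for b
    using f[of b] by (auto simp: has_bochner_integral_iff)
  have int: "b \<in> Basis \<Longrightarrow> integrable lborel (f b)" for b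
    using f by (auto simp: has_bochner_integral_iff)
  have "integrable (Pi\<^sub>M Basis (\<lambda>_. lborel)) (\<lambda>x. \<Prod>b\<in>Basis. f b (x b))"
    by (rule product_integrable_prod) (auto intro: int)
  moreover have "(\<integral>x. (\<Prod>b\<in>Basis. f b (x b)) \<partial>Pi\<^sub>M Basis (\<lambda>_. lborel)) = (\<Prod>b\<in>Basis. integral\<^sup>L lborel (f b))"
    by (rule product_integral_prod) (auto intro: int)
  moreover have "(\<Prod>b\<in>Basis. integral\<^sup>L lborel (f b)) = (\<Prod>b\<in>Basis. I b)"
    using f by (intro prod.cong) (auto simp: has_bochner_integral_iff)
  ultimately show ?thesis
    unfolding has_bochner_integral_iff
    by (subst (1 2) lborel_eq) (simp add: integrable_distr_eq integral_distr inner_sum_left inner_Basis if_distrib sum.If_cases cong: prod.cong)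
qed

definition gauss :: "'a::euclidean_space \<Rightarrow> real" where
  "gauss x = exp (- (norm x)\<^sup>2 / 2)"

lemma gauss_simps: "gauss 0 = 1" "0 < gauss x" "gauss x \<le> 1" "gauss (- x) = gauss x"
  by (auto simp: gauss_def)

lemma abs_gauss [simp]: "\<bar>gauss x\<bar> = gauss x"
  by (simp add: gauss_def)

lemma gauss_nonneg [simp]: "0 \<le> gauss x"
  by (simp add: gauss_def)

lemma continuous_gauss: "continuous_on UNIV gauss"
  unfolding gauss_def by (intro continuous_intros) simp

lemma borel_measurable_gauss [measurable]: "gauss \<in> borel_measurable borel"
  by (intro borel_measurable_continuous_onI continuous_gauss)

lemma fourier_gauss:
  "has_bochner_integral lborel (\<lambda>x::'a::euclidean_space. cos (\<xi> \<bullet> x) * gauss x) (sqrt (2 * pi) ^ DIM('a) * gauss \<xi>)"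
proof -
  have norm2: "(norm x)\<^sup>2 = (\<Sum>b\<in>Basis. (x \<bullet> b)\<^sup>2)" for x :: 'a
    unfolding power2_norm_eq_inner by (subst euclidean_inner) (simp add: power2_eq_square)
  have gauss_prod: "gauss x = (\<Prod>b\<in>Basis. exp (- (x \<bullet> b)\<^sup>2 / 2))" for x :: 'a
    by (simp add: gauss_def norm2 exp_sum[symmetric] sum_divide_distrib sum_negf)
  have "has_bochner_integral lborel (\<lambda>x::'a. \<Prod>b\<in>Basis. iexp ((\<xi> \<bullet> b) * (x \<bullet> b)) * complex_of_real (exp (- (x \<bullet> b)\<^sup>2 / 2)))
    (\<Prod>b\<in>(Basis::'a set). complex_of_real (sqrt (2 * pi) * exp (- (\<xi> \<bullet> b)\<^sup>2 / 2)))"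
    by (rule has_bochner_integral_Basis_prod) (rule has_bochner_integral_iexp_gaussian)
  also have "(\<lambda>x::'a. \<Prod>b\<in>Basis. iexp ((\<xi> \<bullet> b) * (x \<bullet> b)) * complex_of_real (exp (- (x \<bullet> b)\<^sup>2 / 2)))
    = (\<lambda>x. iexp (\<xi> \<bullet> x) * complex_of_real (gauss x))"
  proof
    fix x :: 'a
    have "(\<Prod>b\<in>Basis. iexp ((\<xi> \<bullet> b) * (x \<bullet> b))) = iexp (\<xi> \<bullet> x)"
      by (subst (2) euclidean_inner) (simp add: exp_sum[symmetric] sum_distrib_left)
    then show "(\<Prod>b\<in>Basis. iexp ((\<xi> \<bullet> b) * (x \<bullet> b)) * complex_of_real (exp (- (x \<bullet> b)\<^sup>2 / 2)))
      = iexp (\<xi> \<bullet> x) * complex_of_real (gauss x)"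
      by (simp only: prod.distrib gauss_prod of_real_prod)
  qed
  also have "(\<Prod>b\<in>(Basis::'a set). complex_of_real (sqrt (2 * pi) * exp (- (\<xi> \<bullet> b)\<^sup>2 / 2)))
    = complex_of_real (sqrt (2 * pi) ^ DIM('a) * gauss \<xi>)"
    by (simp only: of_real_prod[symmetric] prod.distrib gauss_prod prod_constant)
  finally have "has_bochner_integral lborel (\<lambda>x. Re (iexp (\<xi> \<bullet> x) * complex_of_real (gauss x)))
     (Re (complex_of_real (sqrt (2 * pi) ^ DIM('a) * gauss \<xi>)))"
    by (rule has_bochner_integral_Re)
  then show ?thesis
    by (simp add: Re_exp)
qed

lemma integral_gauss: "has_bochner_integral lborel (gauss :: 'a::euclidean_space \<Rightarrow> real) (sqrt (2 * pi) ^ DIM('a))"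
  using fourier_gauss[of "0::'a"] by (simp add: gauss_simps)

lemma integrable_gauss_scaled:
  "0 < d \<Longrightarrow> integrable lborel (\<lambda>x::'a::euclidean_space. gauss (d *\<^sub>R x))"
  using has_bochner_integral_affine[OF integral_gauss[where 'a = 'a], of d 0] by (simp add: has_bochner_integral_iff)

lemma fourier_gauss_scaled:
  assumes d: "0 < d"
  shows "has_bochner_integral lborel (\<lambda>x::'a::euclidean_space. cos (\<xi> \<bullet> x) * gauss (d *\<^sub>R x))
    (sqrt (2 * pi) ^ DIM('a) * gauss ((1 / d) *\<^sub>R \<xi>) / d ^ DIM('a))"
  using has_bochner_integral_affine[OF fourier_gauss[of "(1 / d) *\<^sub>R \<xi>"], of d 0] d by simp

text \<open>
  For even \<open>\<phi>\<close> this is the inverse Fourier transform; with cosines alone everything stays real.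
\<close>

definition fourier_cos :: "('a::euclidean_space \<Rightarrow> real) \<Rightarrow> 'a \<Rightarrow> real" where
  "fourier_cos \<phi> x = (LINT \<xi>|lborel. cos (\<xi> \<bullet> x) * \<phi> \<xi>) / (2 * pi) ^ DIM('a)"

lemma integrable_cos_mult:
  fixes \<phi> :: "'a::euclidean_space \<Rightarrow> real"
  assumes "integrable lborel \<phi>"
  shows "integrable lborel (\<lambda>\<xi>. cos (\<xi> \<bullet> x) * \<phi> \<xi>)" "integrable lborel (\<lambda>\<xi>. cos (x \<bullet> \<xi>) * \<phi> \<xi>)"
proof -
  have [measurable]: "\<phi> \<in> borel_measurable borel" using assms by auto
  show "integrable lborel (\<lambda>\<xi>. cos (\<xi> \<bullet> x) * \<phi> \<xi>)" "integrable lborel (\<lambda>\<xi>. cos (x \<bullet> \<xi>) * \<phi> \<xi>)"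
    by (rule Bochner_Integration.integrable_bound[OF assms];
        auto simp: abs_mult intro!: mult_left_le_one_le)+
qed

lemma borel_measurable_fourier_cos [measurable]:
  assumes [measurable]: "\<phi> \<in> borel_measurable borel"
  shows "fourier_cos \<phi> \<in> borel_measurable borel"
  unfolding fourier_cos_def by measurable

lemma abs_fourier_cos_le:
  fixes \<phi> :: "'a::euclidean_space \<Rightarrow> real"
  assumes "integrable lborel \<phi>"
  shows "\<bar>fourier_cos \<phi> x\<bar> \<le> (LINT \<xi>|lborel. \<bar>\<phi> \<xi>\<bar>) / (2 * pi) ^ DIM('a)"
proof -
  have "\<bar>LINT \<xi>|lborel. cos (\<xi> \<bullet> x) * \<phi> \<xi>\<bar> \<le> (LINT \<xi>|lborel. \<bar>cos (\<xi> \<bullet> x) * \<phi> \<xi>\<bar>)"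
    by (rule integral_abs_bound)
  also have "\<dots> \<le> (LINT \<xi>|lborel. \<bar>\<phi> \<xi>\<bar>)"
    using integrable_cos_mult[OF assms] assms
    by (intro integral_mono integrable_abs) (auto simp: abs_mult intro!: mult_left_le_one_le)
  finally show ?thesis by (simp add: fourier_cos_def divide_right_mono)
qed

lemma integrable_product:
  fixes f :: "'a::euclidean_space \<Rightarrow> real" and g :: "'b::euclidean_space \<Rightarrow> real"
  assumes f: "integrable lborel f" and g: "integrable lborel g"
  shows "integrable (lborel \<Otimes>\<^sub>M lborel) (\<lambda>(x, y). f x * g y)"
proof -
  have [measurable]: "f \<in> borel_measurable borel" "g \<in> borel_measurable borel" using f g by auto
  have "(\<integral>\<^sup>+z. ennreal (norm (case z of (x, y) \<Rightarrow> f x * g y)) \<partial>(lborel \<Otimes>\<^sub>M lborel))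
    = (\<integral>\<^sup>+x. \<integral>\<^sup>+y. ennreal (norm (f x)) * ennreal (norm (g y)) \<partial>lborel \<partial>lborel)"
    by (subst lborel.nn_integral_fst[symmetric]) (auto simp: abs_mult ennreal_mult)
  also have "\<dots> < \<infinity>"
    using f g by (simp add: nn_integral_cmult nn_integral_multc integrable_iff_bounded ennreal_mult_less_top)
  finally show ?thesis by (simp add: integrable_iff_bounded)
qed

text \<open>
  By Fubini's theorem the Gaussian factor is transformed first. Its transform is a narrow Gaussian around \<open>\<eta>\<close>
  and one around \<open>- \<eta>\<close>, both because \<open>cos (\<xi> \<bullet> x) cos (\<eta> \<bullet> x)\<close> is half the sum of the cosines at \<open>\<xi> - \<eta>\<close> and \<open>\<xi> + \<eta>\<close>.
  Substituting \<open>\<xi> = \<plusminus> \<eta> + d z\<close> gives the right-hand side.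
\<close>

lemma regularized_inversion:
  fixes \<phi> :: "'a::euclidean_space \<Rightarrow> real"
  assumes int: "integrable lborel \<phi>" and d: "0 < d"
  shows "(LINT x|lborel. fourier_cos \<phi> x * (cos (\<eta> \<bullet> x) * gauss (d *\<^sub>R x))) =
    (LINT z|lborel. (\<phi> (\<eta> + d *\<^sub>R z) + \<phi> (- \<eta> + d *\<^sub>R z)) / 2 * (gauss z / sqrt (2 * pi) ^ DIM('a)))"
proof -
  let ?D = "DIM('a)"
  have [measurable]: "\<phi> \<in> borel_measurable borel" using int by auto
  have sq: "(2 * pi) ^ ?D = sqrt (2 * pi) ^ ?D * sqrt (2 * pi) ^ ?D"
    by (subst power_mult_distrib[symmetric]) simp
  define G where "G y = sqrt (2 * pi) ^ ?D * gauss ((1 / d) *\<^sub>R y) / d ^ ?D" for y :: 'a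
  have Gle: "\<bar>G y\<bar> \<le> sqrt (2 * pi) ^ ?D / d ^ ?D" for y
    using d gauss_simps(2,3)[of "(1 / d) *\<^sub>R y"]
    by (simp add: G_def abs_mult divide_right_mono mult_left_le)
  have [measurable]: "G \<in> borel_measurable borel"
    unfolding G_def by measurable
  have intp: "integrable (lborel \<Otimes>\<^sub>M lborel) (\<lambda>(x, \<xi>). cos (\<xi> \<bullet> x) * \<phi> \<xi> * (cos (\<eta> \<bullet> x) * gauss (d *\<^sub>R x)))"
  proof (rule Bochner_Integration.integrable_bound)
    show "integrable (lborel \<Otimes>\<^sub>M lborel) (\<lambda>(x::'a, \<xi>). gauss (d *\<^sub>R x) * \<phi> \<xi>)"
      by (rule integrable_product[OF integrable_gauss_scaled[OF d] int])
    have "\<bar>cos (\<xi> \<bullet> x) * \<phi> \<xi> * (cos (\<eta> \<bullet> x) * gauss (d *\<^sub>R x))\<bar> \<le> \<bar>gauss (d *\<^sub>R x) * \<phi> \<xi>\<bar>" for x \<xi>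
    proof -
      have "\<bar>cos (\<xi> \<bullet> x)\<bar> * \<bar>cos (\<eta> \<bullet> x)\<bar> * \<bar>gauss (d *\<^sub>R x) * \<phi> \<xi>\<bar> \<le> \<bar>gauss (d *\<^sub>R x) * \<phi> \<xi>\<bar>"
        by (intro mult_left_le_one_le mult_le_one) auto
      then show ?thesis by (simp add: abs_mult ac_simps)
    qed
    then show "AE z in lborel \<Otimes>\<^sub>M lborel. norm (case z of (x, \<xi>) \<Rightarrow> cos (\<xi> \<bullet> x) * \<phi> \<xi> * (cos (\<eta> \<bullet> x) * gauss (d *\<^sub>R x)))
      \<le> norm (case z of (x, \<xi>) \<Rightarrow> gauss (d *\<^sub>R x) * \<phi> \<xi>)"
      by (auto simp: split_beta')
  qed auto
  have inner: "(LINT x|lborel. cos (\<xi> \<bullet> x) * \<phi> \<xi> * (cos (\<eta> \<bullet> x) * gauss (d *\<^sub>R x))) = \<phi> \<xi> * G (\<xi> - \<eta>) / 2 + \<phi> \<xi> * G (\<xi> + \<eta>) / 2" for \<xi>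
  proof -
    have "has_bochner_integral lborel (\<lambda>x. (\<phi> \<xi> / 2) * (cos ((\<xi> - \<eta>) \<bullet> x) * gauss (d *\<^sub>R x) + cos ((\<xi> + \<eta>) \<bullet> x) * gauss (d *\<^sub>R x)))
      ((\<phi> \<xi> / 2) * (G (\<xi> - \<eta>) + G (\<xi> + \<eta>)))"
      unfolding G_def
      by (intro has_bochner_integral_mult_right has_bochner_integral_add fourier_gauss_scaled d)
    also have "(\<lambda>x. (\<phi> \<xi> / 2) * (cos ((\<xi> - \<eta>) \<bullet> x) * gauss (d *\<^sub>R x) + cos ((\<xi> + \<eta>) \<bullet> x) * gauss (d *\<^sub>R x)))
      = (\<lambda>x. cos (\<xi> \<bullet> x) * \<phi> \<xi> * (cos (\<eta> \<bullet> x) * gauss (d *\<^sub>R x)))"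
      by (simp add: fun_eq_iff inner_diff_left inner_add_left cos_add cos_diff algebra_simps)
    finally show ?thesis by (simp add: has_bochner_integral_iff algebra_simps)
  qed
  have intG: "integrable lborel (\<lambda>\<xi>. \<phi> \<xi> * G (\<xi> + a))" for a
  proof (rule Bochner_Integration.integrable_bound)
    show "integrable lborel (\<lambda>\<xi>. \<phi> \<xi> * (sqrt (2 * pi) ^ ?D / d ^ ?D))" using int by simp
    show "AE \<xi> in lborel. norm (\<phi> \<xi> * G (\<xi> + a)) \<le> norm (\<phi> \<xi> * (sqrt (2 * pi) ^ ?D / d ^ ?D))"
      using Gle d by (auto simp: abs_mult simp del: times_divide_eq_right intro!: mult_left_mono)
  qed auto
  have shift: "has_bochner_integral lborel (\<lambda>z. \<phi> (- a + d *\<^sub>R z) * (gauss z / sqrt (2 * pi) ^ ?D))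
      ((LINT \<xi>|lborel. \<phi> \<xi> * G (\<xi> + a)) / (2 * pi) ^ ?D)" for a
  proof -
    have "has_bochner_integral lborel (\<lambda>z. \<phi> (- a + d *\<^sub>R z) * G (- a + d *\<^sub>R z + a)) ((LINT \<xi>|lborel. \<phi> \<xi> * G (\<xi> + a)) / d ^ ?D)"
      by (rule has_bochner_integral_affine[OF has_bochner_integral_integrable[OF intG[of a]] d])
    then have "has_bochner_integral lborel (\<lambda>z. (d ^ ?D / (2 * pi) ^ ?D) * (\<phi> (- a + d *\<^sub>R z) * G (- a + d *\<^sub>R z + a)))
      ((d ^ ?D / (2 * pi) ^ ?D) * ((LINT \<xi>|lborel. \<phi> \<xi> * G (\<xi> + a)) / d ^ ?D))"
      by (rule has_bochner_integral_mult_right)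
    also have "(\<lambda>z. (d ^ ?D / (2 * pi) ^ ?D) * (\<phi> (- a + d *\<^sub>R z) * G (- a + d *\<^sub>R z + a)))
      = (\<lambda>z. \<phi> (- a + d *\<^sub>R z) * (gauss z / sqrt (2 * pi) ^ ?D))"
    proof
      fix z
      have "d ^ ?D / (S * S) * (f * (S * g / d ^ ?D)) = f * (g / S)" if "S \<noteq> 0" for S f g :: real
        using d that by (simp add: field_simps)
      from this[of "sqrt (2 * pi) ^ ?D" "\<phi> (- a + d *\<^sub>R z)" "gauss z"]
      have eq: "d ^ ?D / (sqrt (2 * pi) ^ ?D * sqrt (2 * pi) ^ ?D) * (\<phi> (- a + d *\<^sub>R z) * (sqrt (2 * pi) ^ ?D * gauss z / d ^ ?D))
        = \<phi> (- a + d *\<^sub>R z) * (gauss z / sqrt (2 * pi) ^ ?D)" by simp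
      have arg: "(1 / d) *\<^sub>R (- a + d *\<^sub>R z + a) = z" using d by simp
      show "(d ^ ?D / (2 * pi) ^ ?D) * (\<phi> (- a + d *\<^sub>R z) * G (- a + d *\<^sub>R z + a))
        = \<phi> (- a + d *\<^sub>R z) * (gauss z / sqrt (2 * pi) ^ ?D)"
        unfolding G_def sq arg by (rule eq)
    qed
    finally show ?thesis using d by simp
  qed
  have "(LINT x|lborel. fourier_cos \<phi> x * (cos (\<eta> \<bullet> x) * gauss (d *\<^sub>R x)))
    = (LINT x|lborel. LINT \<xi>|lborel. cos (\<xi> \<bullet> x) * \<phi> \<xi> * (cos (\<eta> \<bullet> x) * gauss (d *\<^sub>R x))) / (2 * pi) ^ ?D"
    by (simp add: fourier_cos_def)
  also have "(LINT x|lborel. LINT \<xi>|lborel. cos (\<xi> \<bullet> x) * \<phi> \<xi> * (cos (\<eta> \<bullet> x) * gauss (d *\<^sub>R x)))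
    = (LINT \<xi>|lborel. LINT x|lborel. cos (\<xi> \<bullet> x) * \<phi> \<xi> * (cos (\<eta> \<bullet> x) * gauss (d *\<^sub>R x)))"
    by (rule lborel_pair.Fubini_integral[OF intp, symmetric])
  also have "\<dots> = (LINT \<xi>|lborel. \<phi> \<xi> * G (\<xi> - \<eta>)) / 2 + (LINT \<xi>|lborel. \<phi> \<xi> * G (\<xi> + \<eta>)) / 2"
    using intG[of "- \<eta>"] intG[of \<eta>] by (simp add: inner)
  finally have L: "(LINT x|lborel. fourier_cos \<phi> x * (cos (\<eta> \<bullet> x) * gauss (d *\<^sub>R x)))
    = ((LINT \<xi>|lborel. \<phi> \<xi> * G (\<xi> - \<eta>)) / (2 * pi) ^ ?D + (LINT \<xi>|lborel. \<phi> \<xi> * G (\<xi> + \<eta>)) / (2 * pi) ^ ?D) / 2"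
    by (simp add: add_divide_distrib)
  have "has_bochner_integral lborel (\<lambda>z. (\<phi> (\<eta> + d *\<^sub>R z) * (gauss z / sqrt (2 * pi) ^ ?D)
      + \<phi> (- \<eta> + d *\<^sub>R z) * (gauss z / sqrt (2 * pi) ^ ?D)) / 2)
     (((LINT \<xi>|lborel. \<phi> \<xi> * G (\<xi> - \<eta>)) / (2 * pi) ^ ?D + (LINT \<xi>|lborel. \<phi> \<xi> * G (\<xi> + \<eta>)) / (2 * pi) ^ ?D) / 2)"
    using shift[of "- \<eta>"] shift[of \<eta>] by (intro has_bochner_integral_divide_zero has_bochner_integral_add) auto
  also have "(\<lambda>z. (\<phi> (\<eta> + d *\<^sub>R z) * (gauss z / sqrt (2 * pi) ^ ?D)
      + \<phi> (- \<eta> + d *\<^sub>R z) * (gauss z / sqrt (2 * pi) ^ ?D)) / 2)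
    = (\<lambda>z. (\<phi> (\<eta> + d *\<^sub>R z) + \<phi> (- \<eta> + d *\<^sub>R z)) / 2 * (gauss z / sqrt (2 * pi) ^ ?D))"
  proof
    have "(a * q + b * q) / 2 = (a + b) / 2 * q" for a b q :: real
      by (simp add: field_simps)
    then show "(\<phi> (\<eta> + d *\<^sub>R z) * (gauss z / sqrt (2 * pi) ^ ?D)
        + \<phi> (- \<eta> + d *\<^sub>R z) * (gauss z / sqrt (2 * pi) ^ ?D)) / 2
      = (\<phi> (\<eta> + d *\<^sub>R z) + \<phi> (- \<eta> + d *\<^sub>R z)) / 2 * (gauss z / sqrt (2 * pi) ^ ?D)" for z .
  qed
  finally show ?thesis
    unfolding L by (rule has_bochner_integral_integral_eq[symmetric])
qed

lemma regularized_inversion_limit: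
  fixes \<phi> :: "'a::euclidean_space \<Rightarrow> real"
  assumes int: "integrable lborel \<phi>" and cont: "continuous_on UNIV \<phi>"
    and even: "\<And>\<xi>. \<phi> (- \<xi>) = \<phi> \<xi>" and bound: "\<And>\<xi>. \<bar>\<phi> \<xi>\<bar> \<le> 1"
    and d: "\<And>n. 0 < d n" "d \<longlonglongrightarrow> 0"
  shows "(\<lambda>n. LINT x|lborel. fourier_cos \<phi> x * (cos (\<eta> \<bullet> x) * gauss (d n *\<^sub>R x))) \<longlonglongrightarrow> \<phi> \<eta>"
proof -
  let ?s = "sqrt (2 * pi) ^ DIM('a)"
  have [measurable]: "\<phi> \<in> borel_measurable borel" using int by auto
  have norm1: "has_bochner_integral lborel (\<lambda>z::'a. gauss z / ?s) 1"
    using has_bochner_integral_divide_zero[OF integral_gauss[where 'a='a], of ?s] by simp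
  have tend: "(\<lambda>n. \<phi> (a + d n *\<^sub>R z)) \<longlonglongrightarrow> \<phi> a" for a z
  proof -
    have "(\<lambda>n. a + d n *\<^sub>R z) \<longlonglongrightarrow> a + 0 *\<^sub>R z" by (intro tendsto_intros d)
    moreover have "isCont \<phi> a" using cont by (simp add: continuous_on_eq_continuous_at)
    ultimately show ?thesis using isCont_tendsto_compose by fastforce
  qed
  have "(\<lambda>n. LINT z|lborel. (\<phi> (\<eta> + d n *\<^sub>R z) + \<phi> (- \<eta> + d n *\<^sub>R z)) / 2 * (gauss z / ?s))
    \<longlonglongrightarrow> (LINT z|lborel. (\<phi> \<eta> + \<phi> (- \<eta>)) / 2 * (gauss (z::'a) / ?s))"
  proof (rule integral_dominated_convergence[where w = "\<lambda>z. gauss z / ?s"])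
    show "integrable lborel (\<lambda>z::'a. gauss z / ?s)" using norm1 by (rule integrable.intros)
    show "AE z in lborel. (\<lambda>n. (\<phi> (\<eta> + d n *\<^sub>R z) + \<phi> (- \<eta> + d n *\<^sub>R z)) / 2 * (gauss z / ?s))
      \<longlonglongrightarrow> (\<phi> \<eta> + \<phi> (- \<eta>)) / 2 * (gauss z / ?s)"
      by (intro AE_I2 tendsto_mult tendsto_divide tendsto_add tend tendsto_const) auto
    fix n
    have "\<bar>(\<phi> (\<eta> + d n *\<^sub>R z) + \<phi> (- \<eta> + d n *\<^sub>R z)) / 2\<bar> \<le> 1" for z
      using bound[of "\<eta> + d n *\<^sub>R z"] bound[of "- \<eta> + d n *\<^sub>R z"] by simp
    then have "\<bar>(\<phi> (\<eta> + d n *\<^sub>R z) + \<phi> (- \<eta> + d n *\<^sub>R z)) / 2\<bar> * (gauss z / ?s) \<le> gauss z / ?s" for z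
      using gauss_simps(2)[of z] by (intro mult_left_le_one_le) auto
    then show "AE z in lborel. norm ((\<phi> (\<eta> + d n *\<^sub>R z) + \<phi> (- \<eta> + d n *\<^sub>R z)) / 2 * (gauss z / ?s)) \<le> gauss z / ?s"
      by (auto simp: abs_mult)
  qed auto
  also have "(LINT z|lborel. (\<phi> \<eta> + \<phi> (- \<eta>)) / 2 * (gauss (z::'a) / ?s)) = \<phi> \<eta>"
    by (subst has_bochner_integral_integral_eq[OF has_bochner_integral_mult_right[OF norm1]]) (simp add: even)
  finally show ?thesis
    by (simp only: regularized_inversion[OF int d(1)])
qed

text \<open>
  Nonnegativity of the transform is what yields its integrability: for \<open>\<eta> = 0\<close> the regularized integrals increase to the
  integral of \<open>fourier_cos \<phi>\<close> and converge to \<open>\<phi> 0\<close>. Dominated convergence then treats general \<open>\<eta>\<close>.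
\<close>

lemma fourier_inversion:
  fixes \<phi> :: "'a::euclidean_space \<Rightarrow> real"
  assumes int: "integrable lborel \<phi>" and cont: "continuous_on UNIV \<phi>"
    and even: "\<And>\<xi>. \<phi> (- \<xi>) = \<phi> \<xi>" and bound: "\<And>\<xi>. \<bar>\<phi> \<xi>\<bar> \<le> 1"
    and nonneg: "\<And>x. 0 \<le> fourier_cos \<phi> x"
  shows "has_bochner_integral lborel (\<lambda>x. cos (\<eta> \<bullet> x) * fourier_cos \<phi> x) (\<phi> \<eta>)"
proof -
  have [measurable]: "\<phi> \<in> borel_measurable borel" using int by auto
  define d where "d n = inverse (real (Suc n))" for n
  have d: "0 < d n" "d \<longlonglongrightarrow> 0" for n
    using LIMSEQ_inverse_real_of_nat by (auto simp: d_def[abs_def])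
  have glim: "(\<lambda>n. gauss (d n *\<^sub>R x)) \<longlonglongrightarrow> 1" for x :: 'a
  proof -
    have "(\<lambda>n. d n *\<^sub>R x) \<longlonglongrightarrow> 0 *\<^sub>R x" by (intro tendsto_intros d)
    moreover have "isCont gauss (0::'a)" using continuous_gauss[where 'a='a] by (simp add: continuous_on_eq_continuous_at)
    ultimately show ?thesis using isCont_tendsto_compose[of "0::'a" gauss] by (simp add: gauss_simps)
  qed
  note lim = regularized_inversion_limit[OF int cont even bound d]
  obtain B where B: "\<And>x. \<bar>fourier_cos \<phi> x\<bar> \<le> B"
    using abs_fourier_cos_le[OF int] by blast
  have intg: "integrable lborel (\<lambda>x. fourier_cos \<phi> x * gauss (d n *\<^sub>R x))" for n
  proof (rule Bochner_Integration.integrable_bound)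
    show "integrable lborel (\<lambda>x::'a. B * gauss (d n *\<^sub>R x))"
      using integrable_gauss_scaled[OF d(1), where 'a='a] by simp
    show "AE x in lborel. norm (fourier_cos \<phi> x * gauss (d n *\<^sub>R x)) \<le> norm (B * gauss (d n *\<^sub>R x))"
      using order_trans[OF B abs_ge_self] by (intro AE_I2) (simp add: abs_mult mult_right_mono)
  qed auto
  have p: "integrable lborel (fourier_cos \<phi>)"
  proof (rule integrable_monotone_convergence[of lborel "\<lambda>n x. fourier_cos \<phi> x * gauss (d n *\<^sub>R x)"])
    show "AE x in lborel. mono (\<lambda>n. fourier_cos \<phi> x * gauss (d n *\<^sub>R x))"
    proof (intro AE_I2 monoI mult_left_mono nonneg)
      fix x :: 'a and m n :: nat assume "m \<le> n"
      then have "(d n * norm x)\<^sup>2 \<le> (d m * norm x)\<^sup>2"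
        by (intro power_mono mult_right_mono) (auto simp: d_def field_simps)
      then show "gauss (d m *\<^sub>R x) \<le> gauss (d n *\<^sub>R x)"
        using d(1) by (simp add: gauss_def less_imp_le)
    qed
    show "AE x in lborel. (\<lambda>n. fourier_cos \<phi> x * gauss (d n *\<^sub>R x)) \<longlonglongrightarrow> fourier_cos \<phi> x"
      using tendsto_mult[OF tendsto_const glim] by (intro AE_I2) fastforce
    show "(\<lambda>n. LINT x|lborel. fourier_cos \<phi> x * gauss (d n *\<^sub>R x)) \<longlonglongrightarrow> \<phi> 0"
      using lim[of 0] by simp
  qed (use intg in auto)
  have "(\<lambda>n. LINT x|lborel. fourier_cos \<phi> x * (cos (\<eta> \<bullet> x) * gauss (d n *\<^sub>R x)))
    \<longlonglongrightarrow> (LINT x|lborel. cos (\<eta> \<bullet> x) * fourier_cos \<phi> x)"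
  proof (rule integral_dominated_convergence[OF _ _ p])
    show "AE x in lborel. (\<lambda>n. fourier_cos \<phi> x * (cos (\<eta> \<bullet> x) * gauss (d n *\<^sub>R x))) \<longlonglongrightarrow> cos (\<eta> \<bullet> x) * fourier_cos \<phi> x"
      using tendsto_mult[OF tendsto_const tendsto_mult[OF tendsto_const glim]] by (intro AE_I2) (fastforce simp: mult.commute)
    fix n
    have "\<bar>fourier_cos \<phi> x * (cos (\<eta> \<bullet> x) * gauss (d n *\<^sub>R x))\<bar> \<le> fourier_cos \<phi> x" for x
    proof -
      have "\<bar>cos (\<eta> \<bullet> x)\<bar> * \<bar>gauss (d n *\<^sub>R x)\<bar> * \<bar>fourier_cos \<phi> x\<bar> \<le> \<bar>fourier_cos \<phi> x\<bar>"
        using gauss_simps(2,3)[of "d n *\<^sub>R x"] by (intro mult_left_le_one_le mult_le_one) auto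
      then show ?thesis using nonneg[of x] by (simp add: abs_mult ac_simps)
    qed
    then show "AE x in lborel. norm (fourier_cos \<phi> x * (cos (\<eta> \<bullet> x) * gauss (d n *\<^sub>R x))) \<le> fourier_cos \<phi> x"
      by simp
  qed auto
  with lim[of \<eta>] have "(LINT x|lborel. cos (\<eta> \<bullet> x) * fourier_cos \<phi> x) = \<phi> \<eta>"
    by (rule LIMSEQ_unique[symmetric])
  then show ?thesis
    using integrable_cos_mult(2)[OF p, of \<eta>] by (simp add: has_bochner_integral_iff)
qed

section \<open>Functions of positive type\<close>

text \<open>
  For even \<open>h\<close> the integral is the Fourier transform; for continuous \<open>h\<close> the condition then amounts to positive
  definiteness. In this form it passes to dominated limits.
\<close>

definition positive_type :: "('a::euclidean_space \<Rightarrow> real) \<Rightarrow> bool" where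
  "positive_type h \<longleftrightarrow> integrable lborel h \<and> (\<forall>x. 0 \<le> (LINT \<xi>|lborel. cos (\<xi> \<bullet> x) * h \<xi>))"

lemma positive_type_gauss:
  assumes "0 < d"
  shows "positive_type (\<lambda>\<xi>::'a::euclidean_space. gauss (d *\<^sub>R \<xi>))"
  using fourier_gauss_scaled[OF assms, where 'a='a] integrable_gauss_scaled[OF assms, where 'a='a] assms
  by (auto simp: positive_type_def has_bochner_integral_iff inner_commute)

lemma positive_type_limit:
  fixes h :: "'a::euclidean_space \<Rightarrow> real"
  assumes pos: "\<And>n::nat. positive_type (H n)" and [measurable]: "h \<in> borel_measurable borel"
    and lim: "\<And>\<xi>. (\<lambda>n. H n \<xi>) \<longlonglongrightarrow> h \<xi>"
    and w: "integrable lborel w" "\<And>n \<xi>. \<bar>H n \<xi>\<bar> \<le> w \<xi>"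
  shows "positive_type h"
proof -
  have H: "integrable lborel (H n)" for n using pos by (simp add: positive_type_def)
  then have [measurable]: "H n \<in> borel_measurable borel" for n by auto
  have "integrable lborel h"
    by (rule integrable_dominated_convergence[where s = H and w = w]) (use lim w in auto)
  moreover have "0 \<le> (LINT \<xi>|lborel. cos (\<xi> \<bullet> x) * h \<xi>)" for x
  proof -
    have "(\<lambda>n. LINT \<xi>|lborel. cos (\<xi> \<bullet> x) * H n \<xi>) \<longlonglongrightarrow> (LINT \<xi>|lborel. cos (\<xi> \<bullet> x) * h \<xi>)"
    proof (rule integral_dominated_convergence[where w = w])
      show "AE \<xi> in lborel. (\<lambda>n. cos (\<xi> \<bullet> x) * H n \<xi>) \<longlonglongrightarrow> cos (\<xi> \<bullet> x) * h \<xi>"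
        by (intro AE_I2 tendsto_mult tendsto_const lim)
      fix n
      have "\<bar>cos (\<xi> \<bullet> x)\<bar> * \<bar>H n \<xi>\<bar> \<le> 1 * w \<xi>" for \<xi>
        using w(2)[of n \<xi>] by (intro mult_mono) auto
      then show "AE \<xi> in lborel. norm (cos (\<xi> \<bullet> x) * H n \<xi>) \<le> w \<xi>"
        by (auto simp: abs_mult)
    qed (use w in auto)
    then show ?thesis
      using pos by (intro LIMSEQ_le_const) (auto simp: positive_type_def)
  qed
  ultimately show ?thesis by (simp add: positive_type_def)
qed

lemma integrable_positive_type_mult:
  assumes h: "positive_type h" and [measurable]: "m \<in> borel_measurable borel" and m: "\<And>\<xi>. \<bar>m \<xi>\<bar> \<le> B"
  shows "integrable lborel (\<lambda>\<xi>. h \<xi> * m \<xi>)"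
proof (rule Bochner_Integration.integrable_bound)
  have int: "integrable lborel h" using h by (simp add: positive_type_def)
  then have [measurable]: "h \<in> borel_measurable borel" by auto
  show "integrable lborel (\<lambda>\<xi>. h \<xi> * B)" using int by simp
  show "AE \<xi> in lborel. norm (h \<xi> * m \<xi>) \<le> norm (h \<xi> * B)"
    using order_trans[OF m abs_ge_self] by (auto simp: abs_mult mult_left_mono)
  show "(\<lambda>\<xi>. h \<xi> * m \<xi>) \<in> borel_measurable lborel" by measurable
qed

definition cos_transform :: "('a::euclidean_space \<Rightarrow> real) \<Rightarrow> 'a \<Rightarrow> real" where
  "cos_transform \<mu> \<xi> = (LINT z|lborel. cos (\<xi> \<bullet> z) * \<mu> z)"

lemma borel_measurable_cos_transform [measurable]:
  assumes [measurable]: "\<mu> \<in> borel_measurable borel"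
  shows "cos_transform \<mu> \<in> borel_measurable borel"
  unfolding cos_transform_def[abs_def] by measurable

lemma abs_cos_transform_le:
  assumes "integrable lborel \<mu>" "\<And>z. 0 \<le> \<mu> z"
  shows "\<bar>cos_transform \<mu> \<xi>\<bar> \<le> (LINT z|lborel. \<mu> z)"
proof -
  have "\<bar>cos_transform \<mu> \<xi>\<bar> \<le> (LINT z|lborel. \<bar>cos (\<xi> \<bullet> z) * \<mu> z\<bar>)"
    unfolding cos_transform_def by (rule integral_abs_bound)
  also have "\<dots> \<le> (LINT z|lborel. \<mu> z)"
    using integrable_cos_mult[OF assms(1)] assms
    by (intro integral_mono integrable_abs) (auto simp: abs_mult intro!: mult_left_le_one_le)
  finally show ?thesis .
qed

text \<open>
  Multiplying \<open>h\<close> by \<open>cos (\<xi> \<bullet> z)\<close> averages its transform over the translations by \<open>z\<close> and \<open>- z\<close>; the cosine transform of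
  \<open>\<mu>\<close> is a superposition of such factors with nonnegative weights.
\<close>

lemma positive_type_mult:
  fixes h :: "'a::euclidean_space \<Rightarrow> real"
  assumes h: "positive_type h" and a: "0 \<le> a" "0 \<le> b"
    and \<mu>: "integrable lborel \<mu>" "\<And>z. 0 \<le> \<mu> z"
  shows "positive_type (\<lambda>\<xi>. h \<xi> * (a + b * cos_transform \<mu> \<xi>))"
proof -
  have inth: "integrable lborel h" using h by (simp add: positive_type_def)
  have [measurable]: "h \<in> borel_measurable borel" "\<mu> \<in> borel_measurable borel" using inth \<mu> by auto
  have int1: "integrable lborel (\<lambda>\<xi>. h \<xi> * cos_transform \<mu> \<xi>)"
    by (rule integrable_positive_type_mult[OF h _ abs_cos_transform_le[OF \<mu>]]) measurable
  have nn: "0 \<le> (LINT \<xi>|lborel. cos (\<xi> \<bullet> x) * (h \<xi> * cos_transform \<mu> \<xi>))" for x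
  proof -
    have intp: "integrable (lborel \<Otimes>\<^sub>M lborel) (\<lambda>(z, \<xi>). cos (\<xi> \<bullet> x) * h \<xi> * (cos (\<xi> \<bullet> z) * \<mu> z))"
    proof (rule Bochner_Integration.integrable_bound)
      show "integrable (lborel \<Otimes>\<^sub>M lborel) (\<lambda>(z, \<xi>). \<mu> z * h \<xi>)"
        by (rule integrable_product[OF \<mu>(1) inth])
      have "\<bar>cos (\<xi> \<bullet> x) * h \<xi> * (cos (\<xi> \<bullet> z) * \<mu> z)\<bar> \<le> \<bar>\<mu> z * h \<xi>\<bar>" for z \<xi>
      proof -
        have "\<bar>cos (\<xi> \<bullet> x)\<bar> * \<bar>cos (\<xi> \<bullet> z)\<bar> * \<bar>\<mu> z * h \<xi>\<bar> \<le> \<bar>\<mu> z * h \<xi>\<bar>"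
          by (intro mult_left_le_one_le mult_le_one) auto
        then show ?thesis by (simp add: abs_mult ac_simps)
      qed
      then show "AE w in lborel \<Otimes>\<^sub>M lborel. norm (case w of (z, \<xi>) \<Rightarrow> cos (\<xi> \<bullet> x) * h \<xi> * (cos (\<xi> \<bullet> z) * \<mu> z))
        \<le> norm (case w of (z, \<xi>) \<Rightarrow> \<mu> z * h \<xi>)"
        by (auto simp: split_beta')
    qed auto
    have "(LINT \<xi>|lborel. cos (\<xi> \<bullet> x) * (h \<xi> * cos_transform \<mu> \<xi>))
      = (LINT \<xi>|lborel. LINT z|lborel. cos (\<xi> \<bullet> x) * h \<xi> * (cos (\<xi> \<bullet> z) * \<mu> z))"
      by (simp add: cos_transform_def mult.assoc)
    also have "\<dots> = (LINT z|lborel. LINT \<xi>|lborel. cos (\<xi> \<bullet> x) * h \<xi> * (cos (\<xi> \<bullet> z) * \<mu> z))"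
      by (rule lborel_pair.Fubini_integral[OF intp])
    also have "\<dots> = (LINT z|lborel. \<mu> z / 2 * ((LINT \<xi>|lborel. cos (\<xi> \<bullet> (x - z)) * h \<xi>) + (LINT \<xi>|lborel. cos (\<xi> \<bullet> (x + z)) * h \<xi>)))"
    proof (rule Bochner_Integration.integral_cong[OF refl])
      fix z
      have "(LINT \<xi>|lborel. cos (\<xi> \<bullet> x) * h \<xi> * (cos (\<xi> \<bullet> z) * \<mu> z))
        = (LINT \<xi>|lborel. \<mu> z / 2 * (cos (\<xi> \<bullet> (x - z)) * h \<xi> + cos (\<xi> \<bullet> (x + z)) * h \<xi>))"
        by (intro Bochner_Integration.integral_cong)
           (simp_all add: inner_diff_right inner_add_right cos_add cos_diff field_simps)
      then show "(LINT \<xi>|lborel. cos (\<xi> \<bullet> x) * h \<xi> * (cos (\<xi> \<bullet> z) * \<mu> z))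
        = \<mu> z / 2 * ((LINT \<xi>|lborel. cos (\<xi> \<bullet> (x - z)) * h \<xi>) + (LINT \<xi>|lborel. cos (\<xi> \<bullet> (x + z)) * h \<xi>))"
        using integrable_cos_mult(1)[OF inth] by simp
    qed
    also have "\<dots> \<ge> 0"
    proof -
      have h': "0 \<le> (LINT \<xi>|lborel. cos (\<xi> \<bullet> y) * h \<xi>)" for y
        using h by (simp add: positive_type_def)
      show ?thesis
        by (intro integral_nonneg_AE AE_I2 mult_nonneg_nonneg[OF _ add_nonneg_nonneg[OF h' h']]) (simp add: \<mu>(2))
    qed
    finally show ?thesis .
  qed
  show ?thesis
    unfolding positive_type_def
  proof (intro conjI allI)
    show "integrable lborel (\<lambda>\<xi>. h \<xi> * (a + b * cos_transform \<mu> \<xi>))"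
      using inth int1 by (simp add: distrib_left mult.left_commute)
    fix x
    have "(LINT \<xi>|lborel. cos (\<xi> \<bullet> x) * (h \<xi> * (a + b * cos_transform \<mu> \<xi>)))
      = (LINT \<xi>|lborel. a * (cos (\<xi> \<bullet> x) * h \<xi>) + b * (cos (\<xi> \<bullet> x) * (h \<xi> * cos_transform \<mu> \<xi>)))"
      by (simp add: algebra_simps)
    also have "\<dots> = a * (LINT \<xi>|lborel. cos (\<xi> \<bullet> x) * h \<xi>) + b * (LINT \<xi>|lborel. cos (\<xi> \<bullet> x) * (h \<xi> * cos_transform \<mu> \<xi>))"
      using integrable_cos_mult(1)[OF inth] integrable_cos_mult(1)[OF int1] by simp
    also have "\<dots> \<ge> 0"
      using h a nn by (intro add_nonneg_nonneg mult_nonneg_nonneg) (auto simp: positive_type_def)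
    finally show "0 \<le> (LINT \<xi>|lborel. cos (\<xi> \<bullet> x) * (h \<xi> * (a + b * cos_transform \<mu> \<xi>)))" .
  qed
qed

text \<open>
  The exponential is the limit of the powers \<open>(1 + t c / n)^n\<close>, and each factor \<open>1 + t c / n\<close>
  preserves positive type.
\<close>

lemma positive_type_exp_cos_transform:
  fixes h :: "'a::euclidean_space \<Rightarrow> real"
  assumes h: "positive_type h" and t: "0 \<le> t"
    and \<mu>: "integrable lborel \<mu>" "\<And>z. 0 \<le> \<mu> z"
  shows "positive_type (\<lambda>\<xi>. h \<xi> * exp (t * cos_transform \<mu> \<xi>))"
proof -
  have inth: "integrable lborel h" using h by (simp add: positive_type_def)
  have [measurable]: "h \<in> borel_measurable borel" "\<mu> \<in> borel_measurable borel" using inth \<mu> by auto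
  have power: "positive_type (\<lambda>\<xi>. h \<xi> * (1 + b * cos_transform \<mu> \<xi>) ^ n)" if b: "0 \<le> b" for n :: nat and b
  proof (induction n)
    case (Suc n)
    from positive_type_mult[OF this _ b \<mu>, of 1] show ?case by (simp add: mult_ac)
  qed (simp add: h)
  define M where "M = t * (LINT z|lborel. \<mu> z)"
  show ?thesis
  proof (rule positive_type_limit[where H = "\<lambda>n \<xi>. h \<xi> * (1 + t / real (Suc n) * cos_transform \<mu> \<xi>) ^ Suc n"])
    show "positive_type (\<lambda>\<xi>. h \<xi> * (1 + t / real (Suc n) * cos_transform \<mu> \<xi>) ^ Suc n)" for n
      using t by (intro power) auto
    show "(\<lambda>n. h \<xi> * (1 + t / real (Suc n) * cos_transform \<mu> \<xi>) ^ Suc n) \<longlonglongrightarrow> h \<xi> * exp (t * cos_transform \<mu> \<xi>)" for \<xi>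
      using LIMSEQ_Suc[OF tendsto_exp_limit_sequentially[of "t * cos_transform \<mu> \<xi>"]]
      by (intro tendsto_mult tendsto_const) simp
    show "integrable lborel (\<lambda>\<xi>. \<bar>h \<xi>\<bar> * exp M)" using inth by simp
    fix n \<xi>
    define c where "c = cos_transform \<mu> \<xi>"
    have c: "\<bar>t * c\<bar> \<le> M"
      using abs_cos_transform_le[OF \<mu>, of \<xi>] t by (simp add: M_def c_def abs_mult mult_left_mono)
    have "\<bar>1 + t / real (Suc n) * c\<bar> \<le> 1 + \<bar>t * c\<bar> / real (Suc n)"
      by (rule order_trans[OF abs_triangle_ineq]) (simp add: abs_mult)
    then have "\<bar>1 + t / real (Suc n) * c\<bar> ^ Suc n \<le> (1 + \<bar>t * c\<bar> / real (Suc n)) ^ Suc n"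
      by (intro power_mono) auto
    also have "\<dots> \<le> exp \<bar>t * c\<bar>"
      by (intro exp_ge_one_plus_x_over_n_power_n) (auto intro: order_trans[OF _ abs_ge_zero])
    also have "\<dots> \<le> exp M" using c by simp
    finally have "\<bar>1 + t / real (Suc n) * c\<bar> ^ Suc n \<le> exp M" .
    then have "\<bar>h \<xi>\<bar> * \<bar>1 + t / real (Suc n) * c\<bar> ^ Suc n \<le> \<bar>h \<xi>\<bar> * exp M"
      by (intro mult_left_mono) auto
    then show "\<bar>h \<xi> * (1 + t / real (Suc n) * cos_transform \<mu> \<xi>) ^ Suc n\<bar> \<le> \<bar>h \<xi>\<bar> * exp M"
      by (simp only: abs_mult power_abs c_def)
  qed measurable
qed

text \<open>
  Away from the origin \<open>\<nu>\<close> has finite mass, and the exponential of the truncated exponent is a positive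
  multiple of the exponential of a cosine transform. A Gaussian factor provides integrability before the truncation is removed;
  afterwards \<open>exp (- t * \<psi>)\<close> itself serves as the bound for removing the Gaussian.
\<close>

lemma levy_fourier_cos_nonneg:
  fixes \<nu> \<psi> :: "'a::euclidean_space \<Rightarrow> real"
  assumes [measurable]: "\<nu> \<in> borel_measurable borel" and nonneg: "\<And>z. 0 \<le> \<nu> z"
    and tail: "\<And>\<delta>. 0 < \<delta> \<Longrightarrow> integrable lborel (\<lambda>z. \<nu> z * indicator {z. \<delta> \<le> norm z} z)"
    and int: "\<And>\<xi>. integrable lborel (\<lambda>z. (1 - cos (\<xi> \<bullet> z)) * \<nu> z)"
    and \<psi>: "\<And>\<xi>. \<psi> \<xi> = (LINT z|lborel. (1 - cos (\<xi> \<bullet> z)) * \<nu> z)"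
    and exp_int: "integrable lborel (\<lambda>\<xi>. exp (- t * \<psi> \<xi>))" and t: "0 \<le> t"
  shows "0 \<le> fourier_cos (\<lambda>\<xi>. exp (- t * \<psi> \<xi>)) x"
proof -
  have [measurable]: "\<psi> \<in> borel_measurable borel"
    unfolding \<psi>[abs_def] by measurable
  have \<psi>_nonneg: "0 \<le> \<psi> \<xi>" for \<xi>
    unfolding \<psi> using nonneg by (intro integral_nonneg_AE AE_I2 mult_nonneg_nonneg) auto
  have damped: "positive_type (\<lambda>\<xi>. gauss (d *\<^sub>R \<xi>) * exp (- t * \<psi> \<xi>))" if d: "0 < d" for d
  proof -
    define \<nu>' where "\<nu>' n z = \<nu> z * indicator {z. inverse (real (Suc n)) \<le> norm z} z" for n z
    define \<psi>' where "\<psi>' n \<xi> = (LINT z|lborel. (1 - cos (\<xi> \<bullet> z)) * \<nu>' n z)" for n \<xi>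
    have [measurable]: "\<nu>' n \<in> borel_measurable borel" for n unfolding \<nu>'_def by measurable
    have [measurable]: "\<psi>' n \<in> borel_measurable borel" for n unfolding \<psi>'_def by measurable
    have \<nu>': "integrable lborel (\<nu>' n)" "0 \<le> \<nu>' n z" "\<nu>' n z \<le> \<nu> z" for n z
      using tail[of "inverse (real (Suc n))"] nonneg[of z] by (auto simp: \<nu>'_def[abs_def] split: split_indicator)
    have \<psi>'_eq: "\<psi>' n \<xi> = (LINT z|lborel. \<nu>' n z) - cos_transform (\<nu>' n) \<xi>" for n \<xi>
      using \<nu>'(1) integrable_cos_mult(2)[OF \<nu>'(1)] by (simp add: \<psi>'_def cos_transform_def left_diff_distrib)
    have \<psi>'_nonneg: "0 \<le> \<psi>' n \<xi>" for n \<xi>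
      unfolding \<psi>'_def using \<nu>'(2) by (intro integral_nonneg_AE AE_I2 mult_nonneg_nonneg) auto
    have \<psi>'_lim: "(\<lambda>n. \<psi>' n \<xi>) \<longlonglongrightarrow> \<psi> \<xi>" for \<xi>
      unfolding \<psi>'_def \<psi>
    proof (rule integral_dominated_convergence[OF _ _ int])
      show "AE z in lborel. (\<lambda>n. (1 - cos (\<xi> \<bullet> z)) * \<nu>' n z) \<longlonglongrightarrow> (1 - cos (\<xi> \<bullet> z)) * \<nu> z"
      proof (intro AE_I2 tendsto_eventually)
        fix z
        show "\<forall>\<^sub>F n in sequentially. (1 - cos (\<xi> \<bullet> z)) * \<nu>' n z = (1 - cos (\<xi> \<bullet> z)) * \<nu> z"
        proof (cases "z = 0")
          case False
          then have "\<forall>\<^sub>F n in sequentially. inverse (real (Suc n)) < norm z"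
            using order_tendstoD(2)[OF LIMSEQ_inverse_real_of_nat] by simp
          then show ?thesis by eventually_elim (simp add: \<nu>'_def)
        qed simp
      qed
      show "\<And>n. AE z in lborel. norm ((1 - cos (\<xi> \<bullet> z)) * \<nu>' n z) \<le> (1 - cos (\<xi> \<bullet> z)) * \<nu> z"
        using \<nu>'(2,3) by (auto simp: abs_mult intro!: mult_left_mono)
    qed auto
    show ?thesis
    proof (rule positive_type_limit[where H = "\<lambda>n \<xi>. gauss (d *\<^sub>R \<xi>) * exp (- t * \<psi>' n \<xi>)"])
      fix n
      have "positive_type (\<lambda>\<xi>. gauss (d *\<^sub>R \<xi>) * exp (t * cos_transform (\<nu>' n) \<xi>))"
        by (rule positive_type_exp_cos_transform[OF positive_type_gauss[OF d] t \<nu>'(1,2)])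
      from positive_type_mult[OF this, of "exp (- t * (LINT z|lborel. \<nu>' n z))" 0 "\<nu>' n"] \<nu>'
      show "positive_type (\<lambda>\<xi>. gauss (d *\<^sub>R \<xi>) * exp (- t * \<psi>' n \<xi>))"
        by (simp add: \<psi>'_eq right_diff_distrib exp_diff exp_minus field_simps)
      show "(\<lambda>n. gauss (d *\<^sub>R \<xi>) * exp (- t * \<psi>' n \<xi>)) \<longlonglongrightarrow> gauss (d *\<^sub>R \<xi>) * exp (- t * \<psi> \<xi>)" for \<xi>
        by (intro tendsto_intros \<psi>'_lim)
      show "integrable lborel (\<lambda>\<xi>::'a. gauss (d *\<^sub>R \<xi>))" by (rule integrable_gauss_scaled[OF d])
      show "\<bar>gauss (d *\<^sub>R \<xi>) * exp (- t * \<psi>' n \<xi>)\<bar> \<le> gauss (d *\<^sub>R \<xi>)" for \<xi>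
        using t \<psi>'_nonneg[of n \<xi>] by (simp add: abs_mult mult_left_le)
    qed measurable
  qed
  have "positive_type (\<lambda>\<xi>. exp (- t * \<psi> \<xi>))"
  proof (rule positive_type_limit[where H = "\<lambda>n \<xi>. gauss (inverse (real (Suc n)) *\<^sub>R \<xi>) * exp (- t * \<psi> \<xi>)"])
    show "positive_type (\<lambda>\<xi>. gauss (inverse (real (Suc n)) *\<^sub>R \<xi>) * exp (- t * \<psi> \<xi>))" for n
      by (rule damped) simp
    fix \<xi> :: 'a
    have "(\<lambda>n. inverse (real (Suc n)) *\<^sub>R \<xi>) \<longlonglongrightarrow> 0 *\<^sub>R \<xi>"
      by (intro tendsto_intros LIMSEQ_inverse_real_of_nat)
    moreover have "isCont gauss (0::'a)"
      using continuous_gauss[where 'a='a] by (simp add: continuous_on_eq_continuous_at)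
    ultimately have "(\<lambda>n. gauss (inverse (real (Suc n)) *\<^sub>R \<xi>)) \<longlonglongrightarrow> 1"
      using isCont_tendsto_compose[of "0::'a" gauss] by (simp add: gauss_simps)
    from tendsto_mult[OF this tendsto_const]
    show "(\<lambda>n. gauss (inverse (real (Suc n)) *\<^sub>R \<xi>) * exp (- t * \<psi> \<xi>)) \<longlonglongrightarrow> exp (- t * \<psi> \<xi>)" by simp
    show "\<bar>gauss (inverse (real (Suc n)) *\<^sub>R \<xi>) * exp (- t * \<psi> \<xi>)\<bar> \<le> exp (- t * \<psi> \<xi>)" for n
      using gauss_simps(3)[of "inverse (real (Suc n)) *\<^sub>R \<xi>"] by (simp add: abs_mult mult_left_le_one_le)
  qed (use exp_int in auto)
  then show ?thesis by (simp add: fourier_cos_def positive_type_def)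
qed

section \<open>The convolution semigroup of a characteristic exponent\<close>

text \<open>
  What the construction of the semigroup needs to know about a characteristic exponent. The integrability assumption
  encodes growth faster than logarithmic, and the positivity assumption encodes the Levy-Khintchine form.
\<close>

locale levy_symbol =
  fixes \<psi> :: "'a::euclidean_space \<Rightarrow> real"
  assumes psi_continuous: "continuous_on UNIV \<psi>"
    and psi_0: "\<psi> 0 = 0"
    and psi_pos: "\<xi> \<noteq> 0 \<Longrightarrow> 0 < \<psi> \<xi>"
    and psi_even: "\<psi> (- \<xi>) = \<psi> \<xi>"
    and exp_psi_integrable: "0 < t \<Longrightarrow> integrable lborel (\<lambda>\<xi>. exp (- t * \<psi> \<xi>))"
    and kernel_nonneg: "0 < t \<Longrightarrow> 0 \<le> fourier_cos (\<lambda>\<xi>. exp (- t * \<psi> \<xi>)) x"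
begin

definition K :: "real \<Rightarrow> 'a \<Rightarrow> real" where
  "K t = fourier_cos (\<lambda>\<xi>. exp (- t * \<psi> \<xi>))"

lemma psi_nonneg: "0 \<le> \<psi> \<xi>"
  using psi_0 psi_pos[of \<xi>] by (cases "\<xi> = 0") auto

lemma psi_measurable [measurable]: "\<psi> \<in> borel_measurable borel"
  by (rule borel_measurable_continuous_onI[OF psi_continuous])

lemma K_transform:
  assumes t: "0 < t"
  shows "has_bochner_integral lborel (\<lambda>x. cos (\<eta> \<bullet> x) * K t x) (exp (- t * \<psi> \<eta>))"
  unfolding K_def
proof (rule fourier_inversion[OF exp_psi_integrable[OF t]])
  show "continuous_on UNIV (\<lambda>\<xi>. exp (- t * \<psi> \<xi>))"
    by (intro continuous_intros psi_continuous)
qed (use t psi_even psi_nonneg kernel_nonneg in auto)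

lemma K_even: "K t (- x) = K t x"
  by (simp add: K_def fourier_cos_def)

lemma K_at_0: "K t 0 = (LINT \<xi>|lborel. exp (- t * \<psi> \<xi>)) / (2 * pi) ^ DIM('a)"
  by (simp add: K_def fourier_cos_def)

lemma K_mass:
  assumes "0 < t"
  shows "has_bochner_integral lborel (K t) 1"
  using K_transform[OF assms, of 0] by (simp add: psi_0)

lemma K_measurable: "case_prod K \<in> borel_measurable (borel \<Otimes>\<^sub>M borel)"
  unfolding K_def fourier_cos_def by measurable

lemma K_measurable1 [measurable]: "K t \<in> borel_measurable borel"
  unfolding K_def by measurable

text \<open>
  The transforms \<open>exp (- s * \<psi>)\<close> decrease in \<open>s\<close>, so the largest change of the kernel occurs where all cosines are \<open>1\<close>.
\<close>

lemma K_oscillation: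
  assumes s: "0 < s" "s \<le> t"
  shows "\<bar>K s x - K t x\<bar> \<le> K s 0 - K t 0"
proof -
  have t: "0 < t" using s by simp
  note int = exp_psi_integrable[OF s(1)] exp_psi_integrable[OF t]
  have "\<bar>(LINT \<xi>|lborel. cos (\<xi> \<bullet> x) * exp (- s * \<psi> \<xi>)) - (LINT \<xi>|lborel. cos (\<xi> \<bullet> x) * exp (- t * \<psi> \<xi>))\<bar>
    = \<bar>LINT \<xi>|lborel. cos (\<xi> \<bullet> x) * exp (- s * \<psi> \<xi>) - cos (\<xi> \<bullet> x) * exp (- t * \<psi> \<xi>)\<bar>"
    using integrable_cos_mult(1)[OF int(1)] integrable_cos_mult(1)[OF int(2)] by simp
  also have "\<dots> \<le> (LINT \<xi>|lborel. \<bar>cos (\<xi> \<bullet> x) * exp (- s * \<psi> \<xi>) - cos (\<xi> \<bullet> x) * exp (- t * \<psi> \<xi>)\<bar>)"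
    by (rule integral_abs_bound)
  also have "\<dots> \<le> (LINT \<xi>|lborel. exp (- s * \<psi> \<xi>) - exp (- t * \<psi> \<xi>))"
  proof (intro integral_mono integrable_abs Bochner_Integration.integrable_diff integrable_cos_mult(1) int)
    fix \<xi>
    have "exp (- t * \<psi> \<xi>) \<le> exp (- s * \<psi> \<xi>)"
      using s psi_nonneg[of \<xi>] by (simp add: mult_right_mono)
    then have "\<bar>cos (\<xi> \<bullet> x)\<bar> * \<bar>exp (- s * \<psi> \<xi>) - exp (- t * \<psi> \<xi>)\<bar> \<le> exp (- s * \<psi> \<xi>) - exp (- t * \<psi> \<xi>)"
      by (simp add: mult_left_le_one_le)
    then show "\<bar>cos (\<xi> \<bullet> x) * exp (- s * \<psi> \<xi>) - cos (\<xi> \<bullet> x) * exp (- t * \<psi> \<xi>)\<bar> \<le> exp (- s * \<psi> \<xi>) - exp (- t * \<psi> \<xi>)"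
      by (simp only: abs_mult[symmetric] right_diff_distrib)
  qed
  also have "\<dots> = (LINT \<xi>|lborel. exp (- s * \<psi> \<xi>)) - (LINT \<xi>|lborel. exp (- t * \<psi> \<xi>))"
    using int by simp
  finally show ?thesis
    unfolding K_at_0 unfolding K_def fourier_cos_def diff_divide_distrib[symmetric] abs_divide
    by (simp add: divide_right_mono)
qed

lemma K_le_K0:
  assumes "0 < t"
  shows "K t x \<le> K t 0"
  using abs_fourier_cos_le[OF exp_psi_integrable[OF assms], of x]
  unfolding K_at_0 by (simp add: K_def)

lemma K_right_continuous:
  assumes t: "0 < t"
  shows "((\<lambda>s. K s 0) \<longlongrightarrow> K t 0) (at_right t)"
proof -
  have "(\<lambda>n. LINT \<xi>|lborel. exp (- X n * \<psi> \<xi>)) \<longlonglongrightarrow> (LINT \<xi>|lborel. exp (- t * \<psi> \<xi>))"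
    if X: "\<And>n. t < X n" "X \<longlonglongrightarrow> t" for X :: "nat \<Rightarrow> real"
  proof (rule integral_dominated_convergence[OF _ _ exp_psi_integrable[OF t]])
    show "AE \<xi> in lborel. (\<lambda>n. exp (- X n * \<psi> \<xi>)) \<longlonglongrightarrow> exp (- t * \<psi> \<xi>)"
      by (intro AE_I2 tendsto_intros X)
    show "\<And>n. AE \<xi> in lborel. norm (exp (- X n * \<psi> \<xi>)) \<le> exp (- t * \<psi> \<xi>)"
      using mult_right_mono[OF less_imp_le[OF X(1)] psi_nonneg] by simp
  qed measurable
  then have "((\<lambda>s. LINT \<xi>|lborel. exp (- s * \<psi> \<xi>)) \<longlongrightarrow> (LINT \<xi>|lborel. exp (- t * \<psi> \<xi>))) (at_right t)"
    by (auto simp: tendsto_at_iff_sequentially comp_def)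
  then show ?thesis
    unfolding K_at_0 by (intro tendsto_divide tendsto_const) auto
qed

lemma K_vanishes: "((\<lambda>t. K t 0) \<longlongrightarrow> 0) at_top"
proof -
  have "((\<lambda>t. LINT \<xi>|lborel. exp (- t * \<psi> \<xi>)) \<longlongrightarrow> (LINT \<xi>|(lborel::'a measure). 0)) at_top"
  proof (rule integral_dominated_convergence_at_top[where w = "\<lambda>\<xi>. exp (- 1 * \<psi> \<xi>)"])
    show "integrable lborel (\<lambda>\<xi>. exp (- 1 * \<psi> \<xi>))" by (rule exp_psi_integrable) simp
    show "\<forall>\<^sub>F t in at_top. AE \<xi> in lborel. norm (exp (- t * \<psi> \<xi>)) \<le> exp (- 1 * \<psi> \<xi>)"
      using eventually_ge_at_top[of "1::real"]
    proof eventually_elim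
      case (elim t)
      have "1 * \<psi> \<xi> \<le> t * \<psi> \<xi>" for \<xi> using elim psi_nonneg by (intro mult_right_mono) auto
      then show ?case by simp
    qed
    have "AE \<xi> in lborel. \<xi> \<noteq> (0::'a)" by (rule AE_lborel_singleton)
    then show "AE \<xi> in lborel. ((\<lambda>t. exp (- t * \<psi> \<xi>)) \<longlongrightarrow> 0) at_top"
    proof eventually_elim
      case (elim \<xi>)
      have "filterlim (\<lambda>t. t * \<psi> \<xi>) at_top at_top"
        using psi_pos[OF elim] by (intro filterlim_at_top_mult_tendsto_pos[OF tendsto_const] filterlim_ident)
      then have "filterlim (\<lambda>t. - t * \<psi> \<xi>) at_bot at_top"
        by (simp add: filterlim_uminus_at_bot)
      from filterlim_compose[OF exp_at_bot this] show ?case .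
    qed
  qed measurable
  then have "((\<lambda>t. (LINT \<xi>|lborel. exp (- t * \<psi> \<xi>)) / (2 * pi) ^ DIM('a)) \<longlongrightarrow> 0 / (2 * pi) ^ DIM('a)) at_top"
    by (intro tendsto_divide tendsto_const) auto
  then show ?thesis unfolding K_at_0 by simp
qed

text \<open>
  Transforming the factor \<open>K t\<close> back to the Fourier side leaves \<open>\<integral> cos (\<xi> \<bullet> (w - u)) K s u du\<close>. Its cosine part is
  \<open>cos (\<xi> \<bullet> w) exp (- s \<psi> \<xi>)\<close> and its sine part vanishes since \<open>K s\<close> is even.
\<close>

lemma K_conv_0:
  assumes s: "0 < s" and t: "0 < t"
  shows "(LINT u|lborel. K s u * K t (w - u)) = K (s + t) w"
proof -
  let ?c = "(2 * pi) ^ DIM('a)"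
  have intK: "integrable lborel (K s)" using K_mass[OF s] by (simp add: has_bochner_integral_iff)
  note intE = exp_psi_integrable[OF t]
  have intp: "integrable (lborel \<Otimes>\<^sub>M lborel) (\<lambda>(u, \<xi>). K s u * (cos (\<xi> \<bullet> (w - u)) * exp (- t * \<psi> \<xi>)))"
  proof (rule Bochner_Integration.integrable_bound)
    show "integrable (lborel \<Otimes>\<^sub>M lborel) (\<lambda>(u, \<xi>). K s u * exp (- t * \<psi> \<xi>))"
      by (rule integrable_product[OF intK intE])
    show "AE z in lborel \<Otimes>\<^sub>M lborel. norm (case z of (u, \<xi>) \<Rightarrow> K s u * (cos (\<xi> \<bullet> (w - u)) * exp (- t * \<psi> \<xi>)))
      \<le> norm (case z of (u, \<xi>) \<Rightarrow> K s u * exp (- t * \<psi> \<xi>))"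
      by (auto simp: split_beta' abs_mult intro!: mult_left_mono mult_left_le_one_le)
  qed measurable
  have sin_int: "integrable lborel (\<lambda>u. sin (\<xi> \<bullet> u) * K s u)" for \<xi>
    by (rule Bochner_Integration.integrable_bound[OF intK])
       (auto simp: abs_mult intro!: mult_left_le_one_le)
  have sin_0: "(LINT u|lborel. sin (\<xi> \<bullet> u) * K s u) = 0" for \<xi>
  proof -
    have "has_bochner_integral lborel (\<lambda>u. sin (\<xi> \<bullet> (0 - u)) * K s (0 - u)) (LINT u|lborel. sin (\<xi> \<bullet> u) * K s u)"
      by (rule has_bochner_integral_reflect[OF has_bochner_integral_integrable[OF sin_int]])
    then show ?thesis
      by (simp add: has_bochner_integral_iff K_even)
  qed
  have inner: "(LINT u|lborel. K s u * (cos (\<xi> \<bullet> (w - u)) * exp (- t * \<psi> \<xi>))) = cos (\<xi> \<bullet> w) * exp (- (s + t) * \<psi> \<xi>)" for \<xi>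
  proof -
    have "(LINT u|lborel. K s u * (cos (\<xi> \<bullet> (w - u)) * exp (- t * \<psi> \<xi>)))
      = (LINT u|lborel. exp (- t * \<psi> \<xi>) * cos (\<xi> \<bullet> w) * (cos (\<xi> \<bullet> u) * K s u) + exp (- t * \<psi> \<xi>) * sin (\<xi> \<bullet> w) * (sin (\<xi> \<bullet> u) * K s u))"
      by (intro Bochner_Integration.integral_cong) (simp_all add: inner_diff_right cos_diff algebra_simps)
    also have "\<dots> = exp (- t * \<psi> \<xi>) * cos (\<xi> \<bullet> w) * exp (- s * \<psi> \<xi>)"
      using K_transform[OF s, of \<xi>] sin_int[of \<xi>] sin_0[of \<xi>] by (simp add: has_bochner_integral_iff)
    also have "\<dots> = cos (\<xi> \<bullet> w) * exp (- (s + t) * \<psi> \<xi>)"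
      by (simp add: algebra_simps flip: exp_add)
    finally show ?thesis .
  qed
  have "(LINT u|lborel. K s u * K t (w - u))
    = (LINT u|lborel. LINT \<xi>|lborel. K s u * (cos (\<xi> \<bullet> (w - u)) * exp (- t * \<psi> \<xi>))) / ?c"
    by (simp add: K_def[of t] fourier_cos_def)
  also have "(LINT u|lborel. LINT \<xi>|lborel. K s u * (cos (\<xi> \<bullet> (w - u)) * exp (- t * \<psi> \<xi>)))
    = (LINT \<xi>|lborel. LINT u|lborel. K s u * (cos (\<xi> \<bullet> (w - u)) * exp (- t * \<psi> \<xi>)))"
    by (rule lborel_pair.Fubini_integral[OF intp, symmetric])
  finally show ?thesis
    by (simp only: inner K_def[of "s + t"] fourier_cos_def)
qed

lemma K_conv:
  assumes s: "0 < s" and t: "0 < t"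
  shows "(LINT y|lborel. K s (y - x) * K t (z - y)) = K (s + t) (z - x)"
proof -
  have "(LINT y|lborel. K s (y - x) * K t (z - y)) = (LINT u|lborel. K s (x + u - x) * K t (z - (x + u)))"
    by (subst lborel_distr_plus[of x, symmetric], subst integral_distr) auto
  also have "\<dots> = (LINT u|lborel. K s u * K t ((z - x) - u))"
    by (simp add: algebra_simps)
  finally show ?thesis by (simp add: K_conv_0[OF s t])
qed

sublocale convolution_semigroup K
proof
  show "0 < t \<Longrightarrow> 0 \<le> K t x" for t x
    using kernel_nonneg[of t x] by (simp add: K_def)
qed (fact K_measurable K_le_K0 K_mass K_conv K_oscillation K_right_continuous K_vanishes)+

end

section \<open>Characteristic exponents of Levy densities\<close>

lemma one_minus_cos_le:
  fixes \<xi> z :: "'a::euclidean_space"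
  shows "1 - cos (\<xi> \<bullet> z) \<le> 2 * (1 + (norm \<xi>)\<^sup>2) * min ((norm z)\<^sup>2) 1"
proof (cases "norm z < 1")
  case True
  then have z: "min ((norm z)\<^sup>2) 1 = (norm z)\<^sup>2"
    by (simp add: min_def power_le_one)
  have sin2: "(sin ((\<xi> \<bullet> z) / 2))\<^sup>2 \<le> ((\<xi> \<bullet> z) / 2)\<^sup>2"
    using power_mono[OF abs_sin_x_le_abs_x[of "(\<xi> \<bullet> z) / 2"] abs_ge_zero, of 2] by (simp only: power2_abs)
  have "1 - cos (\<xi> \<bullet> z) = 2 * (sin ((\<xi> \<bullet> z) / 2))\<^sup>2"
    using cos_double_sin[of "(\<xi> \<bullet> z) / 2"] by simp
  also have "\<dots> \<le> 2 * ((\<xi> \<bullet> z) / 2)\<^sup>2"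
    using sin2 by simp
  also have "\<dots> \<le> (\<xi> \<bullet> z)\<^sup>2"
    by (simp add: power_divide)
  also have "\<dots> \<le> (norm \<xi> * norm z)\<^sup>2"
    using Cauchy_Schwarz_ineq2[of \<xi> z] by (simp add: abs_le_square_iff[symmetric])
  also have "\<dots> \<le> 2 * (1 + (norm \<xi>)\<^sup>2) * (norm z)\<^sup>2"
    unfolding power_mult_distrib by (intro mult_right_mono) auto
  finally show ?thesis by (simp add: z)
next
  case False
  then have z: "min ((norm z)\<^sup>2) 1 = 1"
    using False one_le_power[of "norm z" 2] by (intro min.absorb2) simp
  have "1 - cos (\<xi> \<bullet> z) \<le> 2" using cos_ge_minus_one[of "\<xi> \<bullet> z"] by linarith
  also have "\<dots> \<le> 2 * (1 + (norm \<xi>)\<^sup>2) * min ((norm z)\<^sup>2) 1" unfolding z by simp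
  finally show ?thesis .
qed

text \<open>
  The exceptional set is a countable union of parallel hyperplanes.
\<close>

lemma AE_cos_inner_neq_1:
  fixes \<xi> :: "'a::euclidean_space"
  assumes "\<xi> \<noteq> 0"
  shows "AE z in lborel. cos (\<xi> \<bullet> z) \<noteq> 1"
proof -
  have "AE z in lborel. \<xi> \<bullet> z \<noteq> real_of_int n * 2 * pi" for n
  proof -
    have "{z. \<xi> \<bullet> z = real_of_int n * 2 * pi} \<in> null_sets lborel"
      using negligible_hyperplane[of \<xi> "real_of_int n * 2 * pi"] assms closed_hyperplane[of \<xi> "real_of_int n * 2 * pi"]
      by (auto simp: negligible_iff_null_sets null_sets_completion_iff)
    from AE_not_in[OF this] show ?thesis by simp
  qed
  then have "AE z in lborel. \<forall>n. \<xi> \<bullet> z \<noteq> real_of_int n * 2 * pi"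
    by (simp add: AE_all_countable)
  then show ?thesis
    by eventually_elim (simp add: cos_one_2pi_int)
qed

lemma integrable_prod_inverse_1_plus_square:
  "integrable lborel (\<lambda>x::'a::euclidean_space. \<Prod>b\<in>Basis. inverse (1 + (x \<bullet> b)\<^sup>2))"
proof -
  have "integrable lborel (\<lambda>x::real. inverse (1 + x\<^sup>2))"
    using integrable_inverse_1_plus_square by (simp add: set_integrable_def)
  then show ?thesis
    by (intro integrable.intros[OF has_bochner_integral_Basis_prod[OF has_bochner_integral_integrable]])
qed

text \<open>
  Growth faster than every multiple of \<open>ln\<close> makes \<open>exp (- t * \<psi>)\<close> decay faster than every power. The power
  \<open>norm \<xi>\<close> to the exponent \<open>- 2 * DIM('a)\<close> is convenient because it is comparable to a bound by a product of integrable
  functions of one variable.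
\<close>

lemma integrable_exp_of_log_growth:
  fixes \<psi> :: "'a::euclidean_space \<Rightarrow> real"
  assumes [measurable]: "\<psi> \<in> borel_measurable borel" and nonneg: "\<And>\<xi>. 0 \<le> \<psi> \<xi>"
    and growth: "filterlim (\<lambda>\<xi>. \<psi> \<xi> / ln (norm \<xi>)) at_top at_infinity" and t: "0 < t"
  shows "integrable lborel (\<lambda>\<xi>. exp (- t * \<psi> \<xi>))"
proof -
  let ?D = "DIM('a)"
  have "\<forall>\<^sub>F \<xi> in at_infinity. 2 * real ?D / t \<le> \<psi> \<xi> / ln (norm \<xi>)"
    using growth by (simp add: filterlim_at_top)
  then obtain R0 where R0: "\<And>\<xi>. R0 \<le> norm \<xi> \<Longrightarrow> 2 * real ?D / t \<le> \<psi> \<xi> / ln (norm \<xi>)"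
    by (auto simp: eventually_at_infinity)
  define R where "R = max R0 2"
  define q where "q \<xi> = (\<Prod>b\<in>Basis. 1 + (\<xi> \<bullet> b)\<^sup>2)" for \<xi> :: 'a
  have q_pos: "0 < q \<xi>" for \<xi>
    unfolding q_def by (intro prod_pos) (simp add: add_pos_nonneg)
  have q_le: "q \<xi> \<le> (1 + (norm \<xi>)\<^sup>2) ^ ?D" for \<xi>
  proof -
    have "q \<xi> \<le> (\<Prod>b\<in>(Basis::'a set). 1 + (norm \<xi>)\<^sup>2)"
      unfolding q_def using Basis_le_norm[of _ \<xi>] by (intro prod_mono) (auto simp: abs_le_square_iff[symmetric])
    then show ?thesis by simp
  qed
  \<comment> \<open>The first summand serves for \<open>norm \<xi> \<le> R\<close>, the second one for larger \<open>\<xi>\<close>.\<close>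
  define C where "C = (1 + R\<^sup>2) ^ ?D + 2 ^ ?D"
  have bound: "exp (- t * \<psi> \<xi>) \<le> C * inverse (q \<xi>)" for \<xi>
  proof (cases "norm \<xi> \<le> R")
    case True
    have "exp (- t * \<psi> \<xi>) * q \<xi> \<le> 1 * (1 + R\<^sup>2) ^ ?D"
    proof (intro mult_mono)
      have "(norm \<xi>)\<^sup>2 \<le> R\<^sup>2" using True by (intro power_mono) auto
      then show "q \<xi> \<le> (1 + R\<^sup>2) ^ ?D"
        by (intro order_trans[OF q_le] power_mono) auto
    qed (use t nonneg[of \<xi>] q_pos[of \<xi>] in auto)
    also have "\<dots> \<le> C" by (simp add: C_def)
    finally show ?thesis using q_pos[of \<xi>] by (simp add: field_simps)
  next
    case False
    define r where "r = norm \<xi>"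
    have r: "2 < r" "R0 \<le> r" using False by (auto simp: r_def R_def)
    have lnr: "0 < ln r" using r by simp
    have "2 * real ?D / t \<le> \<psi> \<xi> / ln r"
      using R0[of \<xi>] r by (simp add: r_def)
    then have "2 * real ?D * ln r \<le> t * \<psi> \<xi>"
      using lnr t by (simp add: field_simps)
    then have "exp (- t * \<psi> \<xi>) \<le> exp (- (real (2 * ?D) * ln r))"
      by simp
    also have "\<dots> = inverse (r ^ (2 * ?D))"
      using r exp_of_nat_mult[of "2 * ?D" "ln r"] by (simp add: exp_minus del: of_nat_mult)
    finally have e: "exp (- t * \<psi> \<xi>) \<le> inverse (r ^ (2 * ?D))" .
    have "exp (- t * \<psi> \<xi>) * q \<xi> \<le> inverse (r ^ (2 * ?D)) * (2 * r\<^sup>2) ^ ?D"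
    proof (intro mult_mono e)
      have "1 + r\<^sup>2 \<le> 2 * r\<^sup>2" using r one_le_power[of r 2] by simp
      then show "q \<xi> \<le> (2 * r\<^sup>2) ^ ?D"
        by (intro order_trans[OF q_le] power_mono) (auto simp: r_def)
    qed (use r q_pos[of \<xi>] in auto)
    also have "\<dots> = 2 ^ ?D"
      using r by (simp add: power_mult_distrib power_mult)
    also have "\<dots> \<le> C" by (simp add: C_def)
    finally show ?thesis using q_pos[of \<xi>] by (simp add: field_simps)
  qed
  show ?thesis
  proof (rule Bochner_Integration.integrable_bound)
    show "integrable lborel (\<lambda>\<xi>. C * inverse (q \<xi>))"
      using integrable_prod_inverse_1_plus_square[where 'a='a] by (simp add: q_def prod_inversef[symmetric] comp_def)
    show "AE \<xi> in lborel. norm (exp (- t * \<psi> \<xi>)) \<le> norm (C * inverse (q \<xi>))"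
      using order_trans[OF bound abs_ge_self] by simp
  qed measurable
qed

locale levy_density =
  fixes \<nu> :: "'a::euclidean_space \<Rightarrow> real"
  assumes nu_borel [measurable]: "\<nu> \<in> borel_measurable borel"
    and nu_nn: "0 \<le> \<nu> z"
    and nu_pos: "z \<noteq> 0 \<Longrightarrow> 0 < \<nu> z"
    and nu_levy: "integrable lborel (\<lambda>z. min ((norm z)\<^sup>2) 1 * \<nu> z)"
begin

definition \<psi> :: "'a \<Rightarrow> real" where
  "\<psi> \<xi> = (LINT z|lborel. (1 - cos (\<xi> \<bullet> z)) * \<nu> z)"

lemma psi_bound:
  assumes "norm \<xi> \<le> B"
  shows "\<bar>(1 - cos (\<xi> \<bullet> z)) * \<nu> z\<bar> \<le> 2 * (1 + B\<^sup>2) * (min ((norm z)\<^sup>2) 1 * \<nu> z)"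
proof -
  have "(norm \<xi>)\<^sup>2 \<le> B\<^sup>2" using assms by (intro power_mono) auto
  then have "2 * (1 + (norm \<xi>)\<^sup>2) * min ((norm z)\<^sup>2) 1 \<le> 2 * (1 + B\<^sup>2) * min ((norm z)\<^sup>2) 1"
    by (intro mult_right_mono) auto
  with one_minus_cos_le[of \<xi> z] have "1 - cos (\<xi> \<bullet> z) \<le> 2 * (1 + B\<^sup>2) * min ((norm z)\<^sup>2) 1"
    by linarith
  then have "(1 - cos (\<xi> \<bullet> z)) * \<nu> z \<le> 2 * (1 + B\<^sup>2) * min ((norm z)\<^sup>2) 1 * \<nu> z"
    using nu_nn by (intro mult_right_mono)
  then show ?thesis using nu_nn[of z] by (simp add: abs_mult mult.assoc)
qed

lemma psi_integrable: "integrable lborel (\<lambda>z. (1 - cos (\<xi> \<bullet> z)) * \<nu> z)"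
  by (rule Bochner_Integration.integrable_bound[OF integrable_mult_right[OF nu_levy, of "2 * (1 + (norm \<xi>)\<^sup>2)"]])
     (use order_trans[OF psi_bound[OF order_refl] abs_ge_self] in auto)

lemma tail_integrable:
  assumes \<delta>: "0 < \<delta>"
  shows "integrable lborel (\<lambda>z. \<nu> z * indicator {z. \<delta> \<le> norm z} z)"
proof (rule Bochner_Integration.integrable_bound[OF integrable_mult_right[OF nu_levy, of "inverse (min (\<delta>\<^sup>2) 1)"]])
  have "\<bar>\<nu> z * indicator {z. \<delta> \<le> norm z} z\<bar> \<le> inverse (min (\<delta>\<^sup>2) 1) * (min ((norm z)\<^sup>2) 1 * \<nu> z)" for z
  proof (cases "\<delta> \<le> norm z")
    case True
    then have "\<delta>\<^sup>2 \<le> (norm z)\<^sup>2" using \<delta> by (intro power_mono) auto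
    then have "min (\<delta>\<^sup>2) 1 \<le> min ((norm z)\<^sup>2) 1" by (rule min.mono) simp
    moreover have "0 < min (\<delta>\<^sup>2) 1" using \<delta> by simp
    ultimately have "1 \<le> inverse (min (\<delta>\<^sup>2) 1) * min ((norm z)\<^sup>2) 1"
      by (metis left_inverse less_imp_le less_irrefl mult_left_mono positive_imp_inverse_positive)
    from mult_right_mono[OF this nu_nn[of z]] show ?thesis
      using True nu_nn[of z] by (simp add: mult.assoc)
  next
    case False
    then show ?thesis using nu_nn[of z] \<delta> by simp
  qed
  then show "AE z in lborel. norm (\<nu> z * indicator {z. \<delta> \<le> norm z} z) \<le> norm (inverse (min (\<delta>\<^sup>2) 1) * (min ((norm z)\<^sup>2) 1 * \<nu> z))"
    using order_trans[OF _ abs_ge_self] by (intro AE_I2) (simp only: real_norm_def, blast)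
qed measurable

lemma continuous_psi: "continuous_on UNIV \<psi>"
proof -
  have "(\<lambda>n. \<psi> (X n)) \<longlonglongrightarrow> \<psi> \<xi>" if X: "X \<longlonglongrightarrow> \<xi>" for X :: "nat \<Rightarrow> 'a" and \<xi>
  proof -
    obtain B where B: "\<And>n. norm (X n) \<le> B"
      using convergent_imp_Bseq[OF convergentI[OF X]] by (auto simp: Bseq_def)
    show ?thesis
      unfolding \<psi>_def
    proof (rule integral_dominated_convergence[where w = "\<lambda>z. 2 * (1 + B\<^sup>2) * (min ((norm z)\<^sup>2) 1 * \<nu> z)"])
      show "AE z in lborel. (\<lambda>n. (1 - cos (X n \<bullet> z)) * \<nu> z) \<longlonglongrightarrow> (1 - cos (\<xi> \<bullet> z)) * \<nu> z"
        by (intro AE_I2 tendsto_intros X)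
      show "AE z in lborel. norm ((1 - cos (X n \<bullet> z)) * \<nu> z) \<le> 2 * (1 + B\<^sup>2) * (min ((norm z)\<^sup>2) 1 * \<nu> z)" for n
        using psi_bound[OF B[of n]] by simp
    qed (use nu_levy in auto)
  qed
  then show ?thesis by (auto simp: continuous_on_sequentially comp_def)
qed

text \<open>
  Otherwise \<open>cos (\<xi> \<bullet> z) = 1\<close> for almost every \<open>z\<close>, because \<open>\<nu>\<close> is positive off the origin.
\<close>

lemma psi_positive:
  assumes "\<xi> \<noteq> 0"
  shows "0 < \<psi> \<xi>"
proof (rule ccontr)
  have nn: "AE z in lborel. 0 \<le> (1 - cos (\<xi> \<bullet> z)) * \<nu> z"
    using nu_nn by (intro AE_I2 mult_nonneg_nonneg) auto
  assume "\<not> 0 < \<psi> \<xi>"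
  with integral_nonneg_AE[OF nn] have "\<psi> \<xi> = 0" by (simp add: \<psi>_def)
  then have "AE z in lborel. (1 - cos (\<xi> \<bullet> z)) * \<nu> z = 0"
    using integral_nonneg_eq_0_iff_AE[OF psi_integrable nn] by (simp add: \<psi>_def)
  moreover have "AE z in lborel. z \<noteq> (0::'a)" by (rule AE_lborel_singleton)
  ultimately have "AE z in (lborel :: 'a measure). False"
    using AE_cos_inner_neq_1[OF assms]
  proof eventually_elim
    case (elim z)
    then show ?case using nu_pos[of z] by auto
  qed
  then obtain N where N: "{x \<in> space (lborel :: 'a measure). \<not> False} \<subseteq> N" "emeasure lborel N = 0"
    by (rule AE_E)
  then have "N = UNIV" by auto
  with N(2) show False by (simp add: emeasure_lborel_UNIV)
qed

lemma levy_symbol_psi: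
  assumes growth: "filterlim (\<lambda>\<xi>. \<psi> \<xi> / ln (norm \<xi>)) at_top at_infinity"
  shows "levy_symbol \<psi>"
proof
  have nonneg: "0 \<le> \<psi> \<xi>" for \<xi>
    unfolding \<psi>_def using nu_nn by (intro integral_nonneg_AE AE_I2 mult_nonneg_nonneg) auto
  show int: "integrable lborel (\<lambda>\<xi>. exp (- t * \<psi> \<xi>))" if "0 < t" for t
    using borel_measurable_continuous_onI[OF continuous_psi] nonneg growth that
    by (rule integrable_exp_of_log_growth)
  show "0 \<le> fourier_cos (\<lambda>\<xi>. exp (- t * \<psi> \<xi>)) x" if t: "0 < t" for t x
    by (rule levy_fourier_cos_nonneg[OF nu_borel nu_nn tail_integrable psi_integrable \<psi>_def int[OF t] less_imp_le[OF t]])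
qed (use continuous_psi psi_positive in \<open>auto simp: \<psi>_def\<close>)

end

section \<open>The Hardy-Stein identity\<close>

lemma heat_kernel_eq_fourier_cos:
  fixes \<nu> :: "real^'d \<Rightarrow> real"
  assumes int: "integrable lborel (\<lambda>\<xi>. exp (- t * levy_exponent \<nu> \<xi>))"
  shows "heat_kernel \<nu> t x = fourier_cos (\<lambda>\<xi>. exp (- t * levy_exponent \<nu> \<xi>)) x"
proof -
  define e where "e \<xi> = exp (- t * levy_exponent \<nu> \<xi>)" for \<xi>
  have e: "integrable lborel e" using int by (simp add: e_def[abs_def])
  then have [measurable]: "e \<in> borel_measurable borel" by auto
  have "integrable lborel (\<lambda>\<xi>. exp (- \<i> * complex_of_real (\<xi> \<bullet> x)) * complex_of_real (e \<xi>))"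
    by (rule Bochner_Integration.integrable_bound[OF e]) (auto simp: norm_mult)
  then have "Re (LINT \<xi>|lborel. exp (- \<i> * complex_of_real (\<xi> \<bullet> x)) * complex_of_real (e \<xi>))
    = (LINT \<xi>|lborel. Re (exp (- \<i> * complex_of_real (\<xi> \<bullet> x)) * complex_of_real (e \<xi>)))"
    by (rule integral_Re[symmetric])
  also have "\<dots> = (LINT \<xi>|lborel. cos (\<xi> \<bullet> x) * e \<xi>)"
    by (simp add: Re_exp)
  finally have Re: "Re (LINT \<xi>|lborel. exp (- \<i> * complex_of_real (\<xi> \<bullet> x)) * complex_of_real (e \<xi>))
    = (LINT \<xi>|lborel. cos (\<xi> \<bullet> x) * e \<xi>)" .
  have Re_mult: "Re (complex_of_real a * z) = a * Re z" for a z by simp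
  have const: "(2 * pi) powr (- real CARD('d)) = inverse ((2 * pi) ^ CARD('d))"
    by (simp only: powr_minus) (subst powr_realpow, simp_all)
  show ?thesis
    unfolding heat_kernel_def fourier_cos_def e_def[symmetric] const Re_mult Re
    by (simp add: divide_inverse mult.commute)
qed

theorem theorem3p1:
  fixes \<nu> :: "real^'d \<Rightarrow> real" and F :: "real^'d \<Rightarrow> real^'n" and p :: real
  assumes nu_borel: "\<nu> \<in> borel_measurable (restrict_space borel (UNIV - {0}))"
    and nu_pos: "\<And>z. z \<noteq> 0 \<Longrightarrow> \<nu> z > 0"
    and nu_sym: "\<And>z. z \<noteq> 0 \<Longrightarrow> \<nu> (- z) = \<nu> z"
    and nu_levy: "(\<integral>\<^sup>+z. ennreal (min ((norm z)\<^sup>2) 1 * \<nu> z) \<partial>lborel) < \<infinity>"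
    and psi_growth:
      "filterlim (\<lambda>\<xi>. levy_exponent \<nu> \<xi> / ln (norm \<xi>)) at_top at_infinity"
    and kernel_bound:
      "\<exists>c. \<forall>t>0. \<forall>x y. x \<noteq> y \<longrightarrow> heat_kernel \<nu> t (y - x) / t \<le> c * \<nu> (y - x)"
    and kernel_limit:
      "\<And>x y. x \<noteq> y \<Longrightarrow> ((\<lambda>t. heat_kernel \<nu> t (y - x) / t) \<longlongrightarrow> \<nu> (y - x)) (at_right 0)"
    and p_gt_1: "1 < p"
    and F_Lp: "in_Lp p F"
  shows "(\<integral>\<^sup>+x. ennreal (norm (F x) powr p) \<partial>lborel) =
    (\<integral>\<^sup>+t\<in>{0..}.
      (\<integral>\<^sup>+y. (\<integral>\<^sup>+x.
        ennreal (bregman p (vec_heat_semigroup \<nu> t F x) (vec_heat_semigroup \<nu> t F y) * \<nu> (y - x))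
      \<partial>lborel) \<partial>lborel)
    \<partial>lborel)"
proof -
  \<comment> \<open>Measurability and sign of \<open>\<nu>\<close> are only known off the origin, so its value there is reset.\<close>
  define \<nu>0 where "\<nu>0 z = (if z = 0 then 0 else \<nu> z)" for z
  have \<nu>0_eq: "\<nu>0 = (\<lambda>z. indicator (UNIV - {0}) z *\<^sub>R \<nu> z)"
    by (auto simp: \<nu>0_def fun_eq_iff)
  have [measurable]: "\<nu>0 \<in> borel_measurable borel"
    using nu_borel unfolding \<nu>0_eq by (subst (asm) borel_measurable_restrict_space_iff) auto
  have \<nu>0_nn: "0 \<le> \<nu>0 z" for z
    using nu_pos[of z] by (auto simp: \<nu>0_def)
  have min_eq: "min ((norm z)\<^sup>2) 1 * \<nu>0 z = min ((norm z)\<^sup>2) 1 * \<nu> z" for z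
    by (auto simp: \<nu>0_def)
  interpret D: levy_density \<nu>0
  proof
    show "integrable lborel (\<lambda>z. min ((norm z)\<^sup>2) 1 * \<nu>0 z)"
      using nu_levy \<nu>0_nn by (simp add: integrable_iff_bounded min_eq[symmetric] abs_mult)
  qed (use \<nu>0_nn nu_pos in \<open>auto simp: \<nu>0_def\<close>)
  have psi: "levy_exponent \<nu> = D.\<psi>"
  proof
    show "levy_exponent \<nu> \<xi> = D.\<psi> \<xi>" for \<xi>
      unfolding levy_exponent_def D.\<psi>_def by (intro Bochner_Integration.integral_cong) (auto simp: \<nu>0_def)
  qed
  interpret L: levy_symbol D.\<psi>
    using psi_growth unfolding psi by (rule D.levy_symbol_psi)
  have kernel: "heat_kernel \<nu> t x = L.K t x" if "0 < t" for t x
    using heat_kernel_eq_fourier_cos[of t \<nu> x] L.exp_psi_integrable[OF that] by (simp add: psi L.K_def)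
  obtain c where c: "\<And>t x y. 0 < t \<Longrightarrow> x \<noteq> y \<Longrightarrow> heat_kernel \<nu> t (y - x) / t \<le> c * \<nu> (y - x)"
    using kernel_bound by blast
  interpret S: levy_semigroup L.K \<nu>0 "\<bar>c\<bar>"
  proof
    show "(\<integral>\<^sup>+z. ennreal (\<nu>0 z) * indicator {z. \<delta> \<le> norm z} z \<partial>lborel) < \<infinity>" if "0 < \<delta>" for \<delta>
    proof -
      have "(\<integral>\<^sup>+z. ennreal (\<nu>0 z) * indicator {z. \<delta> \<le> norm z} z \<partial>lborel)
        = (\<integral>\<^sup>+z. ennreal (norm (\<nu>0 z * indicator {z. \<delta> \<le> norm z} z)) \<partial>lborel)"
        using \<nu>0_nn by (intro nn_integral_cong) (auto split: split_indicator)
      also have "\<dots> < \<infinity>"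
        using D.tail_integrable[OF that] by (simp add: integrable_iff_bounded)
      finally show ?thesis .
    qed
    show "L.K t x \<le> t * (\<bar>c\<bar> * \<nu>0 x)" if t: "0 < t" and x: "x \<noteq> 0" for t x
    proof -
      have "L.K t x / t \<le> c * \<nu>0 x"
        using c[OF t, of 0 x] x by (simp add: kernel[OF t] \<nu>0_def)
      also have "\<dots> \<le> \<bar>c\<bar> * \<nu>0 x"
        by (intro mult_right_mono \<nu>0_nn) simp
      finally show ?thesis using t by (simp add: field_simps)
    qed
    show "((\<lambda>t. L.K t x / t) \<longlongrightarrow> \<nu>0 x) (at_right 0)" if x: "x \<noteq> 0" for x
    proof (rule Lim_transform_eventually)
      show "((\<lambda>t. heat_kernel \<nu> t x / t) \<longlongrightarrow> \<nu>0 x) (at_right 0)"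
        using kernel_limit[of 0 x] x by (simp add: \<nu>0_def)
      show "\<forall>\<^sub>F t in at_right 0. heat_kernel \<nu> t x / t = L.K t x / t"
        using eventually_at_right_less[of "0::real"] by eventually_elim (simp add: kernel)
    qed
  qed (use \<nu>0_nn in auto)
  have F: "power_integrable p F"
    using F_Lp by (simp add: in_Lp_def power_integrable_def)
  note [measurable] = power_integrableD(1)[OF F]
  have semigroup: "vec_heat_semigroup \<nu> t F x = L.P t F x" if t: "0 \<le> t" for t x
  proof (cases "t = 0")
    case False
    with t have t: "0 < t" by simp
    have "(LINT y|lborel. F y $ i * heat_kernel \<nu> t (y - x)) = (LINT y|lborel. L.K t (y - x) *\<^sub>R F y) $ i" for i
      using integral_bounded_linear[OF bounded_linear_vec_nth[of i] L.integrable_k_scaleR[OF t F p_gt_1, of x]]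
      by (simp add: kernel[OF t] mult.commute)
    then show ?thesis
      using t by (simp add: vec_heat_semigroup_def heat_semigroup_def L.P_def vec_eq_iff)
  qed (simp add: vec_heat_semigroup_def heat_semigroup_def vec_eq_iff)
  have diss: "(\<integral>\<^sup>+y. \<integral>\<^sup>+x. ennreal (bregman p (vec_heat_semigroup \<nu> t F x) (vec_heat_semigroup \<nu> t F y) * \<nu> (y - x)) \<partial>lborel \<partial>lborel)
    = S.dissipation p F t" if t: "0 \<le> t" for t
  proof -
    have "bregman p (L.P t F x) (L.P t F y) * \<nu> (y - x) = bregman p (L.P t F x) (L.P t F y) * \<nu>0 (y - x)" for x y
      by (cases "x = y") (auto simp: \<nu>0_def)
    then have "(\<integral>\<^sup>+y. \<integral>\<^sup>+x. ennreal (bregman p (vec_heat_semigroup \<nu> t F x) (vec_heat_semigroup \<nu> t F y) * \<nu> (y - x)) \<partial>lborel \<partial>lborel)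
      = (\<integral>\<^sup>+y. \<integral>\<^sup>+x. ennreal (bregman p (L.P t F x) (L.P t F y) * \<nu>0 (y - x)) \<partial>lborel \<partial>lborel)"
      by (simp only: semigroup[OF t])
    also have "\<dots> = S.dissipation p F t"
      unfolding S.dissipation_def by (rule lborel_pair.Fubini') measurable
    finally show ?thesis .
  qed
  have "(\<integral>\<^sup>+x. ennreal (norm (F x) powr p) \<partial>lborel) = (\<integral>\<^sup>+t\<in>{0..}. S.dissipation p F t \<partial>lborel)"
    using S.hardy_stein[OF F p_gt_1] by (simp add: power_energy_def)
  also have "\<dots> = (\<integral>\<^sup>+t\<in>{0..}.
      (\<integral>\<^sup>+y. (\<integral>\<^sup>+x.
        ennreal (bregman p (vec_heat_semigroup \<nu> t F x) (vec_heat_semigroup \<nu> t F y) * \<nu> (y - x))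
      \<partial>lborel) \<partial>lborel)
    \<partial>lborel)"
    by (intro nn_integral_cong) (simp add: diss split: split_indicator)
  finally show ?thesis .
qed

end
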